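(* Let $\Phi$ be a finite crystallographic root system with a fixed choice of positive roots, and let $W(\Phi)$ be its Weyl group. An element $w\in W(\Phi)$ is boolean if and only if $w$ avoids (i.e. does not contain) each of the following Billey–Postnikov patterns: (1) $s_1s_2s_1=s_2s_1s_2\in W(A_2)$; (2) $s_2s_1s_3s_2\in W(A_3)$; (3) each of the three elements of $W(B_2)$ of Coxeter length at least $3$ (namely $s_1s_2s_1$, $s_2s_1s_2$, and $s_1s_2s_1s_2=s_2s_1s_2s_1$); (4) $s_2s_1s_3s_2\in W(B_3)$; (5) $s_2s_1s_3s_2\in W(C_3)$; (6) $s_2s_1s_3s_4s_2\in W(D_4)$; (7) each of the seven elements of $W(G_2)$ of Coxeter length at least $3$.
   Context: For a finite crystallographic root system $\Phi$ in a Euclidean space $E$ with positive roots $\Phi^+$ and simple roots $\Delta$, $W(\Phi)$ is the group generated by the reflections $s_\alpha$, $\alpha\in\Phi$; $s_i$ denotes the reflection in the simple root $\alpha_i$. The (strong) Bruhat order on $W$ is the transitive closure of $w\lessdot ws_\beta$ whenever $\ell(ws_\beta)=\ell(w)+1$, $\ell$ the Coxeter length. An element $w$ is boolean if the Bruhat interval $[\mathrm{id},w]$ is isomorphic to a Boolean lattice. The inversion set is $I_\Phi(w)=\{\beta\in\Phi^+ : w\beta\in-\Phi^+\}$; it determines $w$. For a subspace $E'\subset E$, $\Phi'=\Phi\cap E'$ is a root system with positive roots $\Phi^+\cap E'$, and the restriction $w|_{\Phi'}$ is the unique element of $W(\Phi')$ with inversion set $I_\Phi(w)\cap E'$. We say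 $w\in W(\Phi)$ contains the BP (Billey–Postnikov) pattern $\pi\in W(R)$ (with $R$ a root system with chosen positive roots) if there is a subspace $E'\subset E$ and an isomorphism of root systems $\Phi\cap E'\cong R$ preserving the chosen positive roots and sending $w|_{\Phi\cap E'}$ to $\pi$; otherwise $w$ avoids $\pi$. Labelling of simple roots: $A_2$: $\alpha_1,\alpha_2$; $A_3$: $\alpha_1=e_1-e_2,\alpha_2=e_2-e_3,\alpha_3=e_3-e_4$ (a path $\alpha_1-\alpha_2-\alpha_3$); $B_3$: $\alpha_1=e_1-e_2,\alpha_2=e_2-e_3,\alpha_3=e_3$; $C_3$: $\alpha_1=e_1-e_2,\alpha_2=e_2-e_3,\alpha_3=2e_3$; $D_4$: $\alpha_1=e_1-e_2,\alpha_2=e_2-e_3,\alpha_3=e_3-e_4,\alpha_4=e_3+e_4$ (so $\alpha_2$ is the central node), with positive roots the standard ones ($e_i\pm e_j$, $i<j$, together with $e_i$ in type $B$, $2e_i$ in type $C$). *)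

theory Defs
  imports "HOL-Analysis.Analysis" "HOL-Algebra.Bij" "HOL-Algebra.Generated_Groups"
begin

definition cartan_number :: "'a::real_inner \<Rightarrow> 'a \<Rightarrow> real" where
  "cartan_number \<beta> \<alpha> = 2 * (\<beta> \<bullet> \<alpha>) / (\<alpha> \<bullet> \<alpha>)"

definition reflection :: "'a::real_inner \<Rightarrow> 'a \<Rightarrow> 'a" where
  "reflection \<alpha> x = x - cartan_number x \<alpha> *\<^sub>R \<alpha>"

text \<open>Finite (reduced) crystallographic root systems.  The roots need not span the ambient
  type: \<open>\<Phi>\<close> is a root system in \<open>span \<Phi>\<close>, so that \<open>\<Phi> \<inter> E'\<close> is again
  a root system in this sense for every subspace \<open>E'\<close>.\<close>

definition root_system :: "'a::euclidean_space set \<Rightarrow> bool" where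
  "root_system \<Phi> \<longleftrightarrow>
     finite \<Phi> \<and> 0 \<notin> \<Phi> \<and>
     (\<forall>\<alpha>\<in>\<Phi>. \<forall>c. c *\<^sub>R \<alpha> \<in> \<Phi> \<longleftrightarrow> c = 1 \<or> c = - 1) \<and>
     (\<forall>\<alpha>\<in>\<Phi>. reflection \<alpha> ` \<Phi> = \<Phi>) \<and>
     (\<forall>\<alpha>\<in>\<Phi>. \<forall>\<beta>\<in>\<Phi>. cartan_number \<beta> \<alpha> \<in> \<int>)"

definition positive_roots :: "'a::euclidean_space set \<Rightarrow> 'a set \<Rightarrow> bool" where
  "positive_roots \<Phi> P \<longleftrightarrow>
     (\<exists>h. (\<forall>\<alpha>\<in>\<Phi>. h \<bullet> \<alpha> \<noteq> 0) \<and> P = {\<alpha>\<in>\<Phi>. h \<bullet> \<alpha> > 0})"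

definition simple_roots :: "'a::euclidean_space set \<Rightarrow> 'a set" where
  "simple_roots P = {\<alpha>\<in>P. \<not> (\<exists>\<beta>\<in>P. \<exists>\<gamma>\<in>P. \<alpha> = \<beta> + \<gamma>)}"

definition weyl_group :: "'a::euclidean_space set \<Rightarrow> ('a \<Rightarrow> 'a) set" where
  "weyl_group \<Phi> = generate (BijGroup UNIV) (reflection ` \<Phi>)"

definition refl_word :: "'a::euclidean_space list \<Rightarrow> 'a \<Rightarrow> 'a" where
  "refl_word \<alpha>s = foldr (\<circ>) (map reflection \<alpha>s) id"

definition coxeter_length :: "'a::euclidean_space set \<Rightarrow> ('a \<Rightarrow> 'a) \<Rightarrow> nat" where
  "coxeter_length P w =
     (LEAST n. \<exists>\<alpha>s. length \<alpha>s = n \<and> set \<alpha>s \<subseteq> simple_roots P \<and> w = refl_word \<alpha>s)"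

definition bruhat_cover ::
    "'a::euclidean_space set \<Rightarrow> 'a set \<Rightarrow> ('a \<Rightarrow> 'a) \<Rightarrow> ('a \<Rightarrow> 'a) \<Rightarrow> bool" where
  "bruhat_cover \<Phi> P u v \<longleftrightarrow>
     u \<in> weyl_group \<Phi> \<and>
     (\<exists>\<beta>\<in>\<Phi>. v = u \<circ> reflection \<beta> \<and> coxeter_length P v = coxeter_length P u + 1)"

definition bruhat_le ::
    "'a::euclidean_space set \<Rightarrow> 'a set \<Rightarrow> ('a \<Rightarrow> 'a) \<Rightarrow> ('a \<Rightarrow> 'a) \<Rightarrow> bool" where
  "bruhat_le \<Phi> P = (bruhat_cover \<Phi> P)\<^sup>*\<^sup>*"

definition bruhat_interval ::
    "'a::euclidean_space set \<Rightarrow> 'a set \<Rightarrow> ('a \<Rightarrow> 'a) \<Rightarrow> ('a \<Rightarrow> 'a) \<Rightarrow> ('a \<Rightarrow> 'a) set" where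
  "bruhat_interval \<Phi> P u v =
     {x \<in> weyl_group \<Phi>. bruhat_le \<Phi> P u x \<and> bruhat_le \<Phi> P x v}"

text \<open>The interval is finite, so a Boolean lattice is the lattice of subsets of a finite set.\<close>

definition boolean_element :: "'a::euclidean_space set \<Rightarrow> 'a set \<Rightarrow> ('a \<Rightarrow> 'a) \<Rightarrow> bool" where
  "boolean_element \<Phi> P w \<longleftrightarrow>
     (\<exists>(n::nat) f. bij_betw f (bruhat_interval \<Phi> P id w) (Pow {1..n}) \<and>
        (\<forall>u\<in>bruhat_interval \<Phi> P id w. \<forall>v\<in>bruhat_interval \<Phi> P id w.
           bruhat_le \<Phi> P u v \<longleftrightarrow> f u \<subseteq> f v))"

definition inversion_set :: "'a::euclidean_space set \<Rightarrow> ('a \<Rightarrow> 'a) \<Rightarrow> 'a set" where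
  "inversion_set P w = {\<beta>\<in>P. w \<beta> \<in> uminus ` P}"

definition weyl_restrict ::
    "'a::euclidean_space set \<Rightarrow> 'a set \<Rightarrow> ('a \<Rightarrow> 'a) \<Rightarrow> 'a set \<Rightarrow> 'a \<Rightarrow> 'a" where
  "weyl_restrict \<Phi> P w E' =
     (THE w'. w' \<in> weyl_group (\<Phi> \<inter> E') \<and>
        inversion_set (P \<inter> E') w' = inversion_set P w \<inter> E')"

text \<open>Only the values of \<open>\<phi>\<close> on \<open>span \<Phi>\<close> matter; it is a linear isomorphism
  from \<open>span \<Phi>\<close> onto \<open>span R\<close>, not necessarily an isometry.\<close>

definition root_system_iso ::
    "('a::euclidean_space \<Rightarrow> 'b::euclidean_space) \<Rightarrow> 'a set \<Rightarrow> 'b set \<Rightarrow> bool" where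
  "root_system_iso \<phi> \<Phi> R \<longleftrightarrow>
     linear \<phi> \<and> bij_betw \<phi> (span \<Phi>) (span R) \<and> \<phi> ` \<Phi> = R \<and>
     (\<forall>\<alpha>\<in>\<Phi>. \<forall>\<beta>\<in>\<Phi>. cartan_number (\<phi> \<beta>) (\<phi> \<alpha>) = cartan_number \<beta> \<alpha>)"

definition all_roots :: "'a::euclidean_space set \<Rightarrow> 'a set" where
  "all_roots Q = Q \<union> uminus ` Q"

text \<open>The pattern \<open>\<pi>\<close> lives in the Weyl group of the root system \<open>all_roots Q\<close>
  with positive roots \<open>Q\<close>.\<close>

definition contains_BP ::
    "'a::euclidean_space set \<Rightarrow> 'a set \<Rightarrow> ('a \<Rightarrow> 'a) \<Rightarrow>
     'b::euclidean_space set \<Rightarrow> ('b \<Rightarrow> 'b) \<Rightarrow> bool" where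
  "contains_BP \<Phi> P w Q \<pi> \<longleftrightarrow>
     (\<exists>E' \<phi>. subspace E' \<and> root_system_iso \<phi> (\<Phi> \<inter> E') (all_roots Q) \<and>
        \<phi> ` (P \<inter> E') = Q \<and>
        (\<forall>x\<in>span (\<Phi> \<inter> E'). \<phi> (weyl_restrict \<Phi> P w E' x) = \<pi> (\<phi> x)))"

abbreviation avoids_BP ::
    "'a::euclidean_space set \<Rightarrow> 'a set \<Rightarrow> ('a \<Rightarrow> 'a) \<Rightarrow>
     'b::euclidean_space set \<Rightarrow> ('b \<Rightarrow> 'b) \<Rightarrow> bool" where
  "avoids_BP \<Phi> P w Q \<pi> \<equiv> \<not> contains_BP \<Phi> P w Q \<pi>"

text \<open>Standard basis vectors \<open>e\<^sub>1, \<dots>, e\<^sub>n\<close> of \<open>real ^ n\<close>, indexed by natural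
  numbers because the numeral \<open>n\<close> equals \<open>0\<close> in the index type \<open>n\<close>, which
  makes the order of that type unsuitable for conditions like \<open>i < j\<close>.\<close>

definition std_e :: "nat \<Rightarrow> real ^ 'n::{finite, comm_ring_1}" where
  "std_e i = axis (of_nat i) 1"

text \<open>\<open>A\<^sub>n\<close> lives in \<open>real ^ (n + 1)\<close>; the other classical types of rank \<open>n\<close>
  live in \<open>real ^ n\<close>.\<close>

definition pos_A :: "nat \<Rightarrow> (real ^ 'n::{finite, comm_ring_1}) set" where
  "pos_A n = {std_e i - std_e j |i j. 1 \<le> i \<and> i < j \<and> j \<le> n + 1}"

definition pos_D :: "nat \<Rightarrow> (real ^ 'n::{finite, comm_ring_1}) set" where
  "pos_D n = {std_e i - std_e j |i j. 1 \<le> i \<and> i < j \<and> j \<le> n} \<union>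
             {std_e i + std_e j |i j. 1 \<le> i \<and> i < j \<and> j \<le> n}"

definition pos_B :: "nat \<Rightarrow> (real ^ 'n::{finite, comm_ring_1}) set" where
  "pos_B n = pos_D n \<union> {std_e i |i. 1 \<le> i \<and> i \<le> n}"

definition pos_C :: "nat \<Rightarrow> (real ^ 'n::{finite, comm_ring_1}) set" where
  "pos_C n = pos_D n \<union> {2 *\<^sub>R std_e i |i. 1 \<le> i \<and> i \<le> n}"

definition simple_A :: "nat \<Rightarrow> real ^ 'n::{finite, comm_ring_1}" where
  "simple_A i = std_e i - std_e (i + 1)"

definition simple_B :: "nat \<Rightarrow> nat \<Rightarrow> real ^ 'n::{finite, comm_ring_1}" where
  "simple_B n i = (if i = n then std_e n else std_e i - std_e (i + 1))"

definition simple_C :: "nat \<Rightarrow> nat \<Rightarrow> real ^ 'n::{finite, comm_ring_1}" where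
  "simple_C n i = (if i = n then 2 *\<^sub>R std_e n else std_e i - std_e (i + 1))"

definition simple_D :: "nat \<Rightarrow> nat \<Rightarrow> real ^ 'n::{finite, comm_ring_1}" where
  "simple_D n i = (if i = n then std_e (n - 1) + std_e n else std_e i - std_e (i + 1))"

text \<open>\<open>G\<^sub>2\<close> in the plane \<open>x\<^sub>1 + x\<^sub>2 + x\<^sub>3 = 0\<close>, with simple roots
  \<open>\<alpha>\<close> (short) and \<open>\<beta>\<close> (long).\<close>

definition pos_G2 :: "(real ^ 3) set" where
  "pos_G2 =
     (let \<alpha> = std_e 1 - std_e 2; \<beta> = - 2 *\<^sub>R std_e 1 + std_e 2 + std_e 3
      in {\<alpha>, \<beta>, \<alpha> + \<beta>, 2 *\<^sub>R \<alpha> + \<beta>, 3 *\<^sub>R \<alpha> + \<beta>, 3 *\<^sub>R \<alpha> + 2 *\<^sub>R \<beta>})"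

end

(* An element w with reduced word a_1 ... a_k has exactly k inversions, and they span the same
   subspace as the letters a_1, ..., a_k.  Hence the inversions are linearly independent if and only
   if no letter is repeated, and by the subword property of the Bruhat order this is equivalent
   to w being boolean.  Linear independence passes to subspaces, and each of the listed patterns has
   dependent inversions, so a boolean element avoids them.  Conversely, let E' be a subspace of
   minimal dimension n such that w has dependent inversions in E'.  Then any n of them are
   independent.  Applied to a reduced word of the restriction of w to E', this says that the last
   n + 1 letters are c b_1 ... b_(n-1) c, with distinct simple roots b_i that are all adjacent to c
   in the Dynkin diagram.  There are no triangles in the diagram, so it is a star, the word has no
   further letters if n > 2, and positive definiteness leaves only the listed patterns. *)

theory Submission
  imports Defs
begin

section \<open>Words of reflections\<close>

text \<open>Letters and inversions span the same space because each inversion is its letter plus a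
  combination of later letters.

  Minimality gives independence of any \<open>n\<close> inversions because at most \<open>n\<close>
  dependent ones would span a subspace of dimension below \<open>n\<close> that already carries a
  dependency. This is played against one linear relation: the first inversion of a word
  \<open>c b_1 ... b_(n-1) c\<close> is a combination of the others whose coefficients are Cartan
  numbers of \<open>c\<close>, so none of these may vanish.

  If a further letter precedes the word, the window of \<open>n + 1\<close> letters can be moved one
  step to the left. This makes the last leaf a second centre, adjacent to the old centre and to all
  other leaves, which is a triangle as soon as there are two leaves. With a single leaf there is no
  conflict, and longer elements do occur; hence the lists of all elements of length at least 3 in
  types B2 and G2.

  Positive definiteness enters as one inequality: the products of opposite Cartan numbers along the
  edges of a star add up to less than 4.\<close>

lemma cartan_number_add: "cartan_number (x + y) a = cartan_number x a + cartan_number y a"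
  by (simp add: cartan_number_def inner_add_left add_divide_distrib distrib_left)

lemma cartan_number_diff: "cartan_number (x - y) a = cartan_number x a - cartan_number y a"
  by (simp add: cartan_number_def inner_diff_left diff_divide_distrib right_diff_distrib)

lemma cartan_number_scale: "cartan_number (c *\<^sub>R x) a = c * cartan_number x a"
  by (simp add: cartan_number_def)

lemma cartan_number_uminus_left: "cartan_number (- x) a = - cartan_number x a"
  by (simp add: cartan_number_def)

lemma cartan_number_self: "a \<noteq> 0 \<Longrightarrow> cartan_number a a = 2"
  by (simp add: cartan_number_def)

lemma linear_reflection: "linear (reflection a)"
  by (rule linearI)
    (simp_all add: reflection_def cartan_number_add cartan_number_scale algebra_simps)

text \<open>Division by zero gives zero, so \<open>reflection 0\<close> is the identity; the case
  split covers this degenerate letter.\<close>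

lemma reflection_uminus_self [simp]: "reflection a a = - a"
  by (cases "a = 0") (simp_all add: reflection_def cartan_number_def scaleR_2)

lemma reflection_reflection [simp]: "reflection a (reflection a x) = x"
  by (cases "a = 0")
    (simp_all add: reflection_def cartan_number_def inner_diff_left algebra_simps)

lemma reflection_uminus: "reflection (- a) = reflection a"
  by (rule ext) (simp add: reflection_def cartan_number_def)

lemma reflection_commute:
  assumes "cartan_number a b = 0" shows "reflection a \<circ> reflection b = reflection b \<circ> reflection a"
proof -
  have "cartan_number b a = 0"
    using assms by (auto simp: cartan_number_def inner_commute)
  then show ?thesis
    using assms
    by (auto simp: fun_eq_iff reflection_def cartan_number_def algebra_simps)
qed

lemma inner_reflection: "reflection a x \<bullet> reflection a y = x \<bullet> y"
  by (cases "a = 0")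
    (simp_all add: reflection_def cartan_number_def inner_diff_left inner_diff_right
      algebra_simps inner_commute)

lemma refl_word_Nil [simp]: "refl_word [] = id"
  by (simp add: refl_word_def)

lemma refl_word_Cons: "refl_word (a # as) = reflection a \<circ> refl_word as"
  by (simp add: refl_word_def)

lemma refl_word_append: "refl_word (as @ bs) = refl_word as \<circ> refl_word bs"
  by (induction as) (simp_all add: refl_word_Cons comp_assoc)

lemma refl_word_single: "refl_word [a] = reflection a"
  by (simp add: refl_word_Cons)

lemma linear_refl_word: "linear (refl_word as)"
proof (induction as)
  case (Cons a as)
  then show ?case
    unfolding refl_word_Cons by (rule linear_compose) (rule linear_reflection)
qed (simp add: linear_id[unfolded id_def] id_def)

lemma inner_refl_word: "refl_word as x \<bullet> refl_word as y = x \<bullet> y"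
  by (induction as) (simp_all add: refl_word_Cons inner_reflection)

lemma refl_word_rev [simp]: "refl_word (rev as) (refl_word as x) = x"
  by (induction as arbitrary: x) (simp_all add: refl_word_Cons refl_word_append)

lemma refl_word_rev' [simp]: "refl_word as (refl_word (rev as) x) = x"
  using refl_word_rev[of "rev as"] by simp

lemma refl_word_rev_comp: "refl_word (rev as) \<circ> refl_word as = id"
  by (rule ext) simp

lemma refl_word_rev_comp': "refl_word as \<circ> refl_word (rev as) = id"
  by (rule ext) simp

lemma bij_refl_word: "bij (refl_word as)"
  by (rule o_bij[of "refl_word (rev as)"]) (simp_all add: refl_word_rev_comp refl_word_rev_comp')

lemma refl_word_eq_iff [simp]: "refl_word as x = refl_word as y \<longleftrightarrow> x = y"
  by (metis refl_word_rev)

lemma refl_word_uminus [simp]: "refl_word as (- x) = - refl_word as x"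
  by (rule linear_neg[OF linear_refl_word])

lemma cartan_number_refl_word:
  "cartan_number (refl_word as x) (refl_word as a) = cartan_number x a"
  by (simp add: cartan_number_def inner_refl_word)

text \<open>A linear isometry conjugates a reflection into the reflection in the image vector, and
  the inverse of a word is its reversal.\<close>

lemma reflection_refl_word:
  "reflection (refl_word as b) = refl_word as \<circ> reflection b \<circ> refl_word (rev as)"
proof
  fix x
  have "refl_word as (reflection b (refl_word (rev as) x))
      = x - cartan_number (refl_word (rev as) x) b *\<^sub>R refl_word as b"
    by (simp add: reflection_def linear_diff[OF linear_refl_word] linear_scale[OF linear_refl_word])
  also have "cartan_number (refl_word (rev as) x) b = cartan_number x (refl_word as b)"
    by (metis cartan_number_refl_word refl_word_rev')
  finally show "reflection (refl_word as b) x = (refl_word as \<circ> reflection b \<circ> refl_word (rev as)) x"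
    by (simp add: reflection_def)
qed

text \<open>Each letter moves a vector only along itself. The support and coordinate arguments rest
  on this.\<close>

lemma refl_word_minus_in_span: "refl_word as x - x \<in> span (set as)"
proof (induction as)
  case (Cons a as)
  let ?y = "refl_word as x"
  have eq: "refl_word (a # as) x - x = (?y - x) - cartan_number ?y a *\<^sub>R a"
    by (simp add: refl_word_Cons reflection_def)
  have "?y - x \<in> span (set (a # as))"
    using Cons span_mono[of "set as" "set (a # as)"] by auto
  then show ?case
    unfolding eq by (rule span_diff) (simp add: span_scale span_base)
qed (simp add: span_zero)

text \<open>If the word \<open>as\<close> is reduced, these are the inversions of \<open>refl_word as\<close>.\<close>

fun inv_roots :: "'a::euclidean_space list \<Rightarrow> 'a list" where
  "inv_roots [] = []"
| "inv_roots (a # as) = refl_word (rev as) a # inv_roots as"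

lemma length_inv_roots [simp]: "length (inv_roots as) = length as"
  by (induction as) auto

text \<open>Roots of a suffix are roots of the whole word, and roots of a prefix reappear after an
  isometry. So a window of a word can be studied inside the inversion set of the whole.\<close>

lemma inv_roots_append:
  "inv_roots (as @ bs) = map (refl_word (rev bs)) (inv_roots as) @ inv_roots bs"
  by (induction as) (simp_all add: refl_word_append)

text \<open>Unitriangularity: every root differs from its letter by an element of the span of the
  later letters.\<close>

lemma span_inv_roots: "span (set (inv_roots as)) = span (set as)"
proof (induction as)
  case (Cons a as)
  have "refl_word (rev as) a - a \<in> span (set (inv_roots as))"
    using refl_word_minus_in_span[of "rev as" a] Cons by simp
  then have "span (set (inv_roots (a # as))) = span (insert a (set (inv_roots as)))"
    by (simp add: eq_span_insert_eq)
  then show ?case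
    using Cons by (simp add: span_insert)
qed simp

section \<open>Elements of the Weyl group as words in reflections\<close>

lemma reflection_in_Bij: "reflection (a::'a::euclidean_space) \<in> Bij UNIV"
  using bij_refl_word[of "[a]"] by (simp add: Bij_def refl_word_single)

lemma refl_word_in_Bij: "refl_word as \<in> Bij UNIV"
  by (simp add: Bij_def bij_refl_word)

lemma mult_BijGroup_UNIV:
  "f \<in> Bij UNIV \<Longrightarrow> g \<in> Bij UNIV \<Longrightarrow> f \<otimes>\<^bsub>BijGroup UNIV\<^esub> g = f \<circ> g"
  by (auto simp: BijGroup_def compose_def fun_eq_iff)

lemma inv_reflection: "inv\<^bsub>BijGroup UNIV\<^esub> (reflection (a::'a::euclidean_space)) = reflection a"
proof -
  have "inv_into UNIV (reflection a) = reflection a"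
    by (rule inv_equality) simp_all
  then show ?thesis
    by (simp add: inv_BijGroup[OF reflection_in_Bij] restrict_def)
qed

text \<open>Reflections are involutions, so the inverses allowed in \<open>generate\<close> are
  again single letters.\<close>

lemma weyl_group_iff: "w \<in> weyl_group \<Phi> \<longleftrightarrow> (\<exists>as. set as \<subseteq> \<Phi> \<and> w = refl_word as)"
proof
  assume "w \<in> weyl_group \<Phi>"
  then have "w \<in> generate (BijGroup UNIV) (reflection ` \<Phi>)"
    by (simp add: weyl_group_def)
  then show "\<exists>as. set as \<subseteq> \<Phi> \<and> w = refl_word as"
  proof (induction rule: generate.induct)
    case one
    show ?case
      by (rule exI[of _ "[]"]) (auto simp: BijGroup_def)
  next
    case (incl h)
    then obtain a where "a \<in> \<Phi>" "h = reflection a" by auto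
    then show ?case
      by (intro exI[of _ "[a]"]) (simp add: refl_word_single)
  next
    case (inv h)
    then obtain a where "a \<in> \<Phi>" "h = reflection a" by auto
    then show ?case
      by (intro exI[of _ "[a]"]) (simp add: refl_word_single inv_reflection)
  next
    case (eng h1 h2)
    then obtain as bs where "set as \<subseteq> \<Phi>" "h1 = refl_word as" "set bs \<subseteq> \<Phi>" "h2 = refl_word bs"
      by blast
    then show ?case
      by (intro exI[of _ "as @ bs"])
        (simp add: refl_word_append mult_BijGroup_UNIV refl_word_in_Bij)
  qed
next
  assume "\<exists>as. set as \<subseteq> \<Phi> \<and> w = refl_word as"
  then obtain as where "set as \<subseteq> \<Phi>" "w = refl_word as" by blast
  moreover have "refl_word as \<in> generate (BijGroup UNIV) (reflection ` \<Phi>)" if "set as \<subseteq> \<Phi>"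
    using that
  proof (induction as)
    case Nil
    then show ?case
      using generate.one[of "BijGroup UNIV" "reflection ` \<Phi>"] by (simp add: BijGroup_def restrict_def id_def)
  next
    case (Cons a as)
    have "reflection a \<otimes>\<^bsub>BijGroup UNIV\<^esub> refl_word as \<in> generate (BijGroup UNIV) (reflection ` \<Phi>)"
      using Cons by (intro generate.eng[OF generate.incl]) auto
    then show ?case
      by (simp only: refl_word_Cons mult_BijGroup_UNIV reflection_in_Bij refl_word_in_Bij)
  qed
  ultimately show "w \<in> weyl_group \<Phi>"
    by (simp add: weyl_group_def)
qed

lemma refl_word_in_weyl_group: "set as \<subseteq> \<Phi> \<Longrightarrow> refl_word as \<in> weyl_group \<Phi>"
  by (auto simp: weyl_group_iff)

section \<open>Simple roots\<close>

text \<open>A locale, because its facts are used for three kinds of root systems: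
  \<open>\<Phi>\<close> itself, its intersections with subspaces, and the root systems of the
  patterns.\<close>

locale root_base =
  fixes \<Phi> P :: "'a::euclidean_space set"
  assumes root_system: "root_system \<Phi>" and positive_roots: "positive_roots \<Phi> P"
begin

abbreviation "\<Delta> \<equiv> simple_roots P"

text \<open>One functional that is positive exactly on the positive roots, fixed once and for all;
  it takes the part of the height of a root.\<close>

definition "h = (SOME h. (\<forall>\<alpha>\<in>\<Phi>. h \<bullet> \<alpha> \<noteq> 0) \<and> P = {\<alpha>\<in>\<Phi>. h \<bullet> \<alpha> > 0})"

lemma h: "(\<forall>\<alpha>\<in>\<Phi>. h \<bullet> \<alpha> \<noteq> 0) \<and> P = {\<alpha>\<in>\<Phi>. h \<bullet> \<alpha> > 0}"
  unfolding h_def using positive_roots unfolding positive_roots_def by (rule someI_ex)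

lemma h_nonzero: "\<alpha> \<in> \<Phi> \<Longrightarrow> h \<bullet> \<alpha> \<noteq> 0"
  using h by blast

lemma pos_iff: "\<alpha> \<in> P \<longleftrightarrow> \<alpha> \<in> \<Phi> \<and> h \<bullet> \<alpha> > 0"
  using h by blast

lemma finite_roots: "finite \<Phi>"
  using root_system by (simp add: root_system_def)

lemma finite_pos: "finite P"
  using finite_roots by (rule finite_subset[rotated]) (auto simp: pos_iff)

lemma zero_not_root: "0 \<notin> \<Phi>"
  using root_system by (simp add: root_system_def)

lemma root_multiple: "\<alpha> \<in> \<Phi> \<Longrightarrow> c *\<^sub>R \<alpha> \<in> \<Phi> \<longleftrightarrow> c = 1 \<or> c = - 1"
  using root_system by (simp add: root_system_def)

lemma neg_root: "\<alpha> \<in> \<Phi> \<Longrightarrow> - \<alpha> \<in> \<Phi>"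
  using root_multiple[of \<alpha> "-1"] by simp

lemma refl_root: "\<alpha> \<in> \<Phi> \<Longrightarrow> \<beta> \<in> \<Phi> \<Longrightarrow> reflection \<alpha> \<beta> \<in> \<Phi>"
  using root_system unfolding root_system_def by blast

lemma cartan_int: "\<alpha> \<in> \<Phi> \<Longrightarrow> \<beta> \<in> \<Phi> \<Longrightarrow> cartan_number \<beta> \<alpha> \<in> \<int>"
  using root_system by (simp add: root_system_def)

lemma pos_root: "\<alpha> \<in> P \<Longrightarrow> \<alpha> \<in> \<Phi>"
  by (simp add: pos_iff)

lemma simple_pos: "\<alpha> \<in> \<Delta> \<Longrightarrow> \<alpha> \<in> P"
  by (simp add: simple_roots_def)

lemma simple_root: "\<alpha> \<in> \<Delta> \<Longrightarrow> \<alpha> \<in> \<Phi>"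
  by (simp add: simple_pos pos_root)

lemma neg_pos_iff: "\<alpha> \<in> \<Phi> \<Longrightarrow> - \<alpha> \<in> P \<longleftrightarrow> \<alpha> \<notin> P"
  using h_nonzero[of \<alpha>] by (auto simp: pos_iff neg_root)

lemma neg_not_pos: "\<alpha> \<in> P \<Longrightarrow> - \<alpha> \<notin> P"
  by (simp add: pos_iff)

lemma in_uminus_pos: "\<beta> \<in> uminus ` P \<longleftrightarrow> - \<beta> \<in> P"
  by force

lemma pos_nonzero: "\<alpha> \<in> P \<Longrightarrow> \<alpha> \<noteq> 0"
  using zero_not_root pos_root by blast

lemma refl_word_root: "set as \<subseteq> \<Phi> \<Longrightarrow> \<beta> \<in> \<Phi> \<Longrightarrow> refl_word as \<beta> \<in> \<Phi>"
  by (induction as) (auto simp: refl_word_Cons refl_root)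

text \<open>The product is four times the squared cosine of the angle. Cauchy-Schwarz is strict
  because the only roots proportional to \<open>\<alpha>\<close> are \<open>\<alpha>\<close> and
  \<open>- \<alpha>\<close>.\<close>

lemma cartan_prod_less_4:
  assumes "\<alpha> \<in> \<Phi>" "\<beta> \<in> \<Phi>" "\<beta> \<noteq> \<alpha>" "\<beta> \<noteq> - \<alpha>"
  shows "cartan_number \<beta> \<alpha> * cartan_number \<alpha> \<beta> < 4"
proof -
  have nz: "\<alpha> \<noteq> 0" "\<beta> \<noteq> 0"
    using assms zero_not_root by auto
  have "\<bar>\<alpha> \<bullet> \<beta>\<bar> \<noteq> norm \<alpha> * norm \<beta>"
  proof
    assume "\<bar>\<alpha> \<bullet> \<beta>\<bar> = norm \<alpha> * norm \<beta>"
    then have "norm \<alpha> *\<^sub>R \<beta> = norm \<beta> *\<^sub>R \<alpha> \<or> norm \<alpha> *\<^sub>R \<beta> = - norm \<beta> *\<^sub>R \<alpha>"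
      by (simp add: norm_cauchy_schwarz_abs_eq)
    then obtain c where "norm \<alpha> *\<^sub>R \<beta> = c *\<^sub>R \<alpha>" by blast
    then have "\<beta> = (c / norm \<alpha>) *\<^sub>R \<alpha>"
      using nz by (metis divide_inverse_commute norm_eq_zero real_vector_eq_affinity
          scaleR_scaleR add.right_neutral left_inverse scaleR_one)
    then have "c / norm \<alpha> = 1 \<or> c / norm \<alpha> = - 1"
      using root_multiple[OF assms(1)] assms(2) by metis
    then show False
      using \<open>\<beta> = _\<close> assms by auto
  qed
  then have "\<bar>\<alpha> \<bullet> \<beta>\<bar> < norm \<alpha> * norm \<beta>"
    using Cauchy_Schwarz_ineq2[of \<alpha> \<beta>] by simp
  then have "\<bar>\<alpha> \<bullet> \<beta>\<bar>\<^sup>2 < (norm \<alpha> * norm \<beta>)\<^sup>2"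
    by (intro power_strict_mono) auto
  then have "(\<alpha> \<bullet> \<beta>)\<^sup>2 < (\<alpha> \<bullet> \<alpha>) * (\<beta> \<bullet> \<beta>)"
    by (simp add: power_mult_distrib dot_square_norm)
  moreover have "(\<alpha> \<bullet> \<alpha>) * (\<beta> \<bullet> \<beta>) > 0"
    using nz by simp
  ultimately have "4 * ((\<alpha> \<bullet> \<beta>)\<^sup>2 / ((\<alpha> \<bullet> \<alpha>) * (\<beta> \<bullet> \<beta>))) < 4"
    by (simp add: divide_less_eq)
  moreover have "cartan_number \<beta> \<alpha> * cartan_number \<alpha> \<beta> = 4 * ((\<alpha> \<bullet> \<beta>)\<^sup>2 / ((\<alpha> \<bullet> \<alpha>) * (\<beta> \<bullet> \<beta>)))"
    by (simp add: cartan_number_def power2_eq_square inner_commute)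
  ultimately show ?thesis by simp
qed

text \<open>Two positive integers with product less than 4 cannot both exceed 1, and a Cartan number
  1 turns the reflection into a subtraction.\<close>

lemma diff_root:
  assumes "\<alpha> \<in> \<Phi>" "\<beta> \<in> \<Phi>" "\<beta> \<noteq> \<alpha>" "\<beta> \<noteq> - \<alpha>" "\<alpha> \<bullet> \<beta> > 0"
  shows "\<alpha> - \<beta> \<in> \<Phi>"
proof -
  have nz: "\<alpha> \<noteq> 0" "\<beta> \<noteq> 0"
    using assms zero_not_root by auto
  obtain m k :: int where m: "cartan_number \<beta> \<alpha> = m" and k: "cartan_number \<alpha> \<beta> = k"
    using cartan_int assms by (meson Ints_cases)
  have "real_of_int m > 0" "real_of_int k > 0"
    unfolding m[symmetric] k[symmetric] using assms nz
    by (simp_all add: cartan_number_def inner_commute)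
  moreover have "real_of_int (m * k) < 4"
    using cartan_prod_less_4[OF assms(1-4)] m k by simp
  then have "m * k < 4"
    by linarith
  ultimately have "m = 1 \<or> k = 1"
    using mult_mono[of 2 m 2 k] by (cases "m = 1"; cases "k = 1") auto
  then show ?thesis
  proof
    assume "m = 1"
    then have "\<beta> - \<alpha> \<in> \<Phi>"
      using refl_root[OF assms(1,2)] m by (simp add: reflection_def)
    then show ?thesis
      using neg_root by fastforce
  next
    assume "k = 1"
    then show ?thesis
      using refl_root[OF assms(2,1)] k by (simp add: reflection_def)
  qed
qed

text \<open>Otherwise \<open>a - b\<close> is a root, and depending on its sign either
  \<open>a\<close> or \<open>b\<close> decomposes.\<close>

lemma simple_obtuse:
  assumes "a \<in> \<Delta>" "b \<in> \<Delta>" "a \<noteq> b"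
  shows "a \<bullet> b \<le> 0"
proof (rule ccontr)
  assume "\<not> a \<bullet> b \<le> 0"
  moreover have "b \<noteq> - a"
    using assms by (metis neg_not_pos simple_pos)
  ultimately have "a - b \<in> \<Phi>"
    using assms by (intro diff_root) (auto simp: simple_root)
  then consider "a - b \<in> P" | "b - a \<in> P"
    using neg_pos_iff by fastforce
  then show False
  proof cases
    case 1
    then have "\<exists>\<beta>\<in>P. \<exists>\<gamma>\<in>P. a = \<beta> + \<gamma>"
      using assms by (intro bexI[of _ "a - b"] bexI[of _ b]) (auto simp: simple_pos)
    then show False
      using assms by (simp add: simple_roots_def)
  next
    case 2
    then have "\<exists>\<beta>\<in>P. \<exists>\<gamma>\<in>P. b = \<beta> + \<gamma>"
      using assms by (intro bexI[of _ "b - a"] bexI[of _ a]) (auto simp: simple_pos)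
    then show False
      using assms by (simp add: simple_roots_def)
  qed
qed

lemma finite_simple: "finite \<Delta>"
  using finite_pos by (rule finite_subset[rotated]) (auto simp: simple_pos)

text \<open>The values of \<open>h\<close> are real, so inductions on the height count the finitely
  many lower positive roots instead.\<close>

lemma card_lower_less:
  assumes "\<gamma> \<in> P" "h \<bullet> \<gamma> < h \<bullet> \<beta>"
  shows "card {\<delta>\<in>P. h \<bullet> \<delta> < h \<bullet> \<gamma>} < card {\<delta>\<in>P. h \<bullet> \<delta> < h \<bullet> \<beta>}"
proof (rule psubset_card_mono)
  have "\<gamma> \<in> {\<delta>\<in>P. h \<bullet> \<delta> < h \<bullet> \<beta>} - {\<delta>\<in>P. h \<bullet> \<delta> < h \<bullet> \<gamma>}"
    using assms by simp
  moreover have "{\<delta>\<in>P. h \<bullet> \<delta> < h \<bullet> \<gamma>} \<subseteq> {\<delta>\<in>P. h \<bullet> \<delta> < h \<bullet> \<beta>}"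
    using assms by auto
  ultimately show "{\<delta>\<in>P. h \<bullet> \<delta> < h \<bullet> \<gamma>} \<subset> {\<delta>\<in>P. h \<bullet> \<delta> < h \<bullet> \<beta>}"
    by blast
qed (simp add: finite_pos)

lemma pos_combination:
  assumes "\<alpha> \<in> P"
  shows "\<exists>c. (\<forall>b\<in>\<Delta>. c b \<ge> (0::real)) \<and> \<alpha> = (\<Sum>b\<in>\<Delta>. c b *\<^sub>R b)"
  using assms
proof (induction "card {\<beta>\<in>P. h \<bullet> \<beta> < h \<bullet> \<alpha>}" arbitrary: \<alpha> rule: less_induct)
  case less
  show ?case
  proof (cases "\<alpha> \<in> \<Delta>")
    case True
    have "\<alpha> = (\<Sum>b\<in>\<Delta>. (if b = \<alpha> then 1 else 0) *\<^sub>R b)"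
      using True finite_simple by (simp add: if_distrib[of "\<lambda>c. c *\<^sub>R _"] cong: if_cong)
    then show ?thesis
      by (intro exI[of _ "\<lambda>b. if b = \<alpha> then 1 else 0"]) simp
  next
    case False
    then obtain \<beta> \<gamma> where bg: "\<beta> \<in> P" "\<gamma> \<in> P" "\<alpha> = \<beta> + \<gamma>"
      using less.prems by (auto simp: simple_roots_def)
    have "h \<bullet> \<beta> < h \<bullet> \<alpha>" "h \<bullet> \<gamma> < h \<bullet> \<alpha>"
      using bg by (auto simp: pos_iff inner_add_right)
    then obtain c d where
      "\<forall>b\<in>\<Delta>. c b \<ge> (0::real)" "\<beta> = (\<Sum>b\<in>\<Delta>. c b *\<^sub>R b)"
      "\<forall>b\<in>\<Delta>. d b \<ge> (0::real)" "\<gamma> = (\<Sum>b\<in>\<Delta>. d b *\<^sub>R b)"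
      using less.hyps[OF card_lower_less[OF bg(1)] bg(1)]
        less.hyps[OF card_lower_less[OF bg(2)] bg(2)] by blast
    then show ?thesis
      using bg by (intro exI[of _ "\<lambda>b. c b + d b"]) (auto simp: scaleR_add_left sum.distrib)
  qed
qed

text \<open>Vectors that are pairwise obtuse and lie strictly on one side of a hyperplane are
  independent.\<close>

lemma independent_simple: "independent \<Delta>"
proof -
  have "u b = 0" if u: "(\<Sum>b\<in>\<Delta>. u b *\<^sub>R b) = 0" and b: "b \<in> \<Delta>" for u :: "'a \<Rightarrow> real" and b
  proof -
    \<comment> \<open>The relation is split by the sign of its coefficients. Both halves equal
      \<open>v\<close>, so \<open>v \<bullet> v\<close> becomes a sum of nonpositive terms and
      \<open>v = 0\<close>; then \<open>h\<close> forces every coefficient to vanish.\<close>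
    define A where "A = {b\<in>\<Delta>. u b > 0}"
    define B where "B = {b\<in>\<Delta>. u b \<le> 0}"
    have AB: "\<Delta> = A \<union> B" "A \<inter> B = {}" "finite A" "finite B"
      using finite_simple by (auto simp: A_def B_def)
    define v where "v = (\<Sum>b\<in>A. u b *\<^sub>R b)"
    have v: "v = (\<Sum>b\<in>B. (- u b) *\<^sub>R b)"
      using u AB by (simp add: v_def sum.union_disjoint sum_negf add_eq_0_iff)
    have "v \<bullet> v = (\<Sum>a\<in>A. \<Sum>b\<in>B. (u a * - u b) * (a \<bullet> b))"
    proof -
      have "v \<bullet> v = (\<Sum>a\<in>A. u a *\<^sub>R a) \<bullet> (\<Sum>b\<in>B. (- u b) *\<^sub>R b)"
        using v v_def by simp
      also have "\<dots> = (\<Sum>a\<in>A. \<Sum>b\<in>B. (u a * - u b) * (a \<bullet> b))"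
        by (simp only: inner_sum_left inner_scaleR_left)
          (simp only: inner_sum_right inner_scaleR_right sum_distrib_left mult.assoc)
      finally show ?thesis .
    qed
    also have "\<dots> \<le> 0"
    proof (intro sum_nonpos)
      fix a b assume "a \<in> A" "b \<in> B"
      then have "a \<noteq> b" "u a * - u b \<ge> 0"
        by (auto simp: A_def B_def mult_nonneg_nonpos)
      moreover from this have "a \<bullet> b \<le> 0"
        using \<open>a \<in> A\<close> \<open>b \<in> B\<close> by (intro simple_obtuse) (auto simp: A_def B_def)
      ultimately show "(u a * - u b) * (a \<bullet> b) \<le> 0"
        by (intro mult_nonneg_nonpos)
    qed
    finally have "v = 0"
      by (metis inner_ge_zero inner_eq_zero_iff antisym)
    then have z: "(\<Sum>b\<in>A. u b * (h \<bullet> b)) = 0" "(\<Sum>b\<in>B. (- u b) * (h \<bullet> b)) = 0"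
      using arg_cong[of _ _ "inner h", OF v] \<open>v = 0\<close> arg_cong[of _ _ "inner h", OF v_def]
      by (simp_all add: inner_sum_right)
    have hpos: "h \<bullet> b > 0" if "b \<in> \<Delta>" for b
      using that simple_pos pos_iff by blast
    have "u a * (h \<bullet> a) \<ge> 0" if "a \<in> A" for a
      using that hpos[of a] by (simp add: A_def)
    then have zA: "\<forall>b\<in>A. u b * (h \<bullet> b) = 0"
      using z(1) AB(3) sum_nonneg_eq_0_iff[of A "\<lambda>b. u b * (h \<bullet> b)"] by blast
    have "(- u a) * (h \<bullet> a) \<ge> 0" if "a \<in> B" for a
      using that hpos[of a] by (simp add: B_def mult_nonpos_nonneg)
    then have zB: "\<forall>b\<in>B. (- u b) * (h \<bullet> b) = 0"
      using z(2) AB(4) sum_nonneg_eq_0_iff[of B "\<lambda>b. (- u b) * (h \<bullet> b)"] by blast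
    have "u b * (h \<bullet> b) = 0"
      using zA zB b AB(1) by auto
    then show ?thesis
      using hpos[OF b] by simp
  qed
  then show ?thesis
    using finite_simple by (intro independent_if_scalars_zero) auto
qed

lemma pos_in_span: "P \<subseteq> span \<Delta>"
proof
  fix \<alpha> assume "\<alpha> \<in> P"
  then obtain c where "\<alpha> = (\<Sum>b\<in>\<Delta>. c b *\<^sub>R b)"
    using pos_combination[of \<alpha>] by blast
  then show "\<alpha> \<in> span \<Delta>"
    by (simp add: span_sum span_scale span_base)
qed

lemma span_roots: "span \<Phi> = span \<Delta>"
proof
  have "\<Phi> \<subseteq> span \<Delta>"
    using pos_in_span neg_pos_iff span_neg by (metis minus_minus subset_eq)
  then show "span \<Phi> \<subseteq> span \<Delta>"
    by (simp add: span_minimal)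
  show "span \<Delta> \<subseteq> span \<Phi>"
    by (intro span_mono) (auto simp: simple_root)
qed

section \<open>Coordinates in the basis of simple roots, and generation by simple
  reflections\<close>

definition "coord x = representation \<Delta> x"

lemma coord_diff: "x \<in> span \<Delta> \<Longrightarrow> y \<in> span \<Delta> \<Longrightarrow> coord (x - y) b = coord x b - coord y b"
  by (simp add: coord_def representation_diff independent_simple)

lemma coord_scale: "x \<in> span \<Delta> \<Longrightarrow> coord (c *\<^sub>R x) b = c * coord x b"
  by (simp add: coord_def representation_scale independent_simple)

lemma coord_neg: "x \<in> span \<Delta> \<Longrightarrow> coord (- x) b = - coord x b"
  by (simp add: coord_def representation_neg independent_simple)

lemma coord_simple: "a \<in> \<Delta> \<Longrightarrow> coord a b = (if b = a then 1 else 0)"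
  by (simp add: coord_def representation_basis independent_simple)

lemma coord_pos: 
  assumes "\<alpha> \<in> P" shows "coord \<alpha> b \<ge> 0"
proof -
  obtain c where c: "\<forall>b\<in>\<Delta>. c b \<ge> (0::real)" "\<alpha> = (\<Sum>b\<in>\<Delta>. c b *\<^sub>R b)"
    using pos_combination[OF assms] by blast
  have "coord \<alpha> b = (\<Sum>a\<in>\<Delta>. c a * coord a b)"
    unfolding c(2) coord_def
    by (simp add: representation_sum independent_simple span_scale span_base representation_scale)
  also have "\<dots> \<ge> 0"
    using c by (intro sum_nonneg) (auto simp: coord_simple)
  finally show ?thesis .
qed

lemma coord_sum_eq: "x \<in> span \<Delta> \<Longrightarrow> (\<Sum>b\<in>\<Delta>. coord x b *\<^sub>R b) = x"
  unfolding coord_def by (rule sum_representation_eq) (auto simp: independent_simple finite_simple)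

text \<open>The coordinates of a root all have the same sign, so a single positive one
  decides.\<close>

lemma pos_if_coord_pos:
  assumes "\<alpha> \<in> \<Phi>" "coord \<alpha> b > 0" shows "\<alpha> \<in> P"
proof (rule ccontr)
  assume "\<alpha> \<notin> P"
  then have "- \<alpha> \<in> P"
    using assms neg_pos_iff by blast
  moreover have "\<alpha> \<in> span \<Delta>"
    using assms span_base span_roots by blast
  ultimately show False
    using coord_pos[of "- \<alpha>" b] assms by (simp add: coord_neg)
qed

text \<open>The reflection changes only the coordinate at \<open>a\<close>. A positive root other
  than \<open>a\<close> is no multiple of \<open>a\<close>, so another coordinate is positive and
  stays so.\<close>

lemma simple_refl_pos:
  assumes "a \<in> \<Delta>" "\<beta> \<in> P" "\<beta> \<noteq> a"
  shows "reflection a \<beta> \<in> P"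
proof -
  have sp: "\<beta> \<in> span \<Delta>" "a \<in> span \<Delta>"
    using assms pos_in_span simple_pos by auto
  have "\<exists>b\<in>\<Delta>. b \<noteq> a \<and> coord \<beta> b \<noteq> 0"
  proof (rule ccontr)
    assume *: "\<not> ?thesis"
    then have "\<beta> = (\<Sum>b\<in>\<Delta>. (if b = a then coord \<beta> a else 0) *\<^sub>R b)"
      by (subst coord_sum_eq[OF sp(1), symmetric]) (intro sum.cong, auto)
    also have "\<dots> = coord \<beta> a *\<^sub>R a"
      using assms finite_simple by (simp add: if_distrib[of "\<lambda>c. c *\<^sub>R _"] cong: if_cong)
    finally have eq: "\<beta> = coord \<beta> a *\<^sub>R a" .
    then have "coord \<beta> a = 1 \<or> coord \<beta> a = - 1"
      using root_multiple[of a "coord \<beta> a"] assms by (simp add: pos_root simple_root)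
    then show False
      using eq assms coord_pos[OF assms(2), of a] by auto
  qed
  then obtain b where b: "b \<in> \<Delta>" "b \<noteq> a" "coord \<beta> b > 0"
    using coord_pos[OF assms(2)] by (metis less_eq_real_def)
  have "coord (reflection a \<beta>) b = coord \<beta> b"
    using sp b assms by (simp add: reflection_def coord_diff coord_scale coord_simple span_scale)
  then show ?thesis
    using pos_if_coord_pos[of "reflection a \<beta>" b] b assms
    by (simp add: refl_root pos_root simple_root)
qed

text \<open>Since \<open>\<beta> \<bullet> \<beta> > 0\<close> and the coordinates are nonnegative,
  some simple \<open>a\<close> satisfies \<open>\<beta> \<bullet> a > 0\<close>; reflecting in it
  lowers the value of \<open>h\<close>.\<close>

lemma pos_eq_refl_word_simple:
  assumes "\<beta> \<in> P"
  shows "\<exists>as b. set as \<subseteq> \<Delta> \<and> b \<in> \<Delta> \<and> \<beta> = refl_word as b"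
  using assms
proof (induction "card {\<delta>\<in>P. h \<bullet> \<delta> < h \<bullet> \<beta>}" arbitrary: \<beta> rule: less_induct)
  case less
  show ?case
  proof (cases "\<beta> \<in> \<Delta>")
    case True
    then show ?thesis
      by (intro exI[of _ "[]"] exI[of _ \<beta>]) auto
  next
    case False
    have sp: "\<beta> \<in> span \<Delta>"
      using less.prems pos_in_span by auto
    have "\<exists>a\<in>\<Delta>. \<beta> \<bullet> a > 0"
    proof (rule ccontr)
      assume "\<not> ?thesis"
      then have "(\<Sum>b\<in>\<Delta>. coord \<beta> b * (\<beta> \<bullet> b)) \<le> 0"
        using coord_pos[OF less.prems] by (intro sum_nonpos mult_nonneg_nonpos) (auto simp: not_less)
      then have "\<beta> \<bullet> (\<Sum>b\<in>\<Delta>. coord \<beta> b *\<^sub>R b) \<le> 0"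
        by (simp add: inner_sum_right)
      then have "\<beta> = 0"
        unfolding coord_sum_eq[OF sp] by (metis inner_ge_zero inner_eq_zero_iff antisym)
      then show False
        using less.prems pos_nonzero by blast
    qed
    then obtain a where a: "a \<in> \<Delta>" "\<beta> \<bullet> a > 0" by blast
    let ?\<gamma> = "reflection a \<beta>"
    have \<gamma>: "?\<gamma> \<in> P"
      using simple_refl_pos[OF a(1) less.prems] a(1) False by metis
    have "h \<bullet> a > 0" "a \<noteq> 0"
      using simple_pos[OF a(1)] pos_nonzero pos_iff by auto
    then have "cartan_number \<beta> a * (h \<bullet> a) > 0"
      using a(2) by (simp add: cartan_number_def)
    then have lower: "h \<bullet> ?\<gamma> < h \<bullet> \<beta>"
      by (simp add: reflection_def inner_diff_right)
    obtain as b where as: "set as \<subseteq> \<Delta>" "b \<in> \<Delta>" and eq: "?\<gamma> = refl_word as b"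
      using less.hyps[OF card_lower_less[OF \<gamma> lower] \<gamma>] by blast
    have "\<beta> = refl_word (a # as) b"
      by (simp add: refl_word_Cons flip: eq)
    then show ?thesis
      using a as by (intro exI[of _ "a # as"] exI[of _ b]) auto
  qed
qed

lemma root_eq_refl_word_simple:
  assumes "\<beta> \<in> \<Phi>"
  shows "\<exists>as b. set as \<subseteq> \<Delta> \<and> b \<in> \<Delta> \<and> \<beta> = refl_word as b"
proof (cases "\<beta> \<in> P")
  case False
  then have "- \<beta> \<in> P"
    using assms neg_pos_iff by blast
  then obtain as b where *: "set as \<subseteq> \<Delta>" "b \<in> \<Delta>" "- \<beta> = refl_word as b"
    using pos_eq_refl_word_simple by blast
  then have "\<beta> = refl_word (as @ [b]) b"
    by (simp add: refl_word_append refl_word_single flip: *(3))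
  then show ?thesis
    using * by (intro exI[of _ "as @ [b]"] exI[of _ b]) auto
qed (rule pos_eq_refl_word_simple)

lemma reflection_eq_refl_word_simple:
  assumes "\<beta> \<in> \<Phi>"
  shows "\<exists>as. set as \<subseteq> \<Delta> \<and> reflection \<beta> = refl_word as"
proof -
  obtain as b where *: "set as \<subseteq> \<Delta>" "b \<in> \<Delta>" "\<beta> = refl_word as b"
    using root_eq_refl_word_simple[OF assms] by blast
  then show ?thesis
    by (intro exI[of _ "as @ [b] @ rev as"])
      (auto simp: reflection_refl_word refl_word_append refl_word_Cons comp_assoc)
qed

lemma weyl_group_simple_word:
  "w \<in> weyl_group \<Phi> \<longleftrightarrow> (\<exists>as. set as \<subseteq> \<Delta> \<and> w = refl_word as)"
proof
  assume "w \<in> weyl_group \<Phi>"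
  then obtain bs where "set bs \<subseteq> \<Phi>" "w = refl_word bs"
    by (auto simp: weyl_group_iff)
  then show "\<exists>as. set as \<subseteq> \<Delta> \<and> w = refl_word as"
  proof (induction bs arbitrary: w)
    case Nil
    then show ?case by (intro exI[of _ "[]"]) auto
  next
    case (Cons b bs)
    obtain as where as: "set as \<subseteq> \<Delta>" "refl_word bs = refl_word as"
      using Cons by auto
    obtain cs where cs: "set cs \<subseteq> \<Delta>" "reflection b = refl_word cs"
      using reflection_eq_refl_word_simple Cons.prems by force
    show ?case
      using as cs Cons.prems
      by (intro exI[of _ "cs @ as"]) (simp add: refl_word_append refl_word_Cons)
  qed
next
  assume "\<exists>as. set as \<subseteq> \<Delta> \<and> w = refl_word as"
  then show "w \<in> weyl_group \<Phi>"
    using simple_root by (auto intro!: refl_word_in_weyl_group)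
qed

end

section \<open>Exchange condition and Coxeter length\<close>

lemma refl_word_comp_reflection:
  "refl_word as \<circ> reflection \<beta> = reflection (refl_word as \<beta>) \<circ> refl_word as"
  by (rule ext) (simp add: reflection_refl_word)

text \<open>Peeling off the letters one by one telescopes. The coefficients involve \<open>x\<close>
  itself and not its successive images, so a vanishing Cartan number removes its root from the
  relation.\<close>

lemma refl_word_rev_eq:
  "refl_word (rev bs) x
    = x - (\<Sum>i<length bs. cartan_number x (bs ! i) *\<^sub>R inv_roots bs ! i)"
proof (induction bs arbitrary: x)
  case (Cons b bs)
  have "refl_word (rev (b # bs)) x = refl_word (rev bs) (reflection b x)"
    by (simp add: refl_word_append refl_word_single)
  also have "\<dots> = refl_word (rev bs) x - cartan_number x b *\<^sub>R refl_word (rev bs) b"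
    by (simp add: reflection_def linear_diff[OF linear_refl_word] linear_scale[OF linear_refl_word])
  also have "refl_word (rev bs) x
      = x - (\<Sum>i<length bs. cartan_number x (bs ! i) *\<^sub>R inv_roots bs ! i)"
    by (rule Cons.IH)
  finally show ?case
    by (simp add: sum.lessThan_Suc_shift algebra_simps del: sum.lessThan_Suc)
qed simp

context root_base
begin

lemma root_in_span: "\<beta> \<in> \<Phi> \<Longrightarrow> \<beta> \<in> span \<Delta>"
  using span_base span_roots by blast

lemma simple_subset: "S \<subseteq> \<Delta> \<Longrightarrow> S \<subseteq> \<Phi>"
  using simple_root by blast

lemma simple_word_root: "set as \<subseteq> \<Delta> \<Longrightarrow> \<beta> \<in> \<Phi> \<Longrightarrow> refl_word as \<beta> \<in> \<Phi>"
  using simple_subset by (rule refl_word_root)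

lemma simple_word_weyl: "set as \<subseteq> \<Delta> \<Longrightarrow> refl_word as \<in> weyl_group \<Phi>"
  using simple_subset by (rule refl_word_in_weyl_group)

text \<open>Follow \<open>\<beta>\<close> through the suffixes of the word. The letter at which its
  image turns negative must be equal to that image, and composing with the reflection in
  \<open>\<beta>\<close> cancels this letter.\<close>

lemma exchange:
  assumes "set as \<subseteq> \<Delta>" "\<beta> \<in> P" "refl_word as \<beta> \<notin> P"
  shows "\<exists>xs a ys. as = xs @ a # ys \<and> refl_word as \<circ> reflection \<beta> = refl_word (xs @ ys)"
  using assms
proof (induction as)
  case (Cons a as)
  show ?case
  proof (cases "refl_word as \<beta> \<in> P")
    case True
    have "refl_word as \<beta> = a"
      using simple_refl_pos[of a "refl_word as \<beta>"] Cons.prems True by (auto simp: refl_word_Cons)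
    then have "refl_word (a # as) \<circ> reflection \<beta> = refl_word as"
      using refl_word_comp_reflection[of as \<beta>] by (simp add: refl_word_Cons fun_eq_iff)
    then show ?thesis
      by (intro exI[of _ "[]"] exI[of _ a] exI[of _ as]) simp
  next
    case False
    moreover have "set as \<subseteq> \<Delta>"
      using Cons.prems by simp
    ultimately obtain xs a' ys where
      as: "as = xs @ a' # ys" and eq: "refl_word as \<circ> reflection \<beta> = refl_word (xs @ ys)"
      using Cons.IH Cons.prems(2) by blast
    have "refl_word (a # as) \<circ> reflection \<beta> = refl_word ((a # xs) @ ys)"
      by (simp only: refl_word_Cons append_Cons comp_assoc eq)
    then show ?thesis
      using as by (intro exI[of _ "a # xs"] exI[of _ a'] exI[of _ ys]) simp
  qed
qed simp

abbreviation "len \<equiv> coxeter_length P"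

lemma len_le: "set as \<subseteq> \<Delta> \<Longrightarrow> len (refl_word as) \<le> length as"
  unfolding coxeter_length_def by (rule Least_le) auto

definition "reduced_word as \<longleftrightarrow> set as \<subseteq> \<Delta> \<and> len (refl_word as) = length as"

lemma reduced_word_exists:
  assumes "w \<in> weyl_group \<Phi>" shows "\<exists>as. reduced_word as \<and> w = refl_word as"
proof -
  have "\<exists>n as. length as = n \<and> set as \<subseteq> \<Delta> \<and> w = refl_word as"
    using assms by (auto simp: weyl_group_simple_word)
  then have "\<exists>as. length as = len w \<and> set as \<subseteq> \<Delta> \<and> w = refl_word as"
    unfolding coxeter_length_def by (rule LeastI_ex)
  then show ?thesis
    by (auto simp: reduced_word_def)
qed

lemma weyl_group_reflection:
  assumes "w \<in> weyl_group \<Phi>" "\<beta> \<in> \<Phi>"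
  shows "w \<circ> reflection \<beta> \<in> weyl_group \<Phi>"
proof -
  obtain as where "set as \<subseteq> \<Phi>" "w = refl_word as"
    using assms by (auto simp: weyl_group_iff)
  then show ?thesis
    using assms refl_word_in_weyl_group[of "as @ [\<beta>]" \<Phi>]
    by (simp add: refl_word_append refl_word_single)
qed

lemma weyl_root: "w \<in> weyl_group \<Phi> \<Longrightarrow> \<beta> \<in> \<Phi> \<Longrightarrow> w \<beta> \<in> \<Phi>"
  by (auto simp: weyl_group_iff refl_word_root)

lemma weyl_uminus: "w \<in> weyl_group \<Phi> \<Longrightarrow> w (- x) = - w x"
  by (auto simp: weyl_group_iff)

lemma len_reflection_less:
  assumes "w \<in> weyl_group \<Phi>" "\<beta> \<in> P" "w \<beta> \<notin> P"
  shows "len (w \<circ> reflection \<beta>) < len w"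
proof -
  obtain as where as: "reduced_word as" "w = refl_word as"
    using reduced_word_exists assms by blast
  then obtain xs a ys where "as = xs @ a # ys" "w \<circ> reflection \<beta> = refl_word (xs @ ys)"
    using exchange[of as \<beta>] assms by (auto simp: reduced_word_def)
  then show ?thesis
    using as len_le[of "xs @ ys"] by (auto simp: reduced_word_def)
qed

lemma len_reflection_greater:
  assumes "w \<in> weyl_group \<Phi>" "\<beta> \<in> P" "w \<beta> \<in> P"
  shows "len w < len (w \<circ> reflection \<beta>)"
proof -
  have "(w \<circ> reflection \<beta>) \<beta> \<notin> P"
    using assms by (simp add: weyl_uminus neg_not_pos)
  then have "len (w \<circ> reflection \<beta> \<circ> reflection \<beta>) < len (w \<circ> reflection \<beta>)"
    using assms by (intro len_reflection_less) (auto intro: weyl_group_reflection pos_root)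
  then show ?thesis
    by (simp add: comp_def)
qed

lemma reduced_Nil [simp]: "reduced_word []"
  using len_le[of "[]"] by (simp add: reduced_word_def)

text \<open>For \<open>w = refl_word as\<close>, prepending \<open>a\<close> amounts to composing
  \<open>w\<close> on the right with the reflection in the preimage of \<open>a\<close> under
  \<open>w\<close>; the sign of that root decides whether the length grows.\<close>

lemma reduced_Cons:
  "reduced_word (a # as) \<longleftrightarrow> a \<in> \<Delta> \<and> reduced_word as \<and> refl_word (rev as) a \<in> P"
proof (cases "set (a # as) \<subseteq> \<Delta>")
  case True
  let ?\<beta> = "refl_word (rev as) a"
  have W: "refl_word as \<in> weyl_group \<Phi>" "refl_word (a # as) \<in> weyl_group \<Phi>"
    using True by (simp_all only: simple_word_weyl set_subset_Cons[THEN subset_trans])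
  have \<beta>: "?\<beta> \<in> \<Phi>"
    using True by (intro simple_word_root) (auto simp: simple_root)
  have eq: "refl_word (a # as) = refl_word as \<circ> reflection ?\<beta>"
    by (simp add: refl_word_comp_reflection refl_word_Cons)
  have le: "len (refl_word as) \<le> length as"
    using True by (simp add: len_le)
  have le': "len (refl_word (a # as)) \<le> Suc (length as)"
    using True len_le[of "a # as"] by simp
  show ?thesis
  proof (cases "?\<beta> \<in> P")
    case \<beta>P: True
    have gt: "len (refl_word as) < len (refl_word (a # as))"
      unfolding eq using True W \<beta>P by (intro len_reflection_greater) (auto simp: simple_pos)
    have "len (refl_word (a # as)) \<le> Suc (len (refl_word as))"
    proof -
      obtain bs where bs: "reduced_word bs" "refl_word as = refl_word bs"
        using reduced_word_exists W by blast
      then have "len (refl_word (a # bs)) \<le> Suc (length bs)"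
        using len_le[of "a # bs"] True by (simp add: reduced_word_def)
      then show ?thesis
        using bs by (simp add: refl_word_Cons reduced_word_def)
    qed
    then show ?thesis
      using True \<beta>P gt le le' by (auto simp: reduced_word_def)
  next
    case False
    then have neg: "- ?\<beta> \<in> P"
      using \<beta> neg_pos_iff by blast
    moreover have "refl_word as (- ?\<beta>) \<notin> P"
      using True simple_pos neg_not_pos by simp
    ultimately have "len (refl_word as \<circ> reflection (- ?\<beta>)) < len (refl_word as)"
      using W by (intro len_reflection_less)
    then show ?thesis
      using le False by (auto simp: reduced_word_def eq reflection_uminus)
  qed
qed (auto simp: reduced_word_def)

lemma reduced_iff: "reduced_word as \<longleftrightarrow> set as \<subseteq> \<Delta> \<and> set (inv_roots as) \<subseteq> P"
  by (induction as) (auto simp: reduced_Cons)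

lemma reduced_appendD:
  assumes "reduced_word (as @ bs)" shows "reduced_word as" "reduced_word bs"
proof -
  show "reduced_word bs"
    using assms by (induction as) (auto simp: reduced_Cons)
  show "reduced_word as"
  proof (rule ccontr)
    assume "\<not> reduced_word as"
    then have "len (refl_word as) < length as"
      using assms len_le[of as] by (force simp: reduced_word_def)
    moreover obtain cs where cs: "reduced_word cs" "refl_word as = refl_word cs"
      using assms reduced_word_exists[of "refl_word as"] simple_word_weyl
      by (metis Un_subset_iff reduced_word_def set_append)
    ultimately have "length cs < length as"
      by (simp add: reduced_word_def)
    moreover have "refl_word (as @ bs) = refl_word (cs @ bs)"
      by (simp add: refl_word_append cs)
    moreover have "len (refl_word (cs @ bs)) \<le> length (cs @ bs)"
      using cs assms by (intro len_le) (auto simp: reduced_word_def)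
    ultimately show False
      using assms by (simp add: reduced_word_def)
  qed
qed

section \<open>Inversion sets and their linear independence\<close>

lemma inversion_set_iff:
  assumes "w \<in> weyl_group \<Phi>"
  shows "\<beta> \<in> inversion_set P w \<longleftrightarrow> \<beta> \<in> P \<and> w \<beta> \<notin> P"
  using neg_pos_iff[OF weyl_root[OF assms pos_root]] by (auto simp: inversion_set_def in_uminus_pos)

lemma finite_inversion_set: "finite (inversion_set P w)"
  using finite_pos by (rule finite_subset[rotated]) (auto simp: inversion_set_def)

text \<open>A simple reflection \<open>s_a\<close> preserves the sign of every root except
  \<open>a\<close> and \<open>- a\<close>, so prepending the letter \<open>a\<close> adds exactly
  one inversion, the root sent to \<open>a\<close>.\<close>

lemma reduced_inversions:
  assumes "reduced_word as"
  shows "inversion_set P (refl_word as) = set (inv_roots as) \<and> distinct (inv_roots as)"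
  using assms
proof (induction as)
  case Nil
  have "inversion_set P (refl_word []) = {}"
    using inversion_set_iff[OF simple_word_weyl[of "[]"]] by auto
  then show ?case
    by (simp only: inv_roots.simps list.set distinct.simps simp_thms)
next
  case (Cons a as)
  let ?\<beta> = "refl_word (rev as) a"
  have a: "a \<in> \<Delta>" "?\<beta> \<in> P" "set (a # as) \<subseteq> \<Delta>"
  proof -
    show "a \<in> \<Delta>" "?\<beta> \<in> P"
      using Cons.prems by (simp_all add: reduced_Cons)
    show "set (a # as) \<subseteq> \<Delta>"
      using Cons.prems by (simp add: reduced_word_def)
  qed
  have IH: "inversion_set P (refl_word as) = set (inv_roots as)" "distinct (inv_roots as)"
    using Cons by (auto simp: reduced_Cons)
  have W: "refl_word as \<in> weyl_group \<Phi>" "refl_word (a # as) \<in> weyl_group \<Phi>"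
    using a by (simp_all only: simple_word_weyl set_subset_Cons[THEN subset_trans])
  have notin: "?\<beta> \<notin> inversion_set P (refl_word as)"
    using W a by (simp add: inversion_set_iff simple_pos)
  have "\<gamma> \<in> inversion_set P (refl_word (a # as)) \<longleftrightarrow> \<gamma> = ?\<beta> \<or> \<gamma> \<in> inversion_set P (refl_word as)"
    for \<gamma>
  proof (cases "\<gamma> \<in> P \<and> \<gamma> \<noteq> ?\<beta>")
    case True
    let ?\<delta> = "refl_word as \<gamma>"
    have \<delta>: "?\<delta> \<in> \<Phi>" "?\<delta> \<noteq> a"
      using W True weyl_root pos_root by auto
    have "?\<delta> \<noteq> - a"
    proof
      assume "?\<delta> = - a"
      then have "\<gamma> = - ?\<beta>"
        by (metis refl_word_rev refl_word_uminus)
      then show False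
        using True a neg_not_pos by blast
    qed
    then have "reflection a ?\<delta> \<in> P \<longleftrightarrow> ?\<delta> \<in> P"
      using simple_refl_pos[OF a(1), of ?\<delta>] simple_refl_pos[OF a(1), of "- ?\<delta>"] \<delta> a
      by (metis linear_neg linear_reflection minus_minus neg_pos_iff refl_root simple_root)
    then show ?thesis
      using True W by (simp add: inversion_set_iff refl_word_Cons)
  next
    case False
    have "reflection a a \<notin> P"
      using a simple_pos neg_not_pos by simp
    then show ?thesis
      using False W a by (auto simp: inversion_set_iff refl_word_Cons)
  qed
  then have "inversion_set P (refl_word (a # as)) = insert ?\<beta> (inversion_set P (refl_word as))"
    by auto
  then show ?case
    using IH notin by simp
qed

lemma card_inversion_set: "w \<in> weyl_group \<Phi> \<Longrightarrow> card (inversion_set P w) = len w"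
  using reduced_word_exists[of w] reduced_inversions
  by (auto simp: reduced_word_def distinct_card)

lemma weyl_id: "id \<in> weyl_group \<Phi>"
  using refl_word_in_weyl_group[of "[]" \<Phi>] by simp

lemma no_inversions:
  assumes "w \<in> weyl_group \<Phi>" "inversion_set P w = {}" shows "w = id"
proof -
  obtain as where as: "reduced_word as" "w = refl_word as"
    using reduced_word_exists assms by blast
  then have "as = []"
    using reduced_inversions[of as] assms by (cases as) auto
  then show ?thesis
    using as by simp
qed

text \<open>The composition of \<open>v\<close> with the inverse of \<open>w\<close> has no
  inversions: pull a positive root back by \<open>w\<close>; the preimage or its negative is
  positive, and there \<open>v\<close> and \<open>w\<close> agree in sign.\<close>

lemma inversion_set_inject:
  assumes "v \<in> weyl_group \<Phi>" "w \<in> weyl_group \<Phi>" "inversion_set P v = inversion_set P w"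
  shows "v = w"
proof -
  obtain as bs where as: "set as \<subseteq> \<Phi>" "v = refl_word as" and bs: "set bs \<subseteq> \<Phi>" "w = refl_word bs"
    using assms by (auto simp: weyl_group_iff)
  let ?u = "refl_word (as @ rev bs)"
  have u: "?u \<in> weyl_group \<Phi>"
    using as bs by (intro refl_word_in_weyl_group) auto
  have same: "v \<gamma> \<in> P \<longleftrightarrow> w \<gamma> \<in> P" if "\<gamma> \<in> P" for \<gamma>
    using that assms by (metis inversion_set_iff)
  have "?u \<beta> \<in> P" if \<beta>: "\<beta> \<in> P" for \<beta>
  proof -
    let ?\<gamma> = "refl_word (rev bs) \<beta>"
    have \<gamma>: "?\<gamma> \<in> \<Phi>"
      using bs \<beta> pos_root by (intro refl_word_root) auto
    have w\<gamma>: "w ?\<gamma> = \<beta>" and u\<gamma>: "?u \<beta> = v ?\<gamma>"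
      using as bs by (simp_all add: refl_word_append)
    show ?thesis
    proof (cases "?\<gamma> \<in> P")
      case True
      then show ?thesis
        using same[OF True] \<beta> by (simp add: w\<gamma> u\<gamma>)
    next
      case False
      then have neg: "- ?\<gamma> \<in> P"
        using \<gamma> neg_pos_iff by blast
      have "w (- ?\<gamma>) = - \<beta>"
        using assms(2) w\<gamma> by (simp add: weyl_uminus)
      then have "v (- ?\<gamma>) \<notin> P"
        using same[OF neg] \<beta> neg_not_pos by simp
      then show ?thesis
        unfolding u\<gamma> using assms(1) \<gamma> by (metis weyl_uminus neg_pos_iff weyl_root)
    qed
  qed
  then have "inversion_set P ?u = {}"
    using u inversion_set_iff by blast
  then have "?u = id"
    using no_inversions u by blast
  then show ?thesis
    using as bs refl_word_rev_comp[of bs]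
    by (metis comp_assoc comp_id id_comp refl_word_append)
qed

text \<open>The dimension of the span is the number of different letters, and it is compared with
  the length of the word. Assuming distinct roots rather than a reduced word lets the lemma apply
  directly to windows of a word.\<close>

lemma independent_inv_roots_iff:
  assumes "set as \<subseteq> \<Delta>" "distinct (inv_roots as)"
  shows "independent (set (inv_roots as)) \<longleftrightarrow> distinct as"
proof -
  let ?I = "set (inv_roots as)"
  have "independent (set as)"
    using assms independent_simple independent_mono by blast
  then have "dim ?I = card (set as)"
    using span_inv_roots[of as] by (metis dim_span dim_eq_card_independent)
  moreover have "card ?I = length as"
    using assms by (simp add: distinct_card)
  moreover have "independent ?I \<longleftrightarrow> dim ?I = card ?I"
    using card_eq_dim[of ?I ?I] dim_eq_card_independent[of ?I] span_superset[of ?I] by auto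
  ultimately show ?thesis
    using card_distinct distinct_card by metis
qed

lemma independent_inversions_iff:
  assumes "reduced_word as"
  shows "independent (inversion_set P (refl_word as)) \<longleftrightarrow> distinct as"
  using reduced_inversions[OF assms] independent_inv_roots_iff assms
  by (simp add: reduced_word_def)

lemma coord_span:
  assumes "x \<in> span S" "S \<subseteq> \<Delta>" "a \<notin> S" shows "coord x a = 0"
proof -
  have "coord x = representation S x"
    unfolding coord_def using assms independent_simple by (intro representation_extend)
  then show ?thesis
    using assms(3) representation_ne_zero by metis
qed

lemma coord_refl_word:
  assumes "set as \<subseteq> \<Delta>" "a \<in> \<Delta>" "a \<notin> set as"
  shows "coord (refl_word as a) a = 1"
proof -
  have s: "refl_word as a - a \<in> span (set as)"
    by (rule refl_word_minus_in_span)
  then have "coord (refl_word as a - a) a = 0"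
    using assms by (intro coord_span)
  moreover have "refl_word as a \<in> span \<Delta>"
    using assms by (intro root_in_span simple_word_root) (auto simp: simple_root)
  ultimately show ?thesis
    using assms by (simp add: coord_diff span_base coord_simple)
qed

lemma refl_word_simple_pos:
  assumes "set as \<subseteq> \<Delta>" "a \<in> \<Delta>" "a \<notin> set as"
  shows "refl_word as a \<in> P"
proof (rule pos_if_coord_pos)
  show "refl_word as a \<in> \<Phi>"
    using assms by (intro simple_word_root) (auto simp: simple_root)
  show "coord (refl_word as a) a > 0"
    using coord_refl_word assms by simp
qed

text \<open>Reflections in other simple roots leave the coordinate of \<open>a\<close> at
  \<open>a\<close> equal to 1, so each new inversion is positive.\<close>

lemma distinct_reduced: "distinct as \<Longrightarrow> set as \<subseteq> \<Delta> \<Longrightarrow> reduced_word as"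
  by (induction as) (auto simp: reduced_Cons intro!: refl_word_simple_pos)

lemma cartan_simple_nonpos: "a \<in> \<Delta> \<Longrightarrow> b \<in> \<Delta> \<Longrightarrow> a \<noteq> b \<Longrightarrow> cartan_number a b \<le> 0"
  using simple_obtuse[of a b] by (simp add: cartan_number_def divide_nonpos_nonneg)

text \<open>Only the first letter is in question. The root \<open>?x\<close> is \<open>c\<close>
  plus a nonnegative combination of positive roots, in which the neighbour \<open>b\<close> has a
  positive coefficient; so \<open>?x \<noteq> c\<close>, and the last reflection in \<open>c\<close>
  keeps it positive.\<close>

lemma star_word_reduced:
  assumes "distinct (c # bs)" "set (c # bs) \<subseteq> \<Delta>" "b \<in> set bs" "cartan_number c b \<noteq> 0"
  shows "reduced_word (c # bs @ [c])"
proof -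
  let ?x = "refl_word (rev bs) c"
  have red: "reduced_word (bs @ [c])" "reduced_word bs"
    using assms by (auto intro!: distinct_reduced)
  have xP: "?x \<in> P"
    using assms by (intro refl_word_simple_pos) auto
  have "?x \<noteq> c"
  proof
    assume "?x = c"
    then have "h \<bullet> (\<Sum>i<length bs. cartan_number c (bs ! i) *\<^sub>R inv_roots bs ! i) = 0"
      using refl_word_rev_eq[of bs c] by simp
    then have sum0: "(\<Sum>i<length bs. - cartan_number c (bs ! i) * (h \<bullet> inv_roots bs ! i)) = 0"
      by (simp add: inner_sum_right sum_negf)
    have pos: "h \<bullet> inv_roots bs ! i > 0" if "i < length bs" for i
    proof -
      have "inv_roots bs ! i \<in> P"
        using red(2) that unfolding reduced_iff by (metis length_inv_roots nth_mem subsetD)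
      then show ?thesis by (simp add: pos_iff)
    qed
    have nonpos: "cartan_number c (bs ! i) \<le> 0" if "i < length bs" for i
      using that assms nth_mem[OF that] by (intro cartan_simple_nonpos) auto
    obtain i where i: "i < length bs" "bs ! i = b"
      using assms(3) by (auto simp: in_set_conv_nth)
    have nonneg: "- cartan_number c (bs ! i) * (h \<bullet> inv_roots bs ! i) \<ge> 0"
      if "i < length bs" for i
      using pos[OF that] nonpos[OF that] by (simp add: mult_nonpos_nonneg)
    have "- cartan_number c (bs ! i) * (h \<bullet> inv_roots bs ! i) = 0"
      using sum0 i nonneg sum_nonneg_eq_0_iff[of "{..<length bs}"
          "\<lambda>i. - cartan_number c (bs ! i) * (h \<bullet> inv_roots bs ! i)"] by blast
    then show False
      using pos[OF i(1)] i assms(4) by auto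
  qed
  then have "reflection c ?x \<in> P"
    using xP assms by (intro simple_refl_pos) auto
  then show ?thesis
    using red assms by (simp add: reduced_Cons refl_word_Cons)
qed

section \<open>Restriction to subspaces\<close>

text \<open>Transitivity on chambers, by induction on the number of positive roots where
  \<open>f\<close> is negative. It supplies Weyl group elements with a prescribed inversion
  set.\<close>

lemma weyl_functional:
  fixes f :: "'a \<Rightarrow> real"
  assumes "linear f" "\<forall>\<beta>\<in>\<Phi>. f \<beta> \<noteq> 0"
  shows "\<exists>w\<in>weyl_group \<Phi>. \<forall>\<beta>\<in>\<Phi>. w \<beta> \<in> P \<longleftrightarrow> f \<beta> > 0"
  using assms
proof (induction "card {\<beta>\<in>P. f \<beta> < 0}" arbitrary: f rule: less_induct)
  case less
  show ?case
  proof (cases "\<forall>a\<in>\<Delta>. f a > 0")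
    case True
    have "f \<beta> > 0" if \<beta>: "\<beta> \<in> P" for \<beta>
    proof -
      have "f \<beta> = (\<Sum>b\<in>\<Delta>. coord \<beta> b * f b)"
        by (subst coord_sum_eq[OF root_in_span[OF pos_root[OF \<beta>]], symmetric])
          (simp add: linear_sum[OF less.prems(1)] linear_scale[OF less.prems(1)])
      also have "\<dots> \<ge> 0"
        using True coord_pos[OF \<beta>] by (intro sum_nonneg mult_nonneg_nonneg) (auto simp: less_imp_le)
      finally show ?thesis
        using less.prems(2) pos_root[OF \<beta>] by (metis less_eq_real_def)
    qed
    then have "\<beta> \<in> P \<longleftrightarrow> f \<beta> > 0" if "\<beta> \<in> \<Phi>" for \<beta>
      using that neg_pos_iff[OF that] linear_neg[OF less.prems(1), of \<beta>]
      by (metis neg_0_less_iff_less not_less_iff_gr_or_eq)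
    then show ?thesis
      using weyl_id by (intro bexI[of _ id]) auto
  next
    case False
    then obtain a where a: "a \<in> \<Delta>" "f a < 0"
      using less.prems(2) simple_root by (metis linorder_neqE_linordered_idom)
    define g where "g = f \<circ> reflection a"
    have g: "linear g" "\<forall>\<beta>\<in>\<Phi>. g \<beta> \<noteq> 0"
      using less.prems a simple_root
      by (auto simp: g_def intro: linear_compose linear_reflection refl_root)
    \<comment> \<open>The reflection permutes the positive roots other than \<open>a\<close>, and
      \<open>a\<close> itself no longer counts.\<close>
    have "{\<beta>\<in>P. g \<beta> < 0} \<subseteq> reflection a ` ({\<beta>\<in>P. f \<beta> < 0} - {a})"
    proof
      fix \<beta> assume \<beta>: "\<beta> \<in> {\<beta>\<in>P. g \<beta> < 0}"
      have "g a > 0"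
        using a linear_neg[OF less.prems(1), of a] by (simp add: g_def)
      then have "\<beta> \<noteq> a"
        using \<beta> by auto
      then have "reflection a \<beta> \<in> P"
        using simple_refl_pos a \<beta> by blast
      moreover have "reflection a \<beta> \<noteq> a"
        using \<beta> a simple_pos neg_not_pos by (metis (no_types, lifting) mem_Collect_eq
          reflection_reflection reflection_uminus_self)
      ultimately have "reflection a \<beta> \<in> {\<beta>\<in>P. f \<beta> < 0} - {a}"
        using \<beta> by (auto simp: g_def)
      then show "\<beta> \<in> reflection a ` ({\<beta>\<in>P. f \<beta> < 0} - {a})"
        by (metis imageI reflection_reflection)
    qed
    then have "card {\<beta>\<in>P. g \<beta> < 0} \<le> card ({\<beta>\<in>P. f \<beta> < 0} - {a})"
      using finite_pos by (intro surj_card_le) auto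
    also have "\<dots> < card {\<beta>\<in>P. f \<beta> < 0}"
      using a simple_pos finite_pos by (intro card_Diff1_less) auto
    finally obtain w where w: "w \<in> weyl_group \<Phi>" "\<forall>\<beta>\<in>\<Phi>. w \<beta> \<in> P \<longleftrightarrow> g \<beta> > 0"
      using less.hyps[OF _ g] by blast
    have "(w \<circ> reflection a) \<beta> \<in> P \<longleftrightarrow> f \<beta> > 0" if "\<beta> \<in> \<Phi>" for \<beta>
      using w(2) refl_root[OF simple_root[OF a(1)] that] by (simp add: g_def)
    then show ?thesis
      using weyl_group_reflection[OF w(1) simple_root[OF a(1)]] by blast
  qed
qed

lemma root_base_Int:
  assumes "subspace E'" shows "root_base (\<Phi> \<inter> E') (P \<inter> E')"
proof
  have "reflection \<alpha> \<beta> \<in> \<Phi> \<inter> E'" if "\<alpha> \<in> \<Phi> \<inter> E'" "\<beta> \<in> \<Phi> \<inter> E'" for \<alpha> \<beta>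
    using that assms by (auto simp: refl_root) (simp add: reflection_def subspace_diff subspace_scale)
  then have "reflection \<alpha> ` (\<Phi> \<inter> E') = \<Phi> \<inter> E'" if "\<alpha> \<in> \<Phi> \<inter> E'" for \<alpha>
    using that by (metis (no_types, lifting) image_iff image_subsetI reflection_reflection subsetI
        subset_antisym)
  moreover have "c *\<^sub>R \<alpha> \<in> \<Phi> \<inter> E' \<longleftrightarrow> c = 1 \<or> c = - 1" if "\<alpha> \<in> \<Phi> \<inter> E'" for \<alpha> c
    using that root_multiple[of \<alpha> c] assms subspace_scale[of E' \<alpha> c] by blast
  ultimately show "root_system (\<Phi> \<inter> E')"
    using finite_roots zero_not_root cartan_int by (simp add: root_system_def)
  show "positive_roots (\<Phi> \<inter> E') (P \<inter> E')"
    unfolding positive_roots_def by (rule exI[of _ h]) (auto simp: h_nonzero pos_iff)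
qed

text \<open>Justifies the definite description. Existence: the functional that maps \<open>x\<close>
  to \<open>h \<bullet> w x\<close> has the required signs on \<open>\<Phi> \<inter> E'\<close>.
  Uniqueness: inversion sets determine elements.\<close>

lemma weyl_restrict:
  assumes "subspace E'" "w \<in> weyl_group \<Phi>"
  shows "weyl_restrict \<Phi> P w E' \<in> weyl_group (\<Phi> \<inter> E')"
    and "inversion_set (P \<inter> E') (weyl_restrict \<Phi> P w E') = inversion_set P w \<inter> E'"
proof -
  interpret E: root_base "\<Phi> \<inter> E'" "P \<inter> E'"
    using root_base_Int[OF assms(1)] .
  obtain as where as: "set as \<subseteq> \<Phi>" "w = refl_word as"
    using assms by (auto simp: weyl_group_iff)
  have "linear (\<lambda>x. h \<bullet> w x)"
    using linear_compose[OF linear_refl_word[of as]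
        bounded_linear.linear[OF bounded_linear_inner_right[of h]]]
    by (simp add: as comp_def)
  moreover have "\<forall>\<beta>\<in>\<Phi> \<inter> E'. h \<bullet> w \<beta> \<noteq> 0"
    using assms weyl_root h_nonzero by blast
  ultimately obtain w' where w': "w' \<in> weyl_group (\<Phi> \<inter> E')"
    "\<forall>\<beta>\<in>\<Phi> \<inter> E'. w' \<beta> \<in> P \<inter> E' \<longleftrightarrow> h \<bullet> w \<beta> > 0"
    using E.weyl_functional by blast
  have "inversion_set (P \<inter> E') w' = inversion_set P w \<inter> E'"
    using w' assms pos_root
    by (auto simp: E.inversion_set_iff inversion_set_iff) (auto simp: pos_iff weyl_root)
  then have "\<exists>!w'. w' \<in> weyl_group (\<Phi> \<inter> E') \<and>
      inversion_set (P \<inter> E') w' = inversion_set P w \<inter> E'"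
    using w' E.inversion_set_inject by (intro ex1I[of _ w']) auto
  from theI'[OF this] show "weyl_restrict \<Phi> P w E' \<in> weyl_group (\<Phi> \<inter> E')"
    "inversion_set (P \<inter> E') (weyl_restrict \<Phi> P w E') = inversion_set P w \<inter> E'"
    unfolding weyl_restrict_def by auto
qed

section \<open>Boolean elements\<close>

text \<open>The exchange condition read downwards. The word is arbitrary, not necessarily reduced,
  so the step can be iterated along a chain of covers.\<close>

lemma cover_deletion:
  assumes "bruhat_cover \<Phi> P u (refl_word as)" "set as \<subseteq> \<Delta>"
  shows "\<exists>xs a ys. as = xs @ a # ys \<and> u = refl_word (xs @ ys)"
proof -
  let ?v = "refl_word as"
  obtain \<gamma> where \<gamma>: "\<gamma> \<in> \<Phi>" "?v = u \<circ> reflection \<gamma>" "len ?v = len u + 1"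
    using assms unfolding bruhat_cover_def by blast
  \<comment> \<open>The exchange condition asks for a positive root; the reflection is the same for
    both signs.\<close>
  define \<beta> where "\<beta> = (if \<gamma> \<in> P then \<gamma> else - \<gamma>)"
  have \<beta>: "\<beta> \<in> P" "?v = u \<circ> reflection \<beta>"
    using \<gamma> neg_pos_iff by (auto simp: \<beta>_def reflection_uminus)
  have u: "?v \<circ> reflection \<beta> = u"
    unfolding \<beta>(2) by (rule ext) simp
  have "?v \<beta> \<notin> P"
    using len_reflection_greater[OF simple_word_weyl[OF assms(2)] \<beta>(1)] \<gamma>(3)
    unfolding u by auto
  then show ?thesis
    using exchange[OF assms(2) \<beta>(1)] unfolding u by blast
qed

text \<open>Half of the subword property, keeping track only of the set of letters.\<close>

lemma bruhat_le_word:
  assumes "bruhat_le \<Phi> P u (refl_word as)" "set as \<subseteq> \<Delta>"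
  shows "\<exists>bs. set bs \<subseteq> set as \<and> u = refl_word bs"
  using assms(1) unfolding bruhat_le_def
proof (induction rule: converse_rtranclp_induct)
  case base
  then show ?case by blast
next
  case (step u v)
  then obtain bs where bs: "set bs \<subseteq> set as" "v = refl_word bs" by blast
  then obtain xs a ys where "bs = xs @ a # ys" "u = refl_word (xs @ ys)"
    using cover_deletion[of u bs] step assms(2) by blast
  then show ?case
    using bs by (intro exI[of _ "xs @ ys"]) auto
qed

lemma bruhat_cover_insert:
  assumes "reduced_word (xs @ ys)" "reduced_word (xs @ a # ys)"
  shows "bruhat_cover \<Phi> P (refl_word (xs @ ys)) (refl_word (xs @ a # ys))"
proof -
  let ?\<beta> = "refl_word (rev ys) a"
  have sub: "set (xs @ ys) \<subseteq> \<Delta>" "a \<in> \<Delta>"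
    using assms by (auto simp: reduced_word_def)
  have "refl_word (a # ys) = refl_word ys \<circ> reflection ?\<beta>"
    by (simp add: refl_word_comp_reflection refl_word_Cons)
  then have "refl_word (xs @ a # ys) = refl_word (xs @ ys) \<circ> reflection ?\<beta>"
    by (simp only: refl_word_append comp_assoc)
  moreover have "?\<beta> \<in> \<Phi>"
    using sub by (intro simple_word_root) (auto simp: simple_root)
  moreover have "len (refl_word (xs @ a # ys)) = len (refl_word (xs @ ys)) + 1"
    using assms by (simp add: reduced_word_def)
  ultimately show ?thesis
    unfolding bruhat_cover_def using simple_word_weyl[OF sub(1)] by blast
qed

lemma bruhat_le_prefix:
  "reduced_word (xs @ ys) \<Longrightarrow> bruhat_le \<Phi> P (refl_word xs) (refl_word (xs @ ys))"
proof (induction ys rule: rev_induct)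
  case Nil
  then show ?case by (simp add: bruhat_le_def)
next
  case (snoc y ys)
  have red: "reduced_word ((xs @ ys) @ [])" "reduced_word ((xs @ ys) @ [y])"
    using snoc.prems reduced_appendD(1)[of "xs @ ys" "[y]"] by simp_all
  then have "bruhat_cover \<Phi> P (refl_word (xs @ ys)) (refl_word (xs @ ys @ [y]))"
    using bruhat_cover_insert[OF red] by simp
  then show ?case
    using snoc.IH red unfolding bruhat_le_def by simp
qed

lemma simple_in_span:
  assumes "a \<in> \<Delta>" "S \<subseteq> \<Delta>" "a \<in> span S" shows "a \<in> S"
  using coord_span[OF assms(3,2), of a] assms(1) by (auto simp: coord_simple)

text \<open>The rank \<open>n\<close> of the lattice is squeezed: the prefixes form a chain, whence
  \<open>length as \<le> n\<close>, and the atoms come from letters, whence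
  \<open>n \<le> card (set as)\<close>.\<close>

lemma boolean_imp_distinct:
  assumes bool: "boolean_element \<Phi> P (refl_word as)" and red: "reduced_word as"
  shows "distinct as"
proof -
  let ?w = "refl_word as" and ?le = "bruhat_le \<Phi> P"
  let ?I = "bruhat_interval \<Phi> P id ?w"
  obtain n f where f: "bij_betw f ?I (Pow {1..n::nat})"
    and ord: "\<And>u v. u \<in> ?I \<Longrightarrow> v \<in> ?I \<Longrightarrow> ?le u v \<longleftrightarrow> f u \<subseteq> f v"
    using bool unfolding boolean_element_def by blast
  have sub: "set as \<subseteq> \<Delta>"
    using red by (simp add: reduced_word_def)
  have inj: "u = v" if "u \<in> ?I" "v \<in> ?I" "f u = f v" for u v
    using f that by (meson bij_betw_imp_inj_on inj_onD)
  have trans: "?le u x" if "?le u v" "?le v x" for u v x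
    using that unfolding bruhat_le_def by (rule rtranclp_trans)
  have id_le: "?le id (refl_word bs)" if "reduced_word bs" for bs
    using bruhat_le_prefix[of "[]" bs] that by simp
  have prefix: "refl_word (take i as) \<in> ?I" for i
  proof -
    have "reduced_word (take i as)" "?le (refl_word (take i as)) ?w"
      using red reduced_appendD(1)[of "take i as" "drop i as"]
        bruhat_le_prefix[of "take i as" "drop i as"] by simp_all
    then show ?thesis
      using id_le simple_word_weyl by (simp add: bruhat_interval_def reduced_word_def)
  qed
  have id_in: "id \<in> ?I"
    using prefix[of 0] by simp
  \<comment> \<open>Successive prefixes are comparable and have different lengths, so their images
    under \<open>f\<close> grow strictly.\<close>
  have "i \<le> card (f (refl_word (take i as)))" if "i \<le> length as" for i
    using that
  proof (induction i)
    case (Suc i)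
    let ?u = "refl_word (take i as)" and ?v = "refl_word (take (Suc i) as)"
    have eq: "take (Suc i) as = take i as @ [as ! i]"
      using Suc.prems by (simp add: take_Suc_conv_app_nth)
    have red': "reduced_word (take i as)" "reduced_word (take (Suc i) as)"
      using red reduced_appendD(1)[of "take i as" "drop i as"]
        reduced_appendD(1)[of "take (Suc i) as" "drop (Suc i) as"] by simp_all
    then have "?le ?u ?v"
      using bruhat_le_prefix[of "take i as" "[as ! i]"] by (simp add: eq)
    then have "f ?u \<subseteq> f ?v"
      using ord[OF prefix prefix] by blast
    moreover have "len ?u \<noteq> len ?v"
      using red' Suc.prems by (simp add: reduced_word_def)
    then have "f ?u \<noteq> f ?v"
      using inj[OF prefix prefix] by metis
    moreover have "finite (f ?v)"
    proof -
      have "f ?v \<in> Pow {1..n}"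
        using f prefix by (rule bij_betwE[rule_format])
      then show ?thesis
        by (auto intro: finite_subset)
    qed
    ultimately have "card (f ?u) < card (f ?v)"
      by (intro psubset_card_mono psubsetI)
    then show ?case
      using Suc by simp
  qed simp
  from this[of "length as"] have "length as \<le> card (f ?w)"
    by simp
  also have "f ?w \<in> Pow {1..n}"
    using f prefix[of "length as"] by (auto dest: bij_betwE)
  then have "card (f ?w) \<le> n"
    using card_mono[of "{1..n}" "f ?w"] by simp
  finally have len_n: "length as \<le> n" .
  have f_surj: "\<exists>x\<in>?I. f x = J" if "J \<subseteq> {1..n}" for J
    using f that by (metis PowI bij_betw_imp_surj_on imageE)
  have id_le': "?le id x" if "x \<in> ?I" for x
    using that by (simp add: bruhat_interval_def)
  have f_id: "f id = {}"
    using f_surj[of "{}"] ord[OF id_in] id_le' by blast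
  \<comment> \<open>The element with image \<open>{j}\<close> lies above the reflection in the first
    letter of its reduced word. That reflection is not \<open>id\<close>, so it has the same image;
    different \<open>j\<close> therefore need different letters.\<close>
  have "\<exists>a\<in>set as. f (reflection a) = {j}" if j: "j \<in> {1..n}" for j
  proof -
    obtain x where x: "x \<in> ?I" "f x = {j}"
      using f_surj[of "{j}"] j by blast
    then obtain bs where bs: "reduced_word bs" "x = refl_word bs"
      using reduced_word_exists by (auto simp: bruhat_interval_def)
    have "bs \<noteq> []"
      using x f_id bs by auto
    then obtain a cs where acs: "bs = [a] @ cs"
      by (cases bs) auto
    have red_a: "reduced_word [a]"
      using bs acs reduced_appendD(1) by blast
    have le: "?le (reflection a) x"
      using bruhat_le_prefix[of "[a]" cs] bs acs by (simp add: refl_word_single)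
    then have le_w: "?le (reflection a) ?w"
      using trans x(1) by (auto simp: bruhat_interval_def)
    have a: "a \<in> \<Delta>"
      using red_a by (simp add: reduced_word_def)
    have aI: "reflection a \<in> ?I"
      using le_w id_le[OF red_a] simple_word_weyl[of "[a]"] a
      by (simp add: bruhat_interval_def refl_word_single)
    have "len (reflection a) = 1" "len id = 0"
      using red_a reduced_Nil unfolding reduced_word_def by (simp_all add: refl_word_single)
    then have "f (reflection a) \<noteq> f id"
      using inj[OF aI id_in] by auto
    moreover have "f (reflection a) \<subseteq> {j}"
      using ord[OF aI x(1)] le x by simp
    ultimately have "f (reflection a) = {j}"
      using f_id by blast
    \<comment> \<open>The reflection moves \<open>a\<close> by \<open>- 2 *\<^sub>R a\<close>, so
      \<open>a\<close> lies in the span of any letters expressing it; independence of the simple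
      roots puts it among the letters of \<open>as\<close>.\<close>
    moreover have "a \<in> set as"
    proof -
      obtain ds where ds: "set ds \<subseteq> set as" "reflection a = refl_word ds"
        using bruhat_le_word[OF le_w sub] by blast
      have "refl_word ds a - a = - 2 *\<^sub>R a"
        by (simp flip: ds(2) add: scaleR_2)
      then have "- 2 *\<^sub>R a \<in> span (set ds)"
        using refl_word_minus_in_span[of ds a] by simp
      then have "(- 1 / 2) *\<^sub>R (- 2 *\<^sub>R a) \<in> span (set ds)"
        by (rule span_scale)
      then have "a \<in> span (set as)"
        using span_mono[OF ds(1)] by auto
      then show ?thesis
        using simple_in_span a sub by blast
    qed
    ultimately show ?thesis by blast
  qed
  then have "{1..n} \<subseteq> (\<lambda>a. the_elem (f (reflection a))) ` set as"
    by (metis (no_types, lifting) imageI subsetI the_elem_eq)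
  then have "n \<le> card (set as)"
    using surj_card_le[of "set as" "{1..n}"] by simp
  then show ?thesis
    using len_n card_length[of as] by (intro card_distinct) simp
qed

text \<open>All subwords are reduced and correspond to sets of letters. Their inversions span the
  same subspace as their letters, so different sets give different elements.\<close>

lemma distinct_imp_boolean:
  assumes dist: "distinct as" and sub: "set as \<subseteq> \<Delta>"
  shows "boolean_element \<Phi> P (refl_word as)"
proof -
  let ?w = "refl_word as" and ?le = "bruhat_le \<Phi> P"
  let ?I = "bruhat_interval \<Phi> P id ?w"
  define e where "e J = refl_word (filter (\<lambda>a. a \<in> J) as)" for J
  have red: "reduced_word (filter (\<lambda>a. a \<in> J) as)" for J
    using dist sub by (intro distinct_reduced) auto
  have cover: "bruhat_cover \<Phi> P (e J) (e (insert a J))" if a: "a \<in> set as" "a \<notin> J" for a J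
  proof -
    obtain xs ys where as: "as = xs @ a # ys"
      using a split_list by metis
    define X Y where "X = filter (\<lambda>a. a \<in> J) xs" and "Y = filter (\<lambda>a. a \<in> J) ys"
    have "a \<notin> set xs" "a \<notin> set ys"
      using dist as by auto
    then have 1: "filter (\<lambda>b. b \<in> insert a J) xs = X" "filter (\<lambda>b. b \<in> insert a J) ys = Y"
      unfolding X_def Y_def by (auto intro!: filter_cong)
    have 2: "filter (\<lambda>b. b \<in> insert a J) as = X @ a # Y" "filter (\<lambda>b. b \<in> J) as = X @ Y"
      using 1 a(2) by (simp_all add: as X_def Y_def)
    show ?thesis
      unfolding e_def 2
      using red[of J] red[of "insert a J"] unfolding 2 by (rule bruhat_cover_insert)
  qed
  have le: "?le (e J) (e (J \<union> D))" if "finite D" "D \<subseteq> set as" for J D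
    using that
  proof (induction D rule: finite_induct)
    case empty
    then show ?case by (simp add: bruhat_le_def)
  next
    case (insert x D)
    show ?case
    proof (cases "x \<in> J")
      case True
      then show ?thesis
        using insert by (simp add: insert_absorb)
    next
      case False
      then have "bruhat_cover \<Phi> P (e (J \<union> D)) (e (insert x (J \<union> D)))"
        using insert by (intro cover) auto
      then show ?thesis
        using insert by (simp add: bruhat_le_def)
    qed
  qed
  have le_mono: "?le (e J) (e K)" if "J \<subseteq> K" "K \<subseteq> set as" for J K
    using le[of K J] that by (simp add: finite_subset[of K "set as"] Un_absorb1)
  \<comment> \<open>Each letter occurs once, so deleting an occurrence means removing the letter
    from \<open>J\<close>, and the family \<open>e\<close> is closed downwards.\<close>
  have below: "\<exists>J. J \<subseteq> K \<and> u = e J" if "?le u (e K)" for u K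
    using that unfolding bruhat_le_def
  proof (induction rule: converse_rtranclp_induct)
    case base
    then show ?case by blast
  next
    case (step u v)
    then obtain J where J: "J \<subseteq> K" "v = e J" by blast
    then obtain xs a ys where 1: "filter (\<lambda>b. b \<in> J) as = xs @ a # ys" "u = refl_word (xs @ ys)"
      using cover_deletion[of u "filter (\<lambda>b. b \<in> J) as"] step(1) sub unfolding e_def by force
    have "distinct (xs @ a # ys)"
      using dist distinct_filter[of as "\<lambda>b. b \<in> J"] 1 by simp
    then have "\<forall>b\<in>set xs. b \<noteq> a" "\<forall>b\<in>set ys. b \<noteq> a"
      by auto
    then have "filter (\<lambda>b. b \<noteq> a) (xs @ a # ys) = xs @ ys"
      by (simp add: filter_True)
    moreover have "filter (\<lambda>b. b \<in> J - {a}) as = filter (\<lambda>b. b \<noteq> a) (filter (\<lambda>b. b \<in> J) as)"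
      by (auto intro: filter_cong)
    ultimately have "u = e (J - {a})"
      using 1 by (simp add: e_def)
    then show ?case
      using J by blast
  qed
  have e_subset: "J \<subseteq> K" if "e J = e K" "J \<subseteq> set as" "K \<subseteq> set as" for J K
  proof
    fix a assume a: "a \<in> J"
    have sp: "span (inversion_set P (e L)) = span L" if "L \<subseteq> set as" for L
    proof -
      have "set (filter (\<lambda>a. a \<in> L) as) = L"
        using that by auto
      then show ?thesis
        using reduced_inversions[OF red[of L]] span_inv_roots[of "filter (\<lambda>a. a \<in> L) as"]
        by (simp add: e_def)
    qed
    have "a \<in> span K"
      using sp[of J] sp[of K] that a span_base[of a J] by simp
    then show "a \<in> K"
      using simple_in_span[of a K] that a sub by blast
  qed
  have inj: "inj_on e (Pow (set as))"
  proof (rule inj_onI)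
    fix J K assume "J \<in> Pow (set as)" "K \<in> Pow (set as)" "e J = e K"
    then show "J = K"
      using e_subset[of J K] e_subset[of K J] by simp
  qed
  have e_id: "e {} = id" and e_w: "e (set as) = ?w"
    by (simp_all add: e_def)
  have I: "?I = e ` Pow (set as)"
  proof
    show "?I \<subseteq> e ` Pow (set as)"
      using below[of _ "set as"] e_w by (auto simp: bruhat_interval_def)
    have "e J \<in> weyl_group \<Phi>" for J
      using sub unfolding e_def by (intro simple_word_weyl) auto
    then show "e ` Pow (set as) \<subseteq> ?I"
      using le_mono[of "{}"] le_mono[of _ "set as"] e_w e_id by (auto simp: bruhat_interval_def)
  qed
  \<comment> \<open>Numbers the letters, since the definition asks for subsets of
    \<open>{1..n}\<close>.\<close>
  obtain g where g: "bij_betw g (set as) {1..card (set as)}"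
    using ex_bij_betw_nat_finite_1[OF finite_set] bij_betw_inv by blast
  define f where "f = image g \<circ> inv_into (Pow (set as)) e"
  have f_e: "f (e J) = g ` J" if "J \<subseteq> set as" for J
    using that inj by (simp add: f_def)
  have "bij_betw f ?I (Pow {1..card (set as)})"
    unfolding f_def
  proof (rule bij_betw_trans)
    show "bij_betw (inv_into (Pow (set as)) e) ?I (Pow (set as))"
      using inj I by (intro bij_betw_inv_into) (simp add: bij_betw_def)
    show "bij_betw (image g) (Pow (set as)) (Pow {1..card (set as)})"
      using g by (rule bij_betw_Pow)
  qed
  moreover have "?le u v \<longleftrightarrow> f u \<subseteq> f v" if uv: "u \<in> ?I" "v \<in> ?I" for u v
  proof -
    obtain J K where JK: "u = e J" "J \<subseteq> set as" "v = e K" "K \<subseteq> set as"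
      using uv I by auto
    have "?le u v \<longleftrightarrow> J \<subseteq> K"
    proof
      assume "?le u v"
      then obtain J' where "J' \<subseteq> K" "e J = e J'"
        using below JK by blast
      then show "J \<subseteq> K"
        using e_subset[of J J'] JK by blast
    qed (use JK le_mono in blast)
    also have "\<dots> \<longleftrightarrow> f u \<subseteq> f v"
      using JK inj_on_image_subset_iff[OF bij_betw_imp_inj_on[OF g], of J K] by (simp add: f_e)
    finally show ?thesis .
  qed
  ultimately show ?thesis
    unfolding boolean_element_def by blast
qed

lemma boolean_element_iff:
  assumes "w \<in> weyl_group \<Phi>"
  shows "boolean_element \<Phi> P w \<longleftrightarrow> independent (inversion_set P w)"
proof -
  obtain as where as: "reduced_word as" "w = refl_word as"
    using reduced_word_exists assms by blast
  then show ?thesis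
    using independent_inversions_iff[OF as(1)] boolean_imp_distinct distinct_imp_boolean
    by (metis reduced_word_def)
qed

section \<open>Minimal dependent inversion sets\<close>

lemma cartan_symmetric_zero: "cartan_number a b = 0 \<Longrightarrow> cartan_number b a = 0"
  by (auto simp: cartan_number_def inner_commute)

lemma cartan_simple_less:
  assumes "a \<in> \<Delta>" "b \<in> \<Delta>" "a \<noteq> b" "cartan_number a b \<noteq> 0"
  shows "cartan_number a b \<le> - 1"
proof -
  obtain m :: int where "cartan_number a b = m"
    using cartan_int assms simple_root by (meson Ints_cases)
  then show ?thesis
    using cartan_simple_nonpos[OF assms(1-3)] assms(4) by simp
qed

text \<open>Both Cartan numbers are at most -1, so four times the squared cosine is at least 1:
  adjacent simple roots enclose an angle of at least 120 degrees.\<close>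

lemma inner_simple_le:
  assumes "a \<in> \<Delta>" "b \<in> \<Delta>" "a \<noteq> b" "cartan_number a b \<noteq> 0"
  shows "a \<bullet> b \<le> - (norm a * norm b) / 2"
proof -
  have ab: "cartan_number a b \<le> - 1"
    using assms by (rule cartan_simple_less)
  have ba: "cartan_number b a \<le> - 1"
    using assms cartan_symmetric_zero by (intro cartan_simple_less) auto
  have nz: "norm a > 0" "norm b > 0"
    using assms simple_pos pos_nonzero by auto
  have "1 \<le> cartan_number a b * cartan_number b a"
    using mult_mono[of 1 "- cartan_number a b" 1 "- cartan_number b a"] ab ba by simp
  also have "\<dots> = (2 * (a \<bullet> b))\<^sup>2 / (norm a * norm b)\<^sup>2"
    by (simp add: cartan_number_def power2_eq_square dot_square_norm[unfolded power2_eq_square]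
        inner_commute)
  finally have "(norm a * norm b)\<^sup>2 \<le> (- 2 * (a \<bullet> b))\<^sup>2"
    using nz by (simp add: le_divide_eq)
  moreover have "0 \<le> - 2 * (a \<bullet> b)"
    using simple_obtuse[OF assms(1-3)] by simp
  ultimately have "norm a * norm b \<le> - 2 * (a \<bullet> b)"
    by (rule power2_le_imp_le)
  then show ?thesis by simp
qed

text \<open>Three unit vectors at pairwise angles of at least 120 degrees have a sum of squared norm
  at most 0; but a sum of positive multiples of positive roots is not zero, as \<open>h\<close>
  shows.\<close>

lemma no_triangle:
  assumes "a \<in> \<Delta>" "b \<in> \<Delta>" "c \<in> \<Delta>" "a \<noteq> b" "a \<noteq> c" "b \<noteq> c"
    and "cartan_number a b \<noteq> 0" "cartan_number a c \<noteq> 0" "cartan_number b c \<noteq> 0"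
  shows False
proof -
  have nz: "norm a > 0" "norm b > 0" "norm c > 0"
    using assms simple_pos pos_nonzero by auto
  define n where "n x = (1 / norm x) *\<^sub>R x" for x :: 'a
  have self: "n x \<bullet> n x = 1" if "norm x > 0" for x
    using that by (simp add: n_def dot_square_norm power2_eq_square)
  have other: "n x \<bullet> n y \<le> - 1 / 2" if "norm x > 0" "norm y > 0" "x \<bullet> y \<le> - (norm x * norm y) / 2"
    for x y
    using that by (simp add: n_def divide_le_eq field_simps)
  have "n a \<bullet> n b \<le> - 1 / 2" "n a \<bullet> n c \<le> - 1 / 2" "n b \<bullet> n c \<le> - 1 / 2"
    by (rule other inner_simple_le nz assms)+
  then have "(n a + n b + n c) \<bullet> (n a + n b + n c) \<le> 0"
    using nz by (simp add: inner_add_left inner_add_right self inner_commute)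
  then have "n a + n b + n c = 0"
    by (metis inner_ge_zero inner_eq_zero_iff antisym)
  then have "h \<bullet> (n a + n b + n c) = 0"
    by simp
  moreover have "h \<bullet> n x > 0" if "x \<in> \<Delta>" for x
    using simple_pos[OF that] pos_nonzero by (simp add: n_def pos_iff)
  then have "h \<bullet> (n a + n b + n c) > 0"
    using assms by (simp add: inner_add_right add_pos_pos)
  ultimately show False by simp
qed

text \<open>The first inversion \<open>s\<^sub>n \<cdots> s\<^sub>1 c\<close> of the word is a combination of the others whose
  coefficients are the Cartan numbers of \<open>c\<close>; general position makes all of them nonzero.\<close>

lemma star_if_general_position:
  assumes sub: "set (a # bs @ [c]) \<subseteq> \<Delta>" and card: "card \<Delta> \<le> Suc (length bs)"
    and dist: "distinct (inv_roots (a # bs @ [c]))"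
    and gen: "\<And>S. S \<subseteq> set (inv_roots (a # bs @ [c])) \<Longrightarrow> card S \<le> Suc (length bs)
      \<Longrightarrow> independent S"
  shows "distinct (c # bs)" "set (c # bs) = \<Delta>" "a = c" "b \<in> set bs \<Longrightarrow> cartan_number c b \<noteq> 0"
proof -
  let ?s = "refl_word [c]"
  have inj_s: "inj_on ?s X" for X
    by (rule inj_onI) simp
  have dist': "distinct (inv_roots (bs @ [c]))" "distinct (inv_roots (a # bs))"
  proof -
    show "distinct (inv_roots (bs @ [c]))"
      using dist by simp
    have "distinct (map ?s (inv_roots (a # bs)))"
      using dist inv_roots_append[of "a # bs" "[c]"] by simp
    then show "distinct (inv_roots (a # bs))"
      by (simp only: distinct_map)
  qed
  have "independent (set (inv_roots (bs @ [c])))"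
    using dist' by (intro gen) (auto simp: distinct_card)
  then have dist_bs: "distinct (bs @ [c])"
    using independent_inv_roots_iff[OF _ dist'(1)] sub by simp
  then show 1: "distinct (c # bs)"
    by auto
  show 2: "set (c # bs) = \<Delta>"
  proof (rule card_subset_eq[OF finite_simple])
    show "set (c # bs) \<subseteq> \<Delta>"
      using sub by auto
    then have "card (set (c # bs)) \<le> card \<Delta>"
      by (rule card_mono[OF finite_simple])
    then show "card (set (c # bs)) = card \<Delta>"
      using distinct_card[OF 1] card by simp
  qed
  \<comment> \<open>All roots but the last are the images under \<open>s_c\<close> of the roots of
    \<open>a # bs\<close>, and independence can be pulled back along this injection.\<close>
  have "independent (?s ` set (inv_roots (a # bs)))"
  proof (rule gen)
    show "?s ` set (inv_roots (a # bs)) \<subseteq> set (inv_roots (a # bs @ [c]))"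
      using inv_roots_append[of "a # bs" "[c]"] by auto
    show "card (?s ` set (inv_roots (a # bs))) \<le> Suc (length bs)"
      by (rule card_image_le[THEN order_trans]) (use card_length[of "inv_roots (a # bs)"] in auto)
  qed
  then have "independent (set (inv_roots (a # bs)))"
    using linear_independent_injective_image[OF linear_refl_word[of "[c]"], of "?s ` set (inv_roots (a # bs))"]
    using inj_s by (simp add: image_image refl_word_single)
  then have "distinct (a # bs)"
    using independent_inv_roots_iff[OF _ dist'(2)] sub by simp
  \<comment> \<open>\<open>a\<close> is a simple root outside \<open>bs\<close>, and
    \<open>c\<close> is the only one left.\<close>
  then show ac: "a = c"
    using sub 2 by auto
  show "cartan_number c b \<noteq> 0" if b: "b \<in> set bs" for b
  proof
    assume zero: "cartan_number c b = 0"
    obtain i where i: "i < length bs" "bs ! i = b"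
      using b by (auto simp: in_set_conv_nth)
    define \<gamma> where "\<gamma> j = reflection c (inv_roots bs ! j)" for j
    define \<beta> where "\<beta> = refl_word (rev (bs @ [c])) c"
    have roots: "inv_roots (a # bs @ [c]) = \<beta> # map (reflection c) (inv_roots bs) @ [c]"
      using inv_roots_append[of bs "[c]"] by (simp add: ac \<beta>_def refl_word_single)
    have \<gamma>_nth: "\<gamma> j \<in> set (inv_roots (a # bs @ [c]))" if "j < length bs" for j
      using that unfolding roots by (auto simp: \<gamma>_def)
    have \<gamma>_inj: "\<gamma> j = \<gamma> k \<longleftrightarrow> j = k" if "j < length bs" "k < length bs" for j k
    proof -
      have "distinct (map (reflection c) (inv_roots bs))"
        using dist unfolding roots by simp
      then show ?thesis
        using that nth_eq_iff_index_eq[of "map (reflection c) (inv_roots bs)" j k]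
        by (simp add: \<gamma>_def)
    qed
    have "\<gamma> j \<in> reflection c ` set (inv_roots bs)" if "j < length bs" for j
      using that by (simp add: \<gamma>_def)
    then have ne: "\<beta> \<noteq> c" "\<gamma> i \<noteq> c" "\<And>j. j < length bs \<Longrightarrow> \<gamma> j \<noteq> \<beta>"
      using dist i(1) unfolding roots by force+
    \<comment> \<open>Leaving out the root with coefficient zero keeps \<open>S\<close> within the
      size that \<open>gen\<close> allows, yet \<open>\<beta>\<close> is still a combination of the
      rest.\<close>
    define S where "S = set (inv_roots (a # bs @ [c])) - {\<gamma> i}"
    have "card S = Suc (length bs)"
      unfolding S_def using distinct_card[OF dist] \<gamma>_nth[OF i(1)]
      by (simp only: card_Diff_singleton finite_set length_inv_roots) simp
    then have ind: "independent S"
      by (intro gen) (auto simp: S_def)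
    have \<beta>_S: "\<beta> \<in> S"
      using ne(3)[OF i(1)] unfolding S_def roots by auto
    have "\<beta> = reflection c (refl_word (rev bs) c)"
      by (simp add: \<beta>_def refl_word_Cons)
    also have "\<dots> = - c - (\<Sum>j<length bs. cartan_number c (bs ! j) *\<^sub>R \<gamma> j)"
      by (subst refl_word_rev_eq) (simp add: linear_diff[OF linear_reflection]
          linear_sum[OF linear_reflection] linear_scale[OF linear_reflection] \<gamma>_def)
    also have "\<dots> \<in> span (S - {\<beta>})"
    proof (intro span_diff span_sum span_neg)
      show "c \<in> span (S - {\<beta>})"
        using ne unfolding S_def roots by (intro span_base) auto
      show "cartan_number c (bs ! j) *\<^sub>R \<gamma> j \<in> span (S - {\<beta>})" if "j \<in> {..<length bs}" for j
      proof (cases "j = i")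
        case True
        then show ?thesis
          using zero i by (simp add: span_zero)
      next
        case False
        then have "\<gamma> j \<in> S - {\<beta>}"
          using that ne(3)[of j] \<gamma>_nth[of j] \<gamma>_inj[of j i] i by (simp add: S_def)
        then show ?thesis
          by (intro span_scale span_base)
      qed
    qed
    finally show False
      using ind \<beta>_S dependent_def by blast
  qed
qed

text \<open>General position passes to the window of the last \<open>n + 1\<close> letters, whose
  roots are inversions of the whole word. With at least two leaves, a second window rules out
  further letters.\<close>

lemma star_word:
  assumes red: "reduced_word as" and card: "card \<Delta> \<le> n" and len: "n < length as"
    and gen: "\<And>S. S \<subseteq> inversion_set P (refl_word as) \<Longrightarrow> card S \<le> n \<Longrightarrow> independent S"
  shows "\<exists>pre c bs. as = pre @ c # bs @ [c] \<and> distinct (c # bs) \<and> set (c # bs) = \<Delta> \<and>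
    bs \<noteq> [] \<and> (\<forall>b\<in>set bs. cartan_number c b \<noteq> 0) \<and>
    (\<forall>b\<in>set bs. \<forall>b'\<in>set bs. b \<noteq> b' \<longrightarrow> cartan_number b b' = 0) \<and>
    (length bs \<ge> 2 \<longrightarrow> pre = [])"
proof -
  have sub: "set as \<subseteq> \<Delta>"
    using red by (simp add: reduced_word_def)
  have inv: "inversion_set P (refl_word as) = set (inv_roots as)" "distinct (inv_roots as)"
    using reduced_inversions[OF red] by auto
  have "n \<noteq> 0"
  proof
    assume "n = 0"
    then have "\<Delta> = {}"
      using card finite_simple by simp
    then show False
      using sub len by auto
  qed
  define m where "m = length as - Suc n"
  define pre where "pre = take m as"
  have "length (drop m as) = Suc n"
    using len by (simp add: m_def)
  then obtain a as1 where d1: "drop m as = a # as1" "length as1 = n"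
    by (cases "drop m as") auto
  then obtain bs c where d2: "as1 = bs @ [c]" "length bs = n - 1"
    using \<open>n \<noteq> 0\<close> by (cases as1 rule: rev_cases) auto
  have as: "as = pre @ a # bs @ [c]"
    using append_take_drop_id[of m as] d1 d2 by (simp add: pre_def)
  have n: "n = Suc (length bs)"
    using d2 \<open>n \<noteq> 0\<close> by simp
  let ?u = "a # bs @ [c]"
  have roots: "inv_roots as = map (refl_word (rev ?u)) (inv_roots pre) @ inv_roots ?u"
    unfolding as by (rule inv_roots_append)
  have sub_u: "set ?u \<subseteq> \<Delta>" and card_u: "card \<Delta> \<le> Suc (length bs)"
    and dist_u: "distinct (inv_roots ?u)"
    using sub card n inv(2) unfolding roots distinct_append by (auto simp: as)
  have gen_u: "independent S" if "S \<subseteq> set (inv_roots ?u)" "card S \<le> Suc (length bs)" for S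
    using that by (intro gen) (auto simp: inv roots n)
  note star = star_if_general_position[OF sub_u card_u dist_u gen_u]
  have dist: "distinct (c # bs)" and set: "set (c # bs) = \<Delta>" and ac: "a = c"
    and adj: "\<And>b. b \<in> set bs \<Longrightarrow> cartan_number c b \<noteq> 0"
    using star by blast+
  \<comment> \<open>Two adjacent leaves would form a triangle with the centre.\<close>
  have leaves: "cartan_number b b' = 0" if "b \<in> set bs" "b' \<in> set bs" "b \<noteq> b'" for b b'
    using that no_triangle[of c b b'] adj set dist by auto
  have "bs \<noteq> []"
  proof
    assume "bs = []"
    then have "reduced_word ([c, c])"
      using red as ac reduced_appendD(2)[of pre "[c, c]"] by simp
    then have "- c \<in> P" "c \<in> \<Delta>"
      by (auto simp: reduced_Cons refl_word_single)
    then show False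
      using simple_pos neg_not_pos by blast
  qed
  moreover have "pre = []" if two: "length bs \<ge> 2"
  proof (rule ccontr)
    assume "pre \<noteq> []"
    then obtain pre' d where pre': "pre = pre' @ [d]"
      by (cases pre rule: rev_cases) auto
    obtain bs' b where bs': "bs = bs' @ [b]"
      using two by (cases bs rule: rev_cases) auto
    obtain b1 bs'' where bs'': "bs' = b1 # bs''"
      using two bs' by (cases bs') auto
    \<comment> \<open>The window moved one letter to the left. Up to \<open>s_c\<close> its roots
      are inversions too, so its last letter \<open>b\<close> is adjacent to both \<open>c\<close>
      and \<open>b1\<close>, which are adjacent to each other.\<close>
    let ?v = "d # (c # bs') @ [b]"
    have roots_v: "inv_roots as = map (refl_word (rev (?v @ [c]))) (inv_roots pre') @
        map (reflection c) (inv_roots ?v) @ inv_roots [c]"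
      unfolding as using inv_roots_append[of pre' "?v @ [c]"] inv_roots_append[of ?v "[c]"]
      by (simp add: pre' bs' ac refl_word_single)
    have "distinct (map (reflection c) (inv_roots ?v))"
      using inv(2) unfolding roots_v distinct_append by blast
    then have dist_v: "distinct (inv_roots ?v)"
      by (simp only: distinct_map)
    have sub_v: "set ?v \<subseteq> \<Delta>"
      using sub by (auto simp: as pre' bs' ac)
    have card_v: "card \<Delta> \<le> Suc (length (c # bs'))"
      using card n bs' by simp
    have gen_v: "independent S" if S: "S \<subseteq> set (inv_roots ?v)" "card S \<le> Suc (length (c # bs'))" for S
    proof -
      have inj: "inj_on (reflection c) X" for X
        by (rule inj_onI) (metis reflection_reflection)
      have "independent (reflection c ` S)"
      proof (rule gen)
        have "reflection c ` S \<subseteq> reflection c ` set (inv_roots ?v)"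
          using S(1) by (rule image_mono)
        then show "reflection c ` S \<subseteq> inversion_set P (refl_word as)"
          unfolding inv roots_v set_append set_map by blast
        show "card (reflection c ` S) \<le> n"
          using S(2) n bs' by (simp add: card_image inj)
      qed
      from linear_independent_injective_image[OF linear_reflection[of c] this inj]
      show ?thesis
        by (simp add: image_image)
    qed
    note star' = star_if_general_position[OF sub_v card_v dist_v gen_v]
    have "cartan_number b c \<noteq> 0" "cartan_number b b1 \<noteq> 0"
      using star'(4)[of c] star'(4)[of b1] bs'' by auto
    moreover have "cartan_number c b1 \<noteq> 0"
      using adj bs' bs'' by simp
    ultimately show False
      using no_triangle[of b c b1] set dist bs' bs'' by auto
  qed
  ultimately show ?thesis
    using as ac dist set adj leaves by blast
qed

text \<open>The component of \<open>c\<close> orthogonal to the leaves is nonzero by independence;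
  its squared norm, multiplied by \<open>4 / (c \<bullet> c)\<close>, is the difference of the two
  sides.\<close>

lemma star_cartan_sum:
  assumes "set (c # bs) \<subseteq> \<Delta>" "distinct (c # bs)"
    and orth: "\<forall>b\<in>set bs. \<forall>b'\<in>set bs. b \<noteq> b' \<longrightarrow> cartan_number b b' = 0"
  shows "(\<Sum>b\<leftarrow>bs. cartan_number c b * cartan_number b c) < 4"
proof -
  \<comment> \<open>Each summand is the projection of \<open>c\<close> to the line of a leaf; as the
    leaves are orthogonal, the sum is the projection to their span.\<close>
  define v where "v = c - (\<Sum>b\<in>set bs. (cartan_number c b / 2) *\<^sub>R b)"
  have nz: "b \<noteq> 0" if "b \<in> set (c # bs)" for b
    using that assms simple_pos pos_nonzero by blast
  have "v \<noteq> 0"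
  proof
    assume "v = 0"
    then have "c = (\<Sum>b\<in>set bs. (cartan_number c b / 2) *\<^sub>R b)"
      by (simp add: v_def)
    also have "\<dots> \<in> span (set bs)"
      by (intro span_sum span_scale span_base)
    finally show False
      using simple_in_span[of c "set bs"] assms by auto
  qed
  have vb: "v \<bullet> b = 0" if b: "b \<in> set bs" for b
  proof -
    have "(\<Sum>b'\<in>set bs. (cartan_number c b' / 2) * (b' \<bullet> b))
        = (\<Sum>b'\<in>set bs. if b' = b then c \<bullet> b else 0)"
    proof (intro sum.cong refl)
      fix b' assume b': "b' \<in> set bs"
      show "(cartan_number c b' / 2) * (b' \<bullet> b) = (if b' = b then c \<bullet> b else 0)"
      proof (cases "b' = b")
        case True
        then show ?thesis
          using nz[of b] b by (simp add: cartan_number_def)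
      next
        case False
        then have "cartan_number b' b = 0"
          using orth b b' by blast
        then show ?thesis
          using nz[of b] b False by (simp add: cartan_number_def)
      qed
    qed
    also have "\<dots> = c \<bullet> b"
      using b by simp
    finally show ?thesis
      by (simp add: v_def inner_diff_left inner_sum_left)
  qed
  have "0 < v \<bullet> v"
    using \<open>v \<noteq> 0\<close> by simp
  also have "v \<bullet> v = v \<bullet> c - (\<Sum>b\<in>set bs. (cartan_number c b / 2) * (v \<bullet> b))"
    by (subst (2) v_def) (simp add: inner_diff_right inner_sum_right)
  also have "\<dots> = v \<bullet> c"
    using vb by simp
  also have "\<dots> = c \<bullet> c - (\<Sum>b\<in>set bs. (cartan_number c b / 2) * (b \<bullet> c))"
    by (simp add: v_def inner_diff_left inner_sum_left)
  finally have lt: "(\<Sum>b\<in>set bs. (cartan_number c b / 2) * (b \<bullet> c)) < c \<bullet> c"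
    by simp
  have cc: "c \<bullet> c > 0"
    using nz[of c] by simp
  have "(\<Sum>b\<leftarrow>bs. cartan_number c b * cartan_number b c)
      = (\<Sum>b\<in>set bs. cartan_number c b * cartan_number b c)"
    using assms(2) by (simp add: sum_list_distinct_conv_sum_set)
  also have "\<dots> = 4 / (c \<bullet> c) * (\<Sum>b\<in>set bs. (cartan_number c b / 2) * (b \<bullet> c))"
    unfolding sum_distrib_left by (intro sum.cong refl) (simp add: cartan_number_def[of _ c])
  also have "\<dots> < 4 / (c \<bullet> c) * (c \<bullet> c)"
    using lt cc by (intro mult_strict_left_mono) auto
  finally show ?thesis
    using cc by simp
qed

end

section \<open>Patterns\<close>

text \<open>The Cartan matrix determines the action of the simple reflections on the simple roots,
  and every root arises from a simple one by a word. The last conjunct also carries group elements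
  across.\<close>

lemma root_system_iso_of_cartan_numbers:
  fixes \<Phi> P :: "'a::euclidean_space set" and R Q :: "'b::euclidean_space set"
  assumes \<Phi>: "root_base \<Phi> P" and R: "root_base R Q"
    and as: "distinct as" "set as = simple_roots P"
    and bs: "distinct bs" "set bs = simple_roots Q" and len: "length as = length bs"
    and cartan: "\<And>i j. i < length as \<Longrightarrow> j < length as \<Longrightarrow>
      cartan_number (as ! i) (as ! j) = cartan_number (bs ! i) (bs ! j)"
  shows "\<exists>\<phi>. root_system_iso \<phi> \<Phi> R \<and> \<phi> ` P = Q \<and> map \<phi> as = bs \<and>
    (\<forall>xs x. set xs \<subseteq> simple_roots P \<longrightarrow> x \<in> span \<Phi> \<longrightarrow>
      \<phi> (refl_word xs x) = refl_word (map \<phi> xs) (\<phi> x))"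
proof -
  interpret S: root_base \<Phi> P by (rule \<Phi>)
  interpret T: root_base R Q by (rule R)
  obtain \<phi> where lin: "linear \<phi>"
    and \<phi>: "\<forall>x\<in>simple_roots P. \<phi> x = the (map_of (zip as bs) x)"
    using linear_independent_extend[OF S.independent_simple, of "\<lambda>x. the (map_of (zip as bs) x)"]
    by blast
  have nth: "\<phi> (as ! i) = bs ! i" if "i < length as" for i
    using that \<phi> as(2) len map_of_zip_nth[of as bs i] as(1) nth_mem[OF that] by simp
  have map: "map \<phi> as = bs"
    using nth len by (intro nth_equalityI) auto
  have img: "\<phi> ` simple_roots P = simple_roots Q"
    using arg_cong[OF map, of set] as bs by simp
  have inj_simple: "inj_on \<phi> (simple_roots P)"
    using map bs(1) as by (metis distinct_map)
  have inj: "inj_on \<phi> (span \<Phi>)"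
    unfolding S.span_roots
    using T.independent_simple inj_simple img by (intro linear_inj_on_span_independent_image lin) auto
  have span: "\<phi> ` span \<Phi> = span R"
    by (simp add: S.span_roots T.span_roots linear_span_image[OF lin] flip: img)
  \<comment> \<open>Cartan numbers are linear in the first argument only, so for now the second one
    stays simple.\<close>
  have simple_cartan: "cartan_number (\<phi> x) (\<phi> a) = cartan_number x a"
    if xa: "x \<in> span \<Phi>" "a \<in> simple_roots P" for x a
  proof (rule linear_eq_on_span[where B = "simple_roots P" and x = x and
        f = "\<lambda>x. cartan_number (\<phi> x) (\<phi> a)" and g = "\<lambda>x. cartan_number x a"])
    show "linear (\<lambda>x. cartan_number (\<phi> x) (\<phi> a))" "linear (\<lambda>x. cartan_number x a)"
      by (rule linearI; simp add: linear_add[OF lin] linear_scale[OF lin] cartan_number_add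
          cartan_number_scale)+
    show "x \<in> span (simple_roots P)"
      using that S.span_roots by simp
    fix b assume "b \<in> simple_roots P"
    then obtain i j where "i < length as" "b = as ! i" "j < length as" "a = as ! j"
      using xa(2) as(2) by (metis in_set_conv_nth)
    then show "cartan_number (\<phi> b) (\<phi> a) = cartan_number b a"
      using cartan nth by simp
  qed
  have span_word: "refl_word xs x \<in> span \<Phi>" if "set xs \<subseteq> simple_roots P" "x \<in> span \<Phi>" for xs x
  proof -
    have "set xs \<subseteq> span \<Phi>"
      using that S.simple_root span_base by blast
    then have "refl_word xs x - x \<in> span \<Phi>"
      using refl_word_minus_in_span[of xs x] span_minimal[of "set xs" "span \<Phi>"] by auto
    then show ?thesis
      using span_add[OF _ that(2)] by fastforce
  qed
  have word: "\<phi> (refl_word xs x) = refl_word (map \<phi> xs) (\<phi> x)"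
    if "set xs \<subseteq> simple_roots P" "x \<in> span \<Phi>" for xs x
    using that(1)
  proof (induction xs)
    case (Cons a xs)
    then show ?case
      using simple_cartan[OF span_word[of xs x], of a] that(2)
      by (simp add: refl_word_Cons reflection_def linear_diff[OF lin] linear_scale[OF lin])
  qed simp
  have root: "\<phi> \<beta> \<in> R" if \<beta>: "\<beta> \<in> \<Phi>" for \<beta>
  proof -
    obtain xs b where xs: "set xs \<subseteq> simple_roots P" "b \<in> simple_roots P" "\<beta> = refl_word xs b"
      using S.root_eq_refl_word_simple \<beta> by blast
    then have "\<phi> \<beta> = refl_word (map \<phi> xs) (\<phi> b)"
      using word[of xs b] by (simp add: span_base S.simple_root)
    moreover have "set (map \<phi> xs) \<subseteq> simple_roots Q" "\<phi> b \<in> simple_roots Q"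
      using xs img by auto
    ultimately show ?thesis
      using T.simple_word_root T.simple_root by metis
  qed
  have roots: "\<phi> ` \<Phi> = R"
  proof
    show "\<phi> ` \<Phi> \<subseteq> R"
      using root by blast
    show "R \<subseteq> \<phi> ` \<Phi>"
    proof
      fix \<gamma> assume "\<gamma> \<in> R"
      then obtain ys b' where ys: "set ys \<subseteq> simple_roots Q" "b' \<in> simple_roots Q" "\<gamma> = refl_word ys b'"
        using T.root_eq_refl_word_simple by blast
      have "ys \<in> lists (\<phi> ` simple_roots P)"
        using ys(1) img by (auto simp: in_lists_conv_set)
      then obtain xs where xs: "set xs \<subseteq> simple_roots P" "ys = map \<phi> xs"
        by (auto simp: lists_image)
      obtain b where b: "b \<in> simple_roots P" "b' = \<phi> b"
        using ys(2) img by blast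
      have "\<gamma> = \<phi> (refl_word xs b)"
        using xs b ys(3) word[of xs b] by (simp add: span_base S.simple_root)
      then show "\<gamma> \<in> \<phi> ` \<Phi>"
        using S.simple_word_root xs b S.simple_root by blast
    qed
  qed
  have pos: "\<phi> \<beta> \<in> Q" if \<beta>: "\<beta> \<in> P" for \<beta>
  proof -
    obtain c where c: "\<forall>b\<in>simple_roots P. c b \<ge> (0::real)" "\<beta> = (\<Sum>b\<in>simple_roots P. c b *\<^sub>R b)"
      using S.pos_combination[OF \<beta>] by blast
    \<comment> \<open>The nonnegative combination gives only a weak inequality; it is strict because
      \<open>T.h\<close> vanishes on no root.\<close>
    have "T.h \<bullet> \<phi> \<beta> = (\<Sum>b\<in>simple_roots P. c b * (T.h \<bullet> \<phi> b))"
      unfolding c(2) by (simp add: linear_sum[OF lin] linear_scale[OF lin] inner_sum_right)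
    also have "\<dots> \<ge> 0"
    proof (intro sum_nonneg mult_nonneg_nonneg)
      fix b assume "b \<in> simple_roots P"
      then have "\<phi> b \<in> Q"
        using img T.simple_pos by blast
      then show "T.h \<bullet> \<phi> b \<ge> 0"
        by (simp add: T.pos_iff)
    qed (use c in blast)
    moreover have "\<phi> \<beta> \<in> R"
      using root S.pos_root \<beta> by blast
    ultimately show ?thesis
      using T.h_nonzero by (force simp: T.pos_iff)
  qed
  have "\<phi> ` P = Q"
  proof
    show "\<phi> ` P \<subseteq> Q"
      using pos by blast
    show "Q \<subseteq> \<phi> ` P"
    proof
      fix \<gamma> assume \<gamma>: "\<gamma> \<in> Q"
      then obtain \<beta> where \<beta>: "\<beta> \<in> \<Phi>" "\<gamma> = \<phi> \<beta>"
        using roots T.pos_root by blast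
      have "\<beta> \<in> P"
      proof (rule ccontr)
        assume "\<beta> \<notin> P"
        then have "- \<gamma> \<in> Q"
          using pos[of "- \<beta>"] S.neg_pos_iff \<beta> by (simp add: linear_neg[OF lin])
        then show False
          using \<gamma> T.neg_not_pos by blast
      qed
      then show "\<gamma> \<in> \<phi> ` P"
        using \<beta> by blast
    qed
  qed
  moreover have "cartan_number (\<phi> \<beta>) (\<phi> \<alpha>) = cartan_number \<beta> \<alpha>" if "\<alpha> \<in> \<Phi>" "\<beta> \<in> \<Phi>" for \<alpha> \<beta>
  proof -
    obtain xs a where xs: "set xs \<subseteq> simple_roots P" "a \<in> simple_roots P" "\<alpha> = refl_word xs a"
      using S.root_eq_refl_word_simple \<open>\<alpha> \<in> \<Phi>\<close> by blast
    \<comment> \<open>A word is an isometry intertwined by \<open>\<phi>\<close>; its inverse moves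
      \<open>\<alpha>\<close> to a simple root, where the comparison is known.\<close>
    define \<gamma> where "\<gamma> = refl_word (rev xs) \<beta>"
    have \<gamma>: "\<gamma> \<in> span \<Phi>" "\<beta> = refl_word xs \<gamma>"
      using span_word[of "rev xs" \<beta>] xs that by (simp_all add: \<gamma>_def span_base)
    have "cartan_number (\<phi> \<beta>) (\<phi> \<alpha>) = cartan_number (\<phi> \<gamma>) (\<phi> a)"
      unfolding \<gamma>(2) xs(3) using word xs \<gamma> by (simp add: cartan_number_refl_word span_base S.simple_root)
    also have "\<dots> = cartan_number \<gamma> a"
      using simple_cartan \<gamma> xs by blast
    also have "\<dots> = cartan_number \<beta> \<alpha>"
      unfolding \<gamma>(2) xs(3) by (simp add: cartan_number_refl_word)
    finally show ?thesis .
  qed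
  ultimately show ?thesis
    unfolding root_system_iso_def using lin inj span roots map word
    by (intro exI[of _ \<phi>]) (simp add: bij_betw_def)
qed

lemma root_system_iso_inj_on:
  "root_system_iso \<phi> \<Phi> R \<Longrightarrow> inj_on \<phi> (span \<Phi>)"
  by (auto simp: root_system_iso_def bij_betw_def)

lemma inversion_set_iso:
  fixes \<Phi> P :: "'a::euclidean_space set" and R Q :: "'b::euclidean_space set"
  assumes \<Phi>: "root_base \<Phi> P" and R: "root_base R Q"
    and w: "w \<in> weyl_group \<Phi>" and \<pi>: "\<pi> \<in> weyl_group R" and \<phi>: "\<phi> ` P = Q"
    and eq: "\<forall>x\<in>span \<Phi>. \<phi> (w x) = \<pi> (\<phi> x)" and inj: "inj_on \<phi> (span \<Phi>)"
  shows "inversion_set Q \<pi> = \<phi> ` inversion_set P w"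
proof -
  interpret S: root_base \<Phi> P by (rule \<Phi>)
  interpret T: root_base R Q by (rule R)
  have span: "\<beta> \<in> span \<Phi>" if "\<beta> \<in> \<Phi>" for \<beta>
    using that by (rule span_base)
  have "\<phi> \<gamma> \<in> Q \<longleftrightarrow> \<gamma> \<in> P" if "\<gamma> \<in> \<Phi>" for \<gamma>
  proof
    assume "\<phi> \<gamma> \<in> Q"
    then obtain \<delta> where "\<delta> \<in> P" "\<phi> \<gamma> = \<phi> \<delta>"
      using \<phi> by blast
    then show "\<gamma> \<in> P"
      using inj_onD[OF inj] span that S.pos_root by metis
  qed (use \<phi> in blast)
  then have "\<pi> (\<phi> \<beta>) \<in> Q \<longleftrightarrow> w \<beta> \<in> P" if "\<beta> \<in> P" for \<beta>
    using that eq span S.pos_root S.weyl_root[OF w] by metis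
  moreover have "inversion_set Q \<pi> = {\<gamma> \<in> Q. \<pi> \<gamma> \<notin> Q}" "inversion_set P w = {\<beta> \<in> P. w \<beta> \<notin> P}"
    using S.inversion_set_iff[OF w] T.inversion_set_iff[OF \<pi>] by blast+
  ultimately show ?thesis
    unfolding \<phi>[symmetric] by auto
qed

section \<open>Containment of patterns and independence of inversions\<close>

context root_base
begin

lemma contains_BP_independent:
  fixes Q :: "'b::euclidean_space set"
  assumes w: "w \<in> weyl_group \<Phi>" "independent (inversion_set P w)"
    and Q: "root_base (all_roots Q) Q" "\<pi> \<in> weyl_group (all_roots Q)"
    and contains: "contains_BP \<Phi> P w Q \<pi>"
  shows "independent (inversion_set Q \<pi>)"
proof -
  interpret T: root_base "all_roots Q" Q by (rule Q)
  obtain E' \<phi> where E': "subspace E'" and iso: "root_system_iso \<phi> (\<Phi> \<inter> E') (all_roots Q)"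
    and \<phi>P: "\<phi> ` (P \<inter> E') = Q"
    and \<pi>: "\<forall>x\<in>span (\<Phi> \<inter> E'). \<phi> (weyl_restrict \<Phi> P w E' x) = \<pi> (\<phi> x)"
    using contains unfolding contains_BP_def by blast
  interpret E: root_base "\<Phi> \<inter> E'" "P \<inter> E'"
    using root_base_Int[OF E'] .
  let ?w' = "weyl_restrict \<Phi> P w E'"
  note w' = weyl_restrict[OF E' w(1)]
  have "independent (inversion_set (P \<inter> E') ?w')"
    unfolding w'(2) using w(2) independent_mono by blast
  moreover have "inversion_set (P \<inter> E') ?w' \<subseteq> span (\<Phi> \<inter> E')"
    using E.pos_root span_base[of _ "\<Phi> \<inter> E'"] by (auto simp: inversion_set_def)
  then have "span (inversion_set (P \<inter> E') ?w') \<subseteq> span (\<Phi> \<inter> E')"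
    by (rule span_minimal) (rule subspace_span)
  then have "inj_on \<phi> (span (inversion_set (P \<inter> E') ?w'))"
    by (rule inj_on_subset[OF root_system_iso_inj_on[OF iso]])
  ultimately have "independent (\<phi> ` inversion_set (P \<inter> E') ?w')"
    using iso by (intro linear_independent_injective_image) (auto simp: root_system_iso_def)
  moreover have "inversion_set Q \<pi> = \<phi> ` inversion_set (P \<inter> E') ?w'"
    using inversion_set_iso[OF E.root_base_axioms Q(1) w'(1) Q(2) \<phi>P \<pi>] root_system_iso_inj_on[OF iso]
    by blast
  ultimately show ?thesis
    by simp
qed

text \<open>A list \<open>js\<close> of positions names corresponding words on both sides, and the
  Cartan matrices are nested lists, so that for concrete patterns their equality becomes a
  computation. The length is found by transporting inversions along the isomorphism.\<close>

lemma contains_BP_of_cartan_matrix: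
  fixes Q :: "'b::euclidean_space set"
  assumes "subspace E'" and Q: "root_base (all_roots Q) Q"
    and as: "distinct as" "set as = simple_roots (P \<inter> E')"
    and bs: "distinct bs" "set bs = simple_roots Q" and len: "length as = length bs"
    and cartan: "map (\<lambda>x. map (cartan_number x) as) as = map (\<lambda>x. map (cartan_number x) bs) bs"
    and w': "weyl_restrict \<Phi> P w E' = refl_word (map ((!) as) js)" "set js \<subseteq> {..<length as}"
    and w: "w \<in> weyl_group \<Phi>"
  shows "contains_BP \<Phi> P w Q (refl_word (map ((!) bs) js))" (is ?contains)
    and "coxeter_length Q (refl_word (map ((!) bs) js)) = card (inversion_set P w \<inter> E')"
proof -
  interpret E: root_base "\<Phi> \<inter> E'" "P \<inter> E'"
    using root_base_Int[OF assms(1)] .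
  interpret T: root_base "all_roots Q" Q by (rule Q)
  let ?\<pi> = "refl_word (map ((!) bs) js)"
  have cartan': "cartan_number (as ! i) (as ! j) = cartan_number (bs ! i) (bs ! j)"
    if "i < length as" "j < length as" for i j
    using arg_cong[OF cartan, of "\<lambda>m. m ! i ! j"] that len by simp
  obtain \<phi> where \<phi>: "root_system_iso \<phi> (\<Phi> \<inter> E') (all_roots Q)" "\<phi> ` (P \<inter> E') = Q" "map \<phi> as = bs"
    and word: "\<forall>xs x. set xs \<subseteq> simple_roots (P \<inter> E') \<longrightarrow> x \<in> span (\<Phi> \<inter> E') \<longrightarrow>
      \<phi> (refl_word xs x) = refl_word (map \<phi> xs) (\<phi> x)"
    using root_system_iso_of_cartan_numbers[OF root_base_Int[OF assms(1)] Q as bs len cartan'] by blast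
  have "map \<phi> (map ((!) as) js) = map ((!) bs) js"
    using w'(2) \<phi>(3) by (auto simp: subset_iff)
  moreover have "set (map ((!) as) js) \<subseteq> simple_roots (P \<inter> E')"
    using w'(2) as(2) by (auto simp: subset_iff)
  ultimately have eq: "\<forall>x\<in>span (\<Phi> \<inter> E'). \<phi> (weyl_restrict \<Phi> P w E' x) = ?\<pi> (\<phi> x)"
    using word w'(1) by metis
  then show ?contains
    using assms(1) \<phi> unfolding contains_BP_def by blast
  note res = weyl_restrict[OF assms(1) w]
  have \<pi>: "?\<pi> \<in> weyl_group (all_roots Q)"
    using w'(2) bs(2) len by (intro T.simple_word_weyl) (auto simp: subset_iff)
  have inj: "inj_on \<phi> (span (\<Phi> \<inter> E'))"
    using root_system_iso_inj_on[OF \<phi>(1)] .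
  have "inversion_set P w \<inter> E' \<subseteq> span (\<Phi> \<inter> E')"
    using E.pos_root span_base[of _ "\<Phi> \<inter> E'"] unfolding res(2)[symmetric]
    by (auto simp: inversion_set_def)
  then have "card (\<phi> ` (inversion_set P w \<inter> E')) = card (inversion_set P w \<inter> E')"
    using inj by (intro card_image inj_on_subset[OF inj])
  then show "coxeter_length Q ?\<pi> = card (inversion_set P w \<inter> E')"
    using inversion_set_iso[OF E.root_base_axioms Q res(1) \<pi> \<phi>(2) eq inj] res(2)
      T.card_inversion_set[OF \<pi>] by simp
qed

text \<open>For the types B2 and G2, where all elements of length at least 3 are patterns: the word
  of the restriction may stay unknown, and counting inversions gives its length.\<close>

lemma contains_BP_of_cartan_matrix_any:
  fixes Q :: "'b::euclidean_space set"
  assumes "subspace E'" and Q: "root_base (all_roots Q) Q"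
    and as: "distinct as" "set as = simple_roots (P \<inter> E')"
    and bs: "distinct bs" "set bs = simple_roots Q" and len: "length as = length bs"
    and cartan: "map (\<lambda>x. map (cartan_number x) as) as = map (\<lambda>x. map (cartan_number x) bs) bs"
    and w: "w \<in> weyl_group \<Phi>"
  shows "\<exists>\<pi>\<in>weyl_group (all_roots Q).
    coxeter_length Q \<pi> = card (inversion_set P w \<inter> E') \<and> contains_BP \<Phi> P w Q \<pi>"
proof -
  interpret E: root_base "\<Phi> \<inter> E'" "P \<inter> E'"
    using root_base_Int[OF assms(1)] .
  interpret T: root_base "all_roots Q" Q by (rule Q)
  obtain xs where xs: "set xs \<subseteq> set as" "weyl_restrict \<Phi> P w E' = refl_word xs"
    using weyl_restrict(1)[OF assms(1) w] E.weyl_group_simple_word as(2) by blast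
  have "set as = (!) as ` {..<length as}"
    by (auto simp: in_set_conv_nth image_iff)
  then have "xs \<in> lists ((!) as ` {..<length as})"
    using xs(1) by auto
  then obtain js where js: "set js \<subseteq> {..<length as}" "xs = map ((!) as) js"
    by (auto simp: lists_image)
  note contains = contains_BP_of_cartan_matrix[OF assms(1) Q as bs len cartan _ js(1) w,
      unfolded xs(2), OF arg_cong[OF js(2), of refl_word]]
  have "set (map ((!) bs) js) \<subseteq> simple_roots Q"
    using js(1) bs(2) len by (auto simp: subset_iff)
  then show ?thesis
    using contains T.simple_word_weyl by blast
qed

text \<open>A dependent \<open>S\<close> with at most \<open>dim E'\<close> elements spans a
  subspace of smaller dimension that still contains a dependency. Applied to all inversions in
  \<open>E'\<close>, this gives the strict inequality.\<close>

lemma minimal_dependent_subspace: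
  assumes w: "w \<in> weyl_group \<Phi>" and dep: "\<not> independent (inversion_set P w)"
  shows "\<exists>E'. subspace E' \<and> dim E' < card (inversion_set P w \<inter> E') \<and>
    (\<forall>S. S \<subseteq> inversion_set P w \<inter> E' \<longrightarrow> card S \<le> dim E' \<longrightarrow> independent S)"
proof -
  let ?I = "inversion_set P w"
  obtain E' where E': "subspace E'" "\<not> independent (?I \<inter> E')"
    and min: "\<And>F. subspace F \<Longrightarrow> \<not> independent (?I \<inter> F) \<Longrightarrow> dim E' \<le> dim F"
    using ex_has_least_nat[of "\<lambda>E'. subspace E' \<and> \<not> independent (?I \<inter> E')" UNIV dim]
      dep subspace_UNIV by (metis Int_UNIV_right)
  have gen: "independent S" if S: "S \<subseteq> ?I \<inter> E'" "card S \<le> dim E'" for S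
  proof (rule ccontr)
    assume depS: "\<not> independent S"
    have fin: "finite S"
      using S finite_inversion_set finite_subset by blast
    have "dim S \<noteq> card S"
      using card_eq_dim[of S S] fin depS span_superset[of S] by auto
    moreover have "dim S \<le> card S"
      using dim_le_card[of S S] fin span_superset by blast
    moreover have "\<not> independent (?I \<inter> span S)"
      using depS S span_superset[of S] by (metis (no_types, lifting) independent_mono Int_greatest inf.boundedE)
    then have "dim E' \<le> dim S"
      using min[of "span S"] by simp
    ultimately show False
      using S(2) by simp
  qed
  then have "dim E' < card (?I \<inter> E')"
    using E'(2) by (meson not_le_imp_less subset_refl)
  then show ?thesis
    using E' gen by blast
qed

lemma star_pattern:
  assumes w: "w \<in> weyl_group \<Phi>" and dep: "\<not> independent (inversion_set P w)"
  shows "\<exists>E' pre c bs. subspace E' \<and> weyl_restrict \<Phi> P w E' = refl_word (pre @ c # bs @ [c]) \<and>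
    root_base.reduced_word (P \<inter> E') (pre @ c # bs @ [c]) \<and>
    distinct (c # bs) \<and> set (c # bs) = simple_roots (P \<inter> E') \<and>
    bs \<noteq> [] \<and> (\<forall>b\<in>set bs. cartan_number c b \<noteq> 0) \<and>
    (\<forall>b\<in>set bs. \<forall>b'\<in>set bs. b \<noteq> b' \<longrightarrow> cartan_number b b' = 0) \<and>
    (length bs \<ge> 2 \<longrightarrow> pre = [])"
proof -
  obtain E' where E': "subspace E'" and card: "dim E' < card (inversion_set P w \<inter> E')"
    and gen: "\<forall>S. S \<subseteq> inversion_set P w \<inter> E' \<longrightarrow> card S \<le> dim E' \<longrightarrow> independent S"
    using minimal_dependent_subspace[OF assms] by blast
  interpret E: root_base "\<Phi> \<inter> E'" "P \<inter> E'"
    using root_base_Int[OF E'] .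
  note w' = weyl_restrict[OF E' w]
  obtain as where as: "E.reduced_word as" "weyl_restrict \<Phi> P w E' = refl_word as"
    using E.reduced_word_exists w'(1) by blast
  have inv: "inversion_set (P \<inter> E') (refl_word as) = inversion_set P w \<inter> E'"
    using w'(2) as(2) by simp
  have "dim E' < length as"
    using E.reduced_inversions[OF as(1)] card distinct_card[of "inv_roots as"] unfolding inv
    by simp
  \<comment> \<open>Only an upper bound, since the roots in \<open>E'\<close> might fail to span it;
    equality comes out later from the number of distinct letters in the window.\<close>
  moreover have "card E.\<Delta> \<le> dim E'"
    using E.independent_simple E.simple_pos by (intro independent_card_le_dim) auto
  ultimately show ?thesis
    using E.star_word[OF as(1), of "dim E'"] gen inv as E' by auto
qed

lemma star_word_dependent:
  assumes "distinct (c # bs)" "set (c # bs) \<subseteq> \<Delta>" "b \<in> set bs" "cartan_number c b \<noteq> 0"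
  shows "\<not> independent (inversion_set P (refl_word (c # bs @ [c])))"
  using independent_inversions_iff[OF star_word_reduced[OF assms]] by simp

text \<open>The inversions lie in the span of the simple roots, so at most two of them can be
  independent.\<close>

lemma rank_two_dependent:
  assumes "card \<Delta> \<le> 2" "w \<in> weyl_group \<Phi>" "len w \<ge> 3"
  shows "\<not> independent (inversion_set P w)"
proof
  assume "independent (inversion_set P w)"
  then have "card (inversion_set P w) \<le> card \<Delta>"
    using pos_in_span finite_simple by (intro independent_span_bound[THEN conjunct2])
      (auto simp: inversion_set_def)
  then show False
    using assms by (simp add: card_inversion_set)
qed

end

section \<open>The root systems of the patterns\<close>

text \<open>The height functional \<open>h\<close> witnesses positivity and makes the elements of \<open>bs\<close> indecomposable.\<close>

lemma root_base_all_rootsI: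
  fixes Q :: "'b::euclidean_space set"
  assumes fin: "finite Q" and sub: "set bs \<subseteq> Q"
    and closed: "\<forall>\<alpha>\<in>Q. \<forall>\<beta>\<in>Q. cartan_number \<beta> \<alpha> \<in> \<int> \<and> reflection \<alpha> \<beta> \<in> all_roots Q"
    and double: "\<forall>\<alpha>\<in>Q. 2 *\<^sub>R \<alpha> \<notin> Q"
    and height: "\<forall>\<alpha>\<in>Q. h \<bullet> \<alpha> \<ge> 1" "\<forall>b\<in>set bs. h \<bullet> b = 1"
    and decomp: "\<forall>\<alpha>\<in>Q. \<alpha> \<in> set bs \<or> (\<exists>b\<in>set bs. \<alpha> - b \<in> Q)"
  shows "root_base (all_roots Q) Q" and "simple_roots Q = set bs"
proof -
  let ?R = "all_roots Q"
  have pm: "\<alpha> \<in> ?R \<longleftrightarrow> \<alpha> \<in> Q \<or> - \<alpha> \<in> Q" for \<alpha>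
    by (force simp: all_roots_def)
  have nz: "\<alpha> \<noteq> 0" if "\<alpha> \<in> ?R" for \<alpha>
  proof
    assume "\<alpha> = 0"
    then have "0 \<in> Q"
      using that by (simp add: pm)
    then show False
      using height(1) by force
  qed
  have cint: "cartan_number \<beta> \<alpha> \<in> \<int>" if "\<alpha> \<in> ?R" "\<beta> \<in> ?R" for \<alpha> \<beta>
  proof -
    have "cartan_number (- \<beta>) \<alpha> = - cartan_number \<beta> \<alpha>" "cartan_number \<beta> (- \<alpha>) = - cartan_number \<beta> \<alpha>"
      "cartan_number (- \<beta>) (- \<alpha>) = cartan_number \<beta> \<alpha>"
      by (simp_all add: cartan_number_def)
    then show ?thesis
      using that closed unfolding pm by (metis minus_in_Ints_iff)
  qed
  have refl: "reflection \<alpha> \<beta> \<in> ?R" if "\<alpha> \<in> ?R" "\<beta> \<in> ?R" for \<alpha> \<beta>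
  proof -
    have "reflection \<alpha> (- \<beta>) = - reflection \<alpha> \<beta>"
      by (rule linear_neg[OF linear_reflection])
    moreover have "reflection (- \<alpha>) = reflection \<alpha>"
      by (rule reflection_uminus)
    ultimately show ?thesis
      using that closed unfolding pm by (metis minus_minus)
  qed
  have mult: "c *\<^sub>R \<alpha> \<in> ?R \<longleftrightarrow> c = 1 \<or> c = - 1" if \<alpha>: "\<alpha> \<in> ?R" for \<alpha> c
  proof
    assume c: "c *\<^sub>R \<alpha> \<in> ?R"
    have \<alpha>\<alpha>: "\<alpha> \<bullet> \<alpha> \<noteq> 0" and "c \<noteq> 0"
      using nz[OF \<alpha>] nz[OF c] by auto
    have not2': "2 *\<^sub>R \<beta> \<notin> ?R" if "\<beta> \<in> Q" for \<beta>
    proof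
      assume "2 *\<^sub>R \<beta> \<in> ?R"
      then have "- (2 *\<^sub>R \<beta>) \<in> Q"
        using double that by (simp add: pm)
      then have "h \<bullet> (- (2 *\<^sub>R \<beta>)) \<ge> 1"
        using height(1) by blast
      moreover have "h \<bullet> \<beta> \<ge> 1"
        using height(1) that by blast
      ultimately show False by simp
    qed
    have not2: "2 *\<^sub>R \<beta> \<notin> ?R" if "\<beta> \<in> ?R" for \<beta>
      using that not2'[of \<beta>] not2'[of "- \<beta>"] by (auto simp: pm)
    \<comment> \<open>\<open>2 * c\<close> and \<open>2 / c\<close> are both Cartan numbers, hence
      integers with product 4. The remaining values other than 1 and -1 would make one root twice
      another or twice its negative.\<close>
    obtain m :: int where m: "2 * c = m"
      using cint[OF \<alpha> c] \<alpha>\<alpha> by (auto simp: cartan_number_def elim!: Ints_cases)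
    obtain k :: int where k: "2 / c = k"
      using cint[OF c \<alpha>] \<alpha>\<alpha> \<open>c \<noteq> 0\<close>
      by (auto simp: cartan_number_def power2_eq_square field_simps elim!: Ints_cases)
    have "real_of_int (m * k) = 4"
      using \<open>c \<noteq> 0\<close> by (simp flip: m k)
    then have mk: "m * k = 4"
      by linarith
    then have "m dvd 4"
      by (metis dvd_triv_left)
    then have "\<bar>m\<bar> \<le> 4"
      using dvd_imp_le_int[of 4 m] by simp
    then have "m \<in> {-4,-3,-2,-1,0,1,2,3,4}"
      by auto
    then have "m \<in> {-4,-2,-1,1,2,4}"
      using mk by auto presburger+
    then consider "c = 2" | "c = - 2" | "c = 1 / 2" | "c = - 1 / 2" | "c = 1" | "c = - 1"
      using m by force
    then show "c = 1 \<or> c = - 1"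
    proof cases
      case 1
      then show ?thesis using not2[OF \<alpha>] c by simp
    next
      case 2
      then show ?thesis using not2[OF \<alpha>] c by (auto simp: pm)
    next
      case 3
      have "2 *\<^sub>R (c *\<^sub>R \<alpha>) = \<alpha>" unfolding 3 by simp
      then show ?thesis using not2[OF c] \<alpha> by simp
    next
      case 4
      have "2 *\<^sub>R (c *\<^sub>R \<alpha>) = - \<alpha>" unfolding 4 by simp
      then show ?thesis using not2[OF c] \<alpha> by (simp add: pm)
    qed auto
  qed (use \<alpha> in \<open>auto simp: pm\<close>)
  show base: "root_base ?R Q"
  proof
    have "reflection \<alpha> ` ?R = ?R" if "\<alpha> \<in> ?R" for \<alpha>
    proof
      show "reflection \<alpha> ` ?R \<subseteq> ?R"
        using refl that by blast
      show "?R \<subseteq> reflection \<alpha> ` ?R"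
        using refl[OF that] by (metis imageI reflection_reflection subsetI)
    qed
    moreover have "finite ?R"
      using fin by (simp add: all_roots_def)
    ultimately show "root_system ?R"
      unfolding root_system_def using nz mult cint by blast
    have hpos: "h \<bullet> \<alpha> > 0" if "\<alpha> \<in> Q" for \<alpha>
      using height(1) that by force
    have "h \<bullet> \<alpha> \<noteq> 0 \<and> (\<alpha> \<in> Q \<longleftrightarrow> h \<bullet> \<alpha> > 0)" if "\<alpha> \<in> ?R" for \<alpha>
      using that hpos[of \<alpha>] hpos[of "- \<alpha>"] unfolding pm by fastforce
    then show "positive_roots ?R Q"
      unfolding positive_roots_def by (intro exI[of _ h]) (auto simp: pm)
  qed
  show "simple_roots Q = set bs"
  proof
    show "simple_roots Q \<subseteq> set bs"
    proof
      fix \<alpha> assume \<alpha>: "\<alpha> \<in> simple_roots Q"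
      show "\<alpha> \<in> set bs"
      proof (rule ccontr)
        assume "\<alpha> \<notin> set bs"
        then obtain b where "b \<in> set bs" "\<alpha> - b \<in> Q"
          using decomp \<alpha> by (auto simp: simple_roots_def)
        then have "\<exists>\<beta>\<in>Q. \<exists>\<gamma>\<in>Q. \<alpha> = \<beta> + \<gamma>"
          using sub by (intro bexI[of _ "\<alpha> - b"] bexI[of _ b]) auto
        then show False
          using \<alpha> by (simp add: simple_roots_def)
      qed
    qed
    show "set bs \<subseteq> simple_roots Q"
    proof
      fix b assume b: "b \<in> set bs"
      have "b \<noteq> \<beta> + \<gamma>" if "\<beta> \<in> Q" "\<gamma> \<in> Q" for \<beta> \<gamma>
      proof
        assume "b = \<beta> + \<gamma>"
        then have "h \<bullet> \<beta> + h \<bullet> \<gamma> = 1"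
          using height(2) b by (auto simp: inner_add_right)
        moreover have "h \<bullet> \<beta> \<ge> 1" "h \<bullet> \<gamma> \<ge> 1"
          using height(1) that by auto
        ultimately show False by simp
      qed
      then show "b \<in> simple_roots Q"
        using b sub unfolding simple_roots_def by blast
    qed
  qed
qed

section \<open>Coordinates of the pattern root systems\<close>

lemma vec_eq_2: "(x::real^2) = y \<longleftrightarrow> x $ 1 = y $ 1 \<and> x $ 2 = y $ 2"
  by (simp add: vec_eq_iff forall_2)

lemma vec_eq_3: "(x::real^3) = y \<longleftrightarrow> x $ 1 = y $ 1 \<and> x $ 2 = y $ 2 \<and> x $ 3 = y $ 3"
  by (simp add: vec_eq_iff forall_3)

lemma vec_eq_4:
  "(x::real^4) = y \<longleftrightarrow> x $ 1 = y $ 1 \<and> x $ 2 = y $ 2 \<and> x $ 3 = y $ 3 \<and> x $ 4 = y $ 4"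
  by (simp add: vec_eq_iff forall_4)

lemma vector_4 [simp]:
  "(vector [x, y, z, w] :: ('a::zero)^4) $ 1 = x"
  "(vector [x, y, z, w] :: ('a::zero)^4) $ 2 = y"
  "(vector [x, y, z, w] :: ('a::zero)^4) $ 3 = z"
  "(vector [x, y, z, w] :: ('a::zero)^4) $ 4 = w"
  unfolding vector_def by simp_all

lemma std_e_2:
  "(std_e (Suc 0) :: real^2) = vector [1, 0]" "(std_e (Suc (Suc 0)) :: real^2) = vector [0, 1]"
  by (simp_all add: vec_eq_2 std_e_def axis_def)

lemma std_e_3:
  "(std_e (Suc 0) :: real^3) = vector [1, 0, 0]" "(std_e (Suc (Suc 0)) :: real^3) = vector [0, 1, 0]"
  "(std_e (Suc (Suc (Suc 0))) :: real^3) = vector [0, 0, 1]"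
  by (simp_all add: vec_eq_3 std_e_def axis_def)

lemma std_e_4:
  "(std_e (Suc 0) :: real^4) = vector [1, 0, 0, 0]"
  "(std_e (Suc (Suc 0)) :: real^4) = vector [0, 1, 0, 0]"
  "(std_e (Suc (Suc (Suc 0))) :: real^4) = vector [0, 0, 1, 0]"
  "(std_e (Suc (Suc (Suc (Suc 0)))) :: real^4) = vector [0, 0, 0, 1]"
  by (simp_all add: vec_eq_4 std_e_def axis_def)

text \<open>Lists the index pairs explicitly, so that sets of positive roots can be expanded root by
  root.\<close>

lemma index_pairs:
  "{f i j |i j. 1 \<le> i \<and> i < j \<and> j \<le> n}
    = (\<lambda>(i, j). f i j) ` set (concat (map (\<lambda>j. map (\<lambda>i. (i, j)) [1..<j]) [1..<Suc n]))"
  by (force simp: image_iff)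

lemma index_single: "{f i |i. 1 \<le> i \<and> i \<le> n} = f ` set [1..<Suc n]"
  by (auto simp: image_iff)

lemma vector_diff:
  "(vector [a, b] :: real^2) - vector [a', b'] = vector [a - a', b - b']"
  "(vector [a, b, c] :: real^3) - vector [a', b', c'] = vector [a - a', b - b', c - c']"
  "(vector [a, b, c, d] :: real^4) - vector [a', b', c', d'] = vector [a - a', b - b', c - c', d - d']"
  by (simp_all add: vec_eq_2 vec_eq_3 vec_eq_4)

lemma vector_add:
  "(vector [a, b] :: real^2) + vector [a', b'] = vector [a + a', b + b']"
  "(vector [a, b, c] :: real^3) + vector [a', b', c'] = vector [a + a', b + b', c + c']"
  "(vector [a, b, c, d] :: real^4) + vector [a', b', c', d'] = vector [a + a', b + b', c + c', d + d']"
  by (simp_all add: vec_eq_2 vec_eq_3 vec_eq_4)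

lemma vector_uminus:
  "- (vector [a, b] :: real^2) = vector [- a, - b]"
  "- (vector [a, b, c] :: real^3) = vector [- a, - b, - c]"
  "- (vector [a, b, c, d] :: real^4) = vector [- a, - b, - c, - d]"
  by (simp_all add: vec_eq_2 vec_eq_3 vec_eq_4)

lemma vector_scaleR:
  "r *\<^sub>R (vector [a, b] :: real^2) = vector [r * a, r * b]"
  "r *\<^sub>R (vector [a, b, c] :: real^3) = vector [r * a, r * b, r * c]"
  "r *\<^sub>R (vector [a, b, c, d] :: real^4) = vector [r * a, r * b, r * c, r * d]"
  by (simp_all add: vec_eq_2 vec_eq_3 vec_eq_4)

lemma vector_inner:
  "(vector [a, b] :: real^2) \<bullet> vector [a', b'] = a * a' + b * b'"
  "(vector [a, b, c] :: real^3) \<bullet> vector [a', b', c'] = a * a' + b * b' + c * c'"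
  "(vector [a, b, c, d] :: real^4) \<bullet> vector [a', b', c', d'] = a * a' + b * b' + c * c' + d * d'"
  by (simp_all add: inner_vec_def sum_2 sum_3 sum_4)

lemma cartan_number_vector:
  "cartan_number (vector [a, b] :: real^2) (vector [a', b'])
    = 2 * (a * a' + b * b') / (a' * a' + b' * b')"
  "cartan_number (vector [a, b, c] :: real^3) (vector [a', b', c'])
    = 2 * (a * a' + b * b' + c * c') / (a' * a' + b' * b' + c' * c')"
  "cartan_number (vector [a, b, c, d] :: real^4) (vector [a', b', c', d'])
    = 2 * (a * a' + b * b' + c * c' + d * d') / (a' * a' + b' * b' + c' * c' + d' * d')"
  by (simp_all add: cartan_number_def vector_inner)

lemma vector_eq:
  "(vector [a, b] :: real^2) = vector [a', b'] \<longleftrightarrow> a = a' \<and> b = b'"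
  "(vector [a, b, c] :: real^3) = vector [a', b', c'] \<longleftrightarrow> a = a' \<and> b = b' \<and> c = c'"
  "(vector [a, b, c, d] :: real^4) = vector [a', b', c', d']
    \<longleftrightarrow> a = a' \<and> b = b' \<and> c = c' \<and> d = d'"
  by (simp_all add: vec_eq_2 vec_eq_3 vec_eq_4)

lemmas vector_simps = vector_diff vector_add vector_uminus vector_scaleR vector_inner vector_eq
  cartan_number_def reflection_def

lemma pos_A_2:
  "(pos_A 2 :: (real^3) set) = {vector [1, -1, 0], vector [1, 0, -1], vector [0, 1, -1]}"
  unfolding pos_A_def index_pairs by (simp add: upt_rec std_e_3 vector_simps)

lemma pos_A_3:
  "(pos_A 3 :: (real^4) set) =
    {vector [1, -1, 0, 0], vector [1, 0, -1, 0], vector [1, 0, 0, -1],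
     vector [0, 1, -1, 0], vector [0, 1, 0, -1], vector [0, 0, 1, -1]}"
  unfolding pos_A_def index_pairs by (simp add: upt_rec std_e_4 vector_simps) auto

lemma pos_B_2:
  "(pos_B 2 :: (real^2) set) = {vector [1, -1], vector [1, 1], vector [1, 0], vector [0, 1]}"
  unfolding pos_B_def pos_D_def index_pairs index_single
  by (simp add: upt_rec std_e_2 vector_simps) auto

lemma pos_D_3:
  "(pos_D 3 :: (real^3) set) =
    {vector [1, -1, 0], vector [1, 0, -1], vector [0, 1, -1],
     vector [1, 1, 0], vector [1, 0, 1], vector [0, 1, 1]}"
  unfolding pos_D_def index_pairs by (simp add: upt_rec std_e_3 vector_simps) auto

lemma pos_B_3:
  "(pos_B 3 :: (real^3) set) =
    {vector [1, -1, 0], vector [1, 0, -1], vector [0, 1, -1],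
     vector [1, 1, 0], vector [1, 0, 1], vector [0, 1, 1],
     vector [1, 0, 0], vector [0, 1, 0], vector [0, 0, 1]}"
  unfolding pos_B_def pos_D_3 index_single by (simp add: upt_rec std_e_3 vector_simps) auto

lemma pos_C_3:
  "(pos_C 3 :: (real^3) set) =
    {vector [1, -1, 0], vector [1, 0, -1], vector [0, 1, -1],
     vector [1, 1, 0], vector [1, 0, 1], vector [0, 1, 1],
     vector [2, 0, 0], vector [0, 2, 0], vector [0, 0, 2]}"
  unfolding pos_C_def pos_D_3 index_single by (simp add: upt_rec std_e_3 vector_simps) auto

lemma pos_D_4:
  "(pos_D 4 :: (real^4) set) =
    {vector [1, -1, 0, 0], vector [1, 0, -1, 0], vector [1, 0, 0, -1],
     vector [0, 1, -1, 0], vector [0, 1, 0, -1], vector [0, 0, 1, -1],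
     vector [1, 1, 0, 0], vector [1, 0, 1, 0], vector [1, 0, 0, 1],
     vector [0, 1, 1, 0], vector [0, 1, 0, 1], vector [0, 0, 1, 1]}"
  unfolding pos_D_def index_pairs by (simp add: upt_rec std_e_4 vector_simps) auto

lemma pos_G2:
  "pos_G2 = {vector [1, -1, 0], vector [-2, 1, 1], vector [-1, 0, 1],
     vector [0, -1, 1], vector [1, -2, 1], vector [-1, -1, 2]}"
  unfolding pos_G2_def Let_def by (simp add: numeral_eq_Suc std_e_3 vector_simps)

lemma root_base_A_2:
  "root_base (all_roots (pos_A 2)) (pos_A 2 :: (real^3) set)"
  "simple_roots (pos_A 2 :: (real^3) set) = set [vector [1, -1, 0], vector [0, 1, -1]]"
  unfolding pos_A_2
  \<comment> \<open>Here and below \<open>h\<close> solves the equations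
    \<open>h \<bullet> b = 1\<close> for the simple roots \<open>b\<close>, so that it measures the
    height of a root.\<close>
  by (rule root_base_all_rootsI[where h = "vector [2, 1, 0]"
      and bs = "[vector [1, -1, 0], vector [0, 1, -1]]"]; simp add: vector_simps all_roots_def)+

lemma root_base_A_3:
  "root_base (all_roots (pos_A 3)) (pos_A 3 :: (real^4) set)"
  "simple_roots (pos_A 3 :: (real^4) set) =
    set [vector [1, -1, 0, 0], vector [0, 1, -1, 0], vector [0, 0, 1, -1]]"
  unfolding pos_A_3
  by (rule root_base_all_rootsI[where h = "vector [3, 2, 1, 0]"
      and bs = "[vector [1, -1, 0, 0], vector [0, 1, -1, 0], vector [0, 0, 1, -1]]"];
      simp add: vector_simps all_roots_def)+

lemma root_base_B_2:
  "root_base (all_roots (pos_B 2)) (pos_B 2 :: (real^2) set)"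
  "simple_roots (pos_B 2 :: (real^2) set) = set [vector [1, -1], vector [0, 1]]"
  unfolding pos_B_2
  by (rule root_base_all_rootsI[where h = "vector [2, 1]"
      and bs = "[vector [1, -1], vector [0, 1]]"]; simp add: vector_simps all_roots_def)+

lemma root_base_B_3:
  "root_base (all_roots (pos_B 3)) (pos_B 3 :: (real^3) set)"
  "simple_roots (pos_B 3 :: (real^3) set) =
    set [vector [1, -1, 0], vector [0, 1, -1], vector [0, 0, 1]]"
  unfolding pos_B_3
  by (rule root_base_all_rootsI[where h = "vector [3, 2, 1]"
      and bs = "[vector [1, -1, 0], vector [0, 1, -1], vector [0, 0, 1]]"];
      simp add: vector_simps all_roots_def)+

lemma root_base_C_3:
  "root_base (all_roots (pos_C 3)) (pos_C 3 :: (real^3) set)"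
  "simple_roots (pos_C 3 :: (real^3) set) =
    set [vector [1, -1, 0], vector [0, 1, -1], vector [0, 0, 2]]"
  unfolding pos_C_3
  \<comment> \<open>The halves arise because the long simple root \<open>2 e_3\<close> must have
    height 1.\<close>
  by (rule root_base_all_rootsI[where h = "vector [5 / 2, 3 / 2, 1 / 2]"
      and bs = "[vector [1, -1, 0], vector [0, 1, -1], vector [0, 0, 2]]"];
      simp add: vector_simps all_roots_def)+

lemma root_base_D_4:
  "root_base (all_roots (pos_D 4)) (pos_D 4 :: (real^4) set)"
  "simple_roots (pos_D 4 :: (real^4) set) = set [vector [1, -1, 0, 0], vector [0, 1, -1, 0],
    vector [0, 0, 1, -1], vector [0, 0, 1, 1]]"
  unfolding pos_D_4
  by (rule root_base_all_rootsI[where h = "vector [3, 2, 1, 0]"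
      and bs = "[vector [1, -1, 0, 0], vector [0, 1, -1, 0], vector [0, 0, 1, -1],
        vector [0, 0, 1, 1]]"]; simp add: vector_simps all_roots_def)+

lemma root_base_G2:
  "root_base (all_roots pos_G2) pos_G2"
  "simple_roots pos_G2 = set [vector [1, -1, 0], vector [-2, 1, 1]]"
  unfolding pos_G2
  \<comment> \<open>This \<open>h\<close> lies outside the plane of the roots; multiples of
    \<open>(1, 1, 1)\<close> do not affect heights.\<close>
  by (rule root_base_all_rootsI[where h = "vector [0, -1, 2]"
      and bs = "[vector [1, -1, 0], vector [-2, 1, 1]]"]; simp add: vector_simps all_roots_def)+

lemma simple_A_2:
  "(simple_A (Suc 0) :: real^3) = vector [1, -1, 0]" "(simple_A 2 :: real^3) = vector [0, 1, -1]"
  by (simp_all add: simple_A_def numeral_eq_Suc std_e_3 vector_simps)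

lemma simple_A_3:
  "(simple_A (Suc 0) :: real^4) = vector [1, -1, 0, 0]"
  "(simple_A 2 :: real^4) = vector [0, 1, -1, 0]" "(simple_A 3 :: real^4) = vector [0, 0, 1, -1]"
  by (simp_all add: simple_A_def numeral_eq_Suc std_e_4 vector_simps)

lemma simple_B_3:
  "(simple_B 3 (Suc 0) :: real^3) = vector [1, -1, 0]"
  "(simple_B 3 2 :: real^3) = vector [0, 1, -1]" "(simple_B 3 3 :: real^3) = vector [0, 0, 1]"
  by (simp_all add: simple_B_def numeral_eq_Suc std_e_3 vector_simps)

lemma simple_C_3:
  "(simple_C 3 (Suc 0) :: real^3) = vector [1, -1, 0]"
  "(simple_C 3 2 :: real^3) = vector [0, 1, -1]" "(simple_C 3 3 :: real^3) = vector [0, 0, 2]"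
  by (simp_all add: simple_C_def numeral_eq_Suc std_e_3 vector_simps)

lemma simple_D_4:
  "(simple_D 4 (Suc 0) :: real^4) = vector [1, -1, 0, 0]"
  "(simple_D 4 2 :: real^4) = vector [0, 1, -1, 0]"
  "(simple_D 4 3 :: real^4) = vector [0, 0, 1, -1]" "(simple_D 4 4 :: real^4) = vector [0, 0, 1, 1]"
  by (simp_all add: simple_D_def numeral_eq_Suc std_e_4 vector_simps)

section \<open>The characterization\<close>

text \<open>The edges of a Dynkin diagram: one single bond, and double and triple bonds in both
  orientations.\<close>

lemma cartan_pair_cases:
  fixes x y :: real
  assumes "x \<in> \<int>" "y \<in> \<int>" "x \<le> - 1" "y \<le> - 1" "x * y < 4"
  shows "x = - 1 \<and> y = - 1 \<or> x = - 2 \<and> y = - 1 \<or> x = - 1 \<and> y = - 2 \<or>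
    x = - 3 \<and> y = - 1 \<or> x = - 1 \<and> y = - 3"
proof -
  obtain m k :: int where mk: "x = m" "y = k"
    using assms(1,2) by (auto elim!: Ints_cases)
  have "m \<le> - 1" "k \<le> - 1"
    using assms(3,4) mk by simp_all
  moreover have "m * k < 4"
    using assms(5) mk by (simp flip: of_int_mult)
  moreover have "m > - 4"
  proof (rule ccontr)
    assume "\<not> m > - 4"
    then show False
      using mult_mono[of 4 "- m" 1 "- k"] calculation by simp
  qed
  moreover have "k > - 4"
  proof (rule ccontr)
    assume "\<not> k > - 4"
    then show False
      using mult_mono[of 1 "- m" 4 "- k"] calculation by simp
  qed
  ultimately have "m \<in> {-3, -2, -1}" "k \<in> {-3, -2, -1}" "m * k < 4"
    by auto
  then show ?thesis
    using mk by auto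
qed

context root_base
begin

text \<open>Outside B2 and G2 every pattern repeats its centre at both ends of a word, which makes
  its inversions dependent.\<close>

lemma boolean_avoids_star:
  fixes Q :: "'b::euclidean_space set"
  assumes w: "w \<in> weyl_group \<Phi>" "independent (inversion_set P w)"
    and Q: "root_base (all_roots Q) Q"
    and cbs: "distinct (c # bs)" "set (c # bs) \<subseteq> simple_roots Q" "b \<in> set bs" "cartan_number c b \<noteq> 0"
  shows "avoids_BP \<Phi> P w Q (refl_word (c # bs @ [c]))"
proof
  interpret T: root_base "all_roots Q" Q by (rule Q)
  assume "contains_BP \<Phi> P w Q (refl_word (c # bs @ [c]))"
  moreover have "refl_word (c # bs @ [c]) \<in> weyl_group (all_roots Q)"
    using cbs(2) by (intro T.simple_word_weyl) auto
  ultimately have "independent (inversion_set Q (refl_word (c # bs @ [c])))"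
    using contains_BP_independent[OF w Q] by blast
  then show False
    using T.star_word_dependent[OF cbs] by blast
qed

lemma boolean_avoids_rank_two:
  fixes Q :: "'b::euclidean_space set"
  assumes w: "w \<in> weyl_group \<Phi>" "independent (inversion_set P w)"
    and Q: "root_base (all_roots Q) Q" "card (simple_roots Q) \<le> 2"
    and \<pi>: "\<pi> \<in> weyl_group (all_roots Q)" "coxeter_length Q \<pi> \<ge> 3"
  shows "avoids_BP \<Phi> P w Q \<pi>"
  using contains_BP_independent[OF w Q(1) \<pi>(1)] root_base.rank_two_dependent[OF Q \<pi>] by blast

text \<open>The star has at most three leaves, since each edge contributes at least 1 to a sum below
  4. One leaf gives A2, B2 or G2; two give A3, B3 or C3; three give D4.\<close>

lemma dependent_contains_pattern:
  assumes w: "w \<in> weyl_group \<Phi>" and dep: "\<not> independent (inversion_set P w)"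
  shows "contains_BP \<Phi> P w (pos_A 2 :: (real ^ 3) set) (refl_word (map simple_A [1, 2, 1])) \<or>
      contains_BP \<Phi> P w (pos_A 3 :: (real ^ 4) set) (refl_word (map simple_A [2, 1, 3, 2])) \<or>
      (\<exists>\<pi> \<in> weyl_group (all_roots (pos_B 2 :: (real ^ 2) set)).
         coxeter_length (pos_B 2) \<pi> \<ge> 3 \<and> contains_BP \<Phi> P w (pos_B 2) \<pi>) \<or>
      contains_BP \<Phi> P w (pos_B 3 :: (real ^ 3) set) (refl_word (map (simple_B 3) [2, 1, 3, 2])) \<or>
      contains_BP \<Phi> P w (pos_C 3 :: (real ^ 3) set) (refl_word (map (simple_C 3) [2, 1, 3, 2])) \<or>
      contains_BP \<Phi> P w (pos_D 4 :: (real ^ 4) set) (refl_word (map (simple_D 4) [2, 1, 3, 4, 2])) \<or>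
      (\<exists>\<pi> \<in> weyl_group (all_roots pos_G2).
         coxeter_length pos_G2 \<pi> \<ge> 3 \<and> contains_BP \<Phi> P w pos_G2 \<pi>)"
    (is "?A2 \<or> ?A3 \<or> ?B2 \<or> ?B3 \<or> ?C3 \<or> ?D4 \<or> ?G2")
proof -
  obtain E' pre c bs where E': "subspace E'"
    and w': "weyl_restrict \<Phi> P w E' = refl_word (pre @ c # bs @ [c])"
    and red: "root_base.reduced_word (P \<inter> E') (pre @ c # bs @ [c])"
    and dist: "distinct (c # bs)" and simple: "set (c # bs) = simple_roots (P \<inter> E')" and "bs \<noteq> []"
    and adj: "\<forall>b\<in>set bs. cartan_number c b \<noteq> 0"
    and orth: "\<forall>b\<in>set bs. \<forall>b'\<in>set bs. b \<noteq> b' \<longrightarrow> cartan_number b b' = 0"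
    and pre: "length bs \<ge> 2 \<longrightarrow> pre = []"
    using star_pattern[OF assms] by metis
  interpret E: root_base "\<Phi> \<inter> E'" "P \<inter> E'"
    using root_base_Int[OF E'] .
  have le: "cartan_number c b \<le> - 1" "cartan_number b c \<le> - 1"
    and int: "cartan_number c b \<in> \<int>" "cartan_number b c \<in> \<int>" if "b \<in> set bs" for b
  proof -
    have "c \<in> E.\<Delta>" "b \<in> E.\<Delta>" "c \<noteq> b" "cartan_number c b \<noteq> 0"
      using that dist simple adj by auto
    then show "cartan_number c b \<le> - 1" "cartan_number b c \<le> - 1"
      "cartan_number c b \<in> \<int>" "cartan_number b c \<in> \<int>"
      using E.cartan_simple_less E.cartan_symmetric_zero E.cartan_int E.simple_root by metis+
  qed
  have ge: "1 \<le> cartan_number c b * cartan_number b c" if "b \<in> set bs" for b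
    using le[OF that] mult_mono[of 1 "- cartan_number c b" 1 "- cartan_number b c"] by simp
  have self: "cartan_number b b = 2" if "b \<in> set (c # bs)" for b
    using that simple E.simple_root E.zero_not_root by (metis cartan_number_self)
  have sum: "(\<Sum>b\<leftarrow>bs. cartan_number c b * cartan_number b c) < 4"
    using E.star_cartan_sum[OF equalityD1[OF simple] dist orth] .
  note contains = contains_BP_of_cartan_matrix(1)[OF E' _ _ _ _ _ _ _ _ _ w]
  note contains_any = contains_BP_of_cartan_matrix_any[OF E' _ _ _ _ _ _ _ w]
  have pair: "cartan_number c b = - 1 \<and> cartan_number b c = - 1 \<or>
      cartan_number c b = - 2 \<and> cartan_number b c = - 1 \<or>
      cartan_number c b = - 1 \<and> cartan_number b c = - 2 \<or>
      cartan_number c b = - 3 \<and> cartan_number b c = - 1 \<or>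
      cartan_number c b = - 1 \<and> cartan_number b c = - 3"
    if "b \<in> set bs" "cartan_number c b * cartan_number b c < 4" for b
    using cartan_pair_cases[OF int[OF that(1)] le[OF that(1)] that(2)] .
  consider b where "bs = [b]" | b1 b2 where "bs = [b1, b2]" | b1 b2 b3 where "bs = [b1, b2, b3]"
    | b1 b2 b3 b4 bs' where "bs = b1 # b2 # b3 # b4 # bs'"
    using \<open>bs \<noteq> []\<close> by (metis list.exhaust)
  then show ?thesis
  proof cases
    case (1 b)
    have simple': "set [c, b] = simple_roots (P \<inter> E')" "set [b, c] = simple_roots (P \<inter> E')"
      "distinct [c, b]" "distinct [b, c]" and b: "b \<in> set bs"
      using simple dist 1 by auto
    have self': "cartan_number b b = 2" "cartan_number c c = 2"
      using self b by auto
    have "card (inversion_set P w \<inter> E') = length (pre @ c # bs @ [c])"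
      using E.reduced_inversions[OF red] distinct_card[of "inv_roots (pre @ c # bs @ [c])"]
        weyl_restrict(2)[OF E' w] w' by simp
    then have card: "card (inversion_set P w \<inter> E') \<ge> 3"
      using 1 by simp
    from pair[OF b] sum 1 consider
      "cartan_number c b = - 1" "cartan_number b c = - 1"
      | "cartan_number c b = - 2" "cartan_number b c = - 1"
      | "cartan_number c b = - 1" "cartan_number b c = - 2"
      | "cartan_number c b = - 3" "cartan_number b c = - 1"
      | "cartan_number c b = - 1" "cartan_number b c = - 3"
      by auto
    then show ?thesis
    proof cases
      case c: 1
      \<comment> \<open>With a single bond, \<open>s_c s_b s_c\<close> sends both simple roots to
        negative roots, so no letter can precede it.\<close>
      have "pre = []"
      proof (rule ccontr)
        assume "pre \<noteq> []"
        then obtain pre' d where pre': "pre = pre' @ [d]"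
          by (cases pre rule: rev_cases) auto
        then have red': "E.reduced_word [d, c, b, c]"
          using red E.reduced_appendD(2)[of pre' "[d, c, b, c]"] 1 by simp
        then have "d = c \<or> d = b" and d: "refl_word [c, b, c] d \<in> P"
          using simple 1 by (auto simp: E.reduced_Cons)
        moreover have "refl_word [c, b, c] b = - c" "refl_word [c, b, c] c = - b"
          using c self' 1 by (simp_all add: refl_word_Cons reflection_def cartan_number_add
              cartan_number_diff cartan_number_uminus_left)
        moreover have "- c \<notin> P" "- b \<notin> P"
          using simple' E.simple_pos neg_not_pos by (metis IntD1 list.set_intros)+
        ultimately show False
          by auto
      qed
      have ?A2
        using contains[of "pos_A 2 :: (real^3) set" "[c, b]" "[vector [1, -1, 0], vector [0, 1, -1]]" "[0, 1, 0]"]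
          root_base_A_2 simple' w' 1 \<open>pre = []\<close> c self'
        by (simp add: simple_A_2 vector_eq cartan_number_vector)
      then show ?thesis by blast
    next
      case c: 2
      \<comment> \<open>Here \<open>c\<close> is the longer root, and the list for B2 starts with
        the long one.\<close>
      have ?B2
        using contains_any[of "pos_B 2 :: (real^2) set" "[c, b]" "[vector [1, -1], vector [0, 1]]"]
          root_base_B_2 simple' 1 c self' card by (force simp: vector_eq cartan_number_vector)
      then show ?thesis by blast
    next
      case c: 3
      have ?B2
        using contains_any[of "pos_B 2 :: (real^2) set" "[b, c]" "[vector [1, -1], vector [0, 1]]"]
          root_base_B_2 simple' 1 c self' card by (force simp: vector_eq cartan_number_vector)
      then show ?thesis by blast
    next
      case c: 4
      \<comment> \<open>Again \<open>c\<close> is the longer root, but the list for G2 starts with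
        the short one.\<close>
      have ?G2
        using contains_any[of pos_G2 "[b, c]" "[vector [1, -1, 0], vector [-2, 1, 1]]"]
          root_base_G2 simple' 1 c self' card by (force simp: vector_eq cartan_number_vector)
      then show ?thesis by blast
    next
      case c: 5
      have ?G2
        using contains_any[of pos_G2 "[c, b]" "[vector [1, -1, 0], vector [-2, 1, 1]]"]
          root_base_G2 simple' 1 c self' card by (force simp: vector_eq cartan_number_vector)
      then show ?thesis by blast
    qed
  next
    case (2 b1 b2)
    \<comment> \<open>Two products of at least 1 with sum below 4 leave room for at most one double
      bond; \<open>b\<close> is a leaf with a single bond. If the other bond is double, a short
      \<open>b'\<close> gives B3 and a long one C3.\<close>
    have rank_three: "?A3 \<or> ?B3 \<or> ?C3"
      if b: "set [b, c, b'] = simple_roots (P \<inter> E')" "distinct [b, c, b']"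
        and word: "weyl_restrict \<Phi> P w E' = refl_word [c, b, b', c]"
        and cb: "cartan_number c b = - 1" "cartan_number b c = - 1"
        and cb': "cartan_number c b' = - 1 \<and> cartan_number b' c = - 1 \<or>
          cartan_number c b' = - 2 \<and> cartan_number b' c = - 1 \<or>
          cartan_number c b' = - 1 \<and> cartan_number b' c = - 2" for b b'
    proof -
      have "b \<in> set bs" "b' \<in> set bs" "b \<noteq> b'"
        using b simple dist 2 by auto
      then have bb': "cartan_number b b' = 0" "cartan_number b' b = 0" "cartan_number b b = 2"
        "cartan_number b' b' = 2" "cartan_number c c = 2"
        using orth self by auto
      from cb' consider
        "cartan_number c b' = - 1" "cartan_number b' c = - 1"
        | "cartan_number c b' = - 2" "cartan_number b' c = - 1"
        | "cartan_number c b' = - 1" "cartan_number b' c = - 2"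
        by blast
      then show ?thesis
      proof cases
        case 1
        \<comment> \<open>Positions count from zero, so \<open>[1, 0, 2, 1]\<close> encodes
          \<open>s_2 s_1 s_3 s_2\<close>.\<close>
        have ?A3
          using contains[of "pos_A 3 :: (real^4) set" "[b, c, b']"
              "[vector [1, -1, 0, 0], vector [0, 1, -1, 0], vector [0, 0, 1, -1]]" "[1, 0, 2, 1]"]
            root_base_A_3 b word cb bb' 1 by (simp add: simple_A_3 vector_eq cartan_number_vector)
        then show ?thesis by blast
      next
        case 2
        have ?B3
          using contains[of "pos_B 3 :: (real^3) set" "[b, c, b']"
              "[vector [1, -1, 0], vector [0, 1, -1], vector [0, 0, 1]]" "[1, 0, 2, 1]"]
            root_base_B_3 b word cb bb' 2 by (simp add: simple_B_3 vector_eq cartan_number_vector)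
        then show ?thesis by blast
      next
        case 3
        have ?C3
          using contains[of "pos_C 3 :: (real^3) set" "[b, c, b']"
              "[vector [1, -1, 0], vector [0, 1, -1], vector [0, 0, 2]]" "[1, 0, 2, 1]"]
            root_base_C_3 b word cb bb' 3 by (simp add: simple_C_3 vector_eq cartan_number_vector)
        then show ?thesis by blast
      qed
    qed
    have word: "weyl_restrict \<Phi> P w E' = refl_word [c, b1, b2, c]"
      using w' pre 2 by simp
    \<comment> \<open>Orthogonal leaves commute, so either of them may take the role of the leaf
      with the single bond.\<close>
    have "reflection b1 \<circ> reflection b2 = reflection b2 \<circ> reflection b1"
      using orth dist 2 by (intro reflection_commute) auto
    then have "reflection b1 (reflection b2 x) = reflection b2 (reflection b1 x)" for x
      by (metis comp_apply)
    then have word': "weyl_restrict \<Phi> P w E' = refl_word [c, b2, b1, c]"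
      unfolding word by (simp add: refl_word_Cons fun_eq_iff)
    have set: "set [b1, c, b2] = simple_roots (P \<inter> E')" "distinct [b1, c, b2]"
      "set [b2, c, b1] = simple_roots (P \<inter> E')" "distinct [b2, c, b1]"
      using simple dist 2 by auto
    have b: "b1 \<in> set bs" "b2 \<in> set bs"
      using 2 by auto
    have "cartan_number c b1 * cartan_number b1 c + cartan_number c b2 * cartan_number b2 c < 4"
      using sum 2 by simp
    then have "cartan_number c b1 = - 1 \<and> cartan_number b1 c = - 1 \<and>
        (cartan_number c b2 = - 1 \<and> cartan_number b2 c = - 1 \<or>
          cartan_number c b2 = - 2 \<and> cartan_number b2 c = - 1 \<or>
          cartan_number c b2 = - 1 \<and> cartan_number b2 c = - 2) \<or>
        cartan_number c b2 = - 1 \<and> cartan_number b2 c = - 1 \<and>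
        (cartan_number c b1 = - 1 \<and> cartan_number b1 c = - 1 \<or>
          cartan_number c b1 = - 2 \<and> cartan_number b1 c = - 1 \<or>
          cartan_number c b1 = - 1 \<and> cartan_number b1 c = - 2)"
      using pair[OF b(1)] pair[OF b(2)] ge[OF b(1)] ge[OF b(2)] by auto
    then show ?thesis
      using rank_three[OF set(1,2) word] rank_three[OF set(3,4) word'] by blast
  next
    case (3 b1 b2 b3)
    have b: "b1 \<in> set bs" "b2 \<in> set bs" "b3 \<in> set bs" "b1 \<noteq> b2" "b1 \<noteq> b3" "b2 \<noteq> b3"
      using 3 dist by auto
    have "cartan_number c b1 * cartan_number b1 c + cartan_number c b2 * cartan_number b2 c +
        cartan_number c b3 * cartan_number b3 c < 4"
      using sum 3 by simp
    \<comment> \<open>Three products of at least 1 with sum below 4 must all be 1.\<close>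
    then have cb: "cartan_number c b1 = - 1" "cartan_number b1 c = - 1" "cartan_number c b2 = - 1"
      "cartan_number b2 c = - 1" "cartan_number c b3 = - 1" "cartan_number b3 c = - 1"
      using pair[OF b(1)] pair[OF b(2)] pair[OF b(3)] ge[OF b(1)] ge[OF b(2)] ge[OF b(3)] by auto
    have bb: "cartan_number b1 b2 = 0" "cartan_number b1 b3 = 0" "cartan_number b2 b3 = 0"
      "cartan_number b2 b1 = 0" "cartan_number b3 b1 = 0" "cartan_number b3 b2 = 0"
      using b orth by auto
    have set: "set [b1, c, b2, b3] = simple_roots (P \<inter> E')" "distinct [b1, c, b2, b3]"
      using simple dist 3 by auto
    have self': "cartan_number c c = 2" "cartan_number b1 b1 = 2" "cartan_number b2 b2 = 2"
      "cartan_number b3 b3 = 2"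
      using self b by auto
    have "weyl_restrict \<Phi> P w E' = refl_word [c, b1, b2, b3, c]"
      using w' pre 3 by simp
    then have ?D4
      using contains[of "pos_D 4 :: (real^4) set" "[b1, c, b2, b3]" "[vector [1, -1, 0, 0],
            vector [0, 1, -1, 0], vector [0, 0, 1, -1], vector [0, 0, 1, 1]]" "[1, 0, 2, 3, 1]"]
        root_base_D_4 set cb bb self' by (simp add: simple_D_4 vector_eq cartan_number_vector)
    then show ?thesis by blast
  next
    case (4 b1 b2 b3 b4 bs')
    have "0 \<le> (\<Sum>b\<leftarrow>bs'. cartan_number c b * cartan_number b c)"
    proof (rule sum_list_nonneg)
      fix x assume "x \<in> set (map (\<lambda>b. cartan_number c b * cartan_number b c) bs')"
      then show "0 \<le> x"
        using ge 4 by force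
    qed
    then show ?thesis
      using sum ge[of b1] ge[of b2] ge[of b3] ge[of b4] 4 by simp
  qed
qed

end

theorem theorem1p2:
  fixes \<Phi> P :: "'a::euclidean_space set" and w :: "'a \<Rightarrow> 'a"
  assumes "root_system \<Phi>" and "positive_roots \<Phi> P" and "w \<in> weyl_group \<Phi>"
  shows "boolean_element \<Phi> P w \<longleftrightarrow>
      avoids_BP \<Phi> P w (pos_A 2 :: (real ^ 3) set) (refl_word (map simple_A [1, 2, 1])) \<and>
      avoids_BP \<Phi> P w (pos_A 3 :: (real ^ 4) set) (refl_word (map simple_A [2, 1, 3, 2])) \<and>
      (\<forall>\<pi> \<in> weyl_group (all_roots (pos_B 2 :: (real ^ 2) set)).
         coxeter_length (pos_B 2) \<pi> \<ge> 3 \<longrightarrow> avoids_BP \<Phi> P w (pos_B 2) \<pi>) \<and>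
      avoids_BP \<Phi> P w (pos_B 3 :: (real ^ 3) set) (refl_word (map (simple_B 3) [2, 1, 3, 2])) \<and>
      avoids_BP \<Phi> P w (pos_C 3 :: (real ^ 3) set) (refl_word (map (simple_C 3) [2, 1, 3, 2])) \<and>
      avoids_BP \<Phi> P w (pos_D 4 :: (real ^ 4) set) (refl_word (map (simple_D 4) [2, 1, 3, 4, 2])) \<and>
      (\<forall>\<pi> \<in> weyl_group (all_roots pos_G2).
         coxeter_length pos_G2 \<pi> \<ge> 3 \<longrightarrow> avoids_BP \<Phi> P w pos_G2 \<pi>)"
    (is "_ \<longleftrightarrow> ?avoids")
proof -
  interpret root_base \<Phi> P
    using assms by unfold_locales
  have "?avoids" if ind: "independent (inversion_set P w)"
  proof (intro conjI ballI impI)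
    note avoids = boolean_avoids_star[OF assms(3) ind]
    note avoids2 = boolean_avoids_rank_two[OF assms(3) ind]
    show "avoids_BP \<Phi> P w (pos_A 2 :: (real ^ 3) set) (refl_word (map simple_A [1, 2, 1]))"
      \<comment> \<open>The arguments in each case are the centre, the list of leaves, and one leaf
        witnessing adjacency.\<close>
      using avoids[of "pos_A 2 :: (real^3) set" "vector [1, -1, 0]" "[vector [0, 1, -1]]" "vector [0, 1, -1]"] root_base_A_2
      by (simp add: simple_A_2 vector_eq cartan_number_vector)
    show "avoids_BP \<Phi> P w (pos_A 3 :: (real ^ 4) set) (refl_word (map simple_A [2, 1, 3, 2]))"
      using avoids[of "pos_A 3 :: (real^4) set" "vector [0, 1, -1, 0]"
          "[vector [1, -1, 0, 0], vector [0, 0, 1, -1]]" "vector [0, 0, 1, -1]"] root_base_A_3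
      by (simp add: simple_A_3 vector_eq cartan_number_vector)
    show "avoids_BP \<Phi> P w (pos_B 3 :: (real ^ 3) set) (refl_word (map (simple_B 3) [2, 1, 3, 2]))"
      using avoids[of "pos_B 3 :: (real^3) set" "vector [0, 1, -1]"
          "[vector [1, -1, 0], vector [0, 0, 1]]" "vector [0, 0, 1]"] root_base_B_3
      by (simp add: simple_B_3 vector_eq cartan_number_vector)
    show "avoids_BP \<Phi> P w (pos_C 3 :: (real ^ 3) set) (refl_word (map (simple_C 3) [2, 1, 3, 2]))"
      using avoids[of "pos_C 3 :: (real^3) set" "vector [0, 1, -1]"
          "[vector [1, -1, 0], vector [0, 0, 2]]" "vector [0, 0, 2]"] root_base_C_3
      by (simp add: simple_C_3 vector_eq cartan_number_vector)
    show "avoids_BP \<Phi> P w (pos_D 4 :: (real ^ 4) set) (refl_word (map (simple_D 4) [2, 1, 3, 4, 2]))"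
      using avoids[of "pos_D 4 :: (real^4) set" "vector [0, 1, -1, 0]"
          "[vector [1, -1, 0, 0], vector [0, 0, 1, -1], vector [0, 0, 1, 1]]" "vector [0, 0, 1, 1]"]
        root_base_D_4
      by (simp add: simple_D_4 vector_eq cartan_number_vector)
    show "avoids_BP \<Phi> P w (pos_B 2) \<pi>"
      if "\<pi> \<in> weyl_group (all_roots (pos_B 2 :: (real ^ 2) set))" "coxeter_length (pos_B 2) \<pi> \<ge> 3" for \<pi>
      using that root_base_B_2 card_length[of "[vector [1, -1], vector [0, 1]] :: (real^2) list"]
      by (intro avoids2) simp_all
    show "avoids_BP \<Phi> P w pos_G2 \<pi>"
      if "\<pi> \<in> weyl_group (all_roots pos_G2)" "coxeter_length pos_G2 \<pi> \<ge> 3" for \<pi>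
      using that root_base_G2 card_length[of "[vector [1, -1, 0], vector [-2, 1, 1]] :: (real^3) list"]
      by (intro avoids2) simp_all
  qed
  then show ?thesis
    using boolean_element_iff[OF assms(3)] dependent_contains_pattern[OF assms(3)] by blast
qed

end
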